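(* Let $F\subset\mathbb{R}^2_\ge$ be a compact convex polygon that is not a single segment, such that its semigroup $\mathcal{P}$ is a simplicial affine convex polygonal semigroup with $\mathcal{P}\neq\mathcal{C}$, and suppose that $F\cap\tau_1$ and $F\cap\tau_2$ are not both segments. Then: 1. if $\mathrm{int}(\mathcal{C})=\mathrm{int}(\mathcal{P})$, the semigroup $\mathcal{P}$ is Cohen-Macaulay if and only if $\mathcal{P}\cap\tau_i=\langle n_i\rangle$ for $i=1,2$; 2. if $\mathrm{int}(\mathcal{C})\neq\mathrm{int}(\mathcal{P})$, the semigroup $\mathcal{P}$ is Cohen-Macaulay if and only if $\Upsilon\cup\Upsilon'\cup\Upsilon''\subset\mathcal{P}$.
   Context: $\mathbb{N}$ denotes the nonnegative integers, $\mathbb{Q}_\ge$ and $\mathbb{R}_\ge$ the nonnegative rationals and reals, $O$ the origin; $\overline{XY}$ is the closed segment joining $X,Y$, and $h\,\overline{XY}=\{hZ\mid Z\in\overline{XY}\}$. For nonempty $G\subset\mathbb{R}^2_\ge$, $L_{\mathbb{Q}_\ge}(G)=\{\sum_{i=1}^p q_if_i\mid p\in\mathbb{N},\ q_i\in\mathbb{Q}_\ge,\ f_i\in G\}$. For a compact convex polygon $F\subset\mathbb{R}^2_\ge$ put $F_i=\{iX\mid X\in F\}$ and $\mathcal{P}=\bigcup_{i=0}^\infty F_i\cap\mathbb{N}^2$ (the polygonal semigroup of $F$), and $\mathcal{C}=L_{\mathbb{Q}_\ge}(\mathcal{P})\cap\mathbb{N}^2$. $\mathcal{P}$ is affine if finitely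 generated; an affine semigroup in $\mathbb{N}^2$ of dimension $2$ is simplicial when it has two generators generating its rational cone. $\tau_1,\tau_2$ are the two extremal rays (from $O$) of $\mathcal{C}$, with $\tau_1$ of greater slope; $n_i$ is the nonzero element of $\mathcal{P}\cap\tau_i$ of least Euclidean norm; $\langle n_i\rangle=\{\lambda n_i\mid\lambda\in\mathbb{N}\}$; $\mathrm{int}(\mathcal{P})=\mathcal{P}\setminus(\tau_1\cup\tau_2)$ and $\mathrm{int}(\mathcal{C})=\mathcal{C}\setminus(\tau_1\cup\tau_2)$. For each $i$, $F\cap\tau_i$ is either a single point (a vertex of $F$) or a (nondegenerate) segment. Fix a field $K$; a semigroup $S$ is called Cohen-Macaulay if the semigroup ring $K[S]$ is a Cohen-Macaulay ring. Case $F\cap\tau_1$ a point: list the vertices of $F$ counterclockwise as $A_1,\dots,A_t$ with $F\cap\tau_1=\{A_1\}$. Let $j$ be the least positive integer such that $j\,\overline{A_1A_t}\cap(j+1)\,\overline{A_1A_2}$ is nonempty and consists of one point, called $V_1$. Let $T_1$ be the triangle with vertices $O,A_1,V_1-jA_1$ and $\stackrel{\circ}{T_1}$ its topological interior. The points $h\,\overline{A_1A_t}\cap(h+1)\,\overline{A_1A_2}$, $h\ge j$, $h\in\mathbb{N}$, lie on one straight line, denoted $\nu_1$ (parallel to $\tau_1$). $n_1$ is a multiple of $A_1$; let $j_1$ be the integer with $j_1A_1=jA_1+n_1$. Let $$\Upsilon_1=\mathrm{ConvexHull}(\{O,\,j_1A_1,\,V_1+n_1,\,\nu_1\cap\tau_2\})\setminus\bigcup_{h\in\mathbb{N},\,h<j_1}\big((\stackrel{\circ}{T_1}\cup(\overline{OA_1}\setminus\{O,A_1\}))+hA_1\big).$$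 Case $F\cap\tau_2$ a point: list the vertices counterclockwise as $B_1,\dots,B_t$ with $F\cap\tau_2=\{B_1\}$. Let $k$ be the least positive integer such that $k\,\overline{B_1B_2}\cap(k+1)\,\overline{B_1B_t}$ is a single point, called $V_2$; $T_2$ the triangle with vertices $O,B_1,V_2-kB_1$, with interior $\stackrel{\circ}{T_2}$; $\nu_2$ the line containing the points $h\,\overline{B_1B_2}\cap(h+1)\,\overline{B_1B_t}$, $h\ge k$, $h\in\mathbb{N}$; $k_1$ the integer with $k_1B_1=kB_1+n_2$; and $$\Upsilon_2=\mathrm{ConvexHull}(\{O,\,k_1B_1,\,V_2+n_2,\,\nu_2\cap\tau_1\})\setminus\bigcup_{h\in\mathbb{N},\,h<k_1}\big((\stackrel{\circ}{T_2}\cup(\overline{OB_1}\setminus\{O,B_1\}))+hB_1\big).$$ If $F\cap\tau_i$ is a segment, put $\nu_i=\tau_i$ and $\Upsilon_i=\{O\}$. Let $Q$ be the point $\nu_1\cap\nu_2$ and set $\Upsilon=(Q+L_{\mathbb{Q}_\ge}(F))\cap\mathbb{N}^2$, $\Upsilon'=\{P\in\Upsilon_1\cap\mathbb{N}^2\mid P+n_1,P+n_2\in\mathcal{P}\}$, $\Upsilon''=\{P\in\Upsilon_2\cap\mathbb{N}^2\mid P+n_1,P+n_2\in\mathcal{P}\}$. *)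

theory Defs
  imports
    "HOL-Analysis.Analysis"
    "HOL-Algebra.Ring_Divisibility"
    "HOL-Library.Poly_Mapping"
    "HOL-Library.Extended_Nat"
begin

section \<open>Cohen-Macaulay rings\<close>

definition regular_sequence :: "('a, 'b) ring_scheme \<Rightarrow> 'a list \<Rightarrow> bool" where
  "regular_sequence R xs \<longleftrightarrow>
     set xs \<subseteq> carrier R \<and>
     (\<forall>i<length xs. \<forall>r\<in>carrier R.
        xs ! i \<otimes>\<^bsub>R\<^esub> r \<in> Idl\<^bsub>R\<^esub> (set (take i xs)) \<longrightarrow> r \<in> Idl\<^bsub>R\<^esub> (set (take i xs))) \<and>
     Idl\<^bsub>R\<^esub> (set xs) \<noteq> carrier R"

definition ideal_depth :: "('a, 'b) ring_scheme \<Rightarrow> 'a set \<Rightarrow> enat" where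
  "ideal_depth R I = (SUP xs\<in>{xs. set xs \<subseteq> I \<and> regular_sequence R xs}. enat (length xs))"

definition prime_codim :: "('a, 'b) ring_scheme \<Rightarrow> 'a set \<Rightarrow> enat" where
  "prime_codim R M =
     (SUP n\<in>{n. \<exists>p. (\<forall>i\<le>n. primeideal (p i) R) \<and> (\<forall>i<n. p i \<subset> p (Suc i)) \<and> p n = M}. enat n)"

text \<open>
  The definition of Eisenbud, Commutative Algebra, Section 18.2: a Noetherian ring is
  Cohen-Macaulay if depth and codimension agree at every maximal ideal.
\<close>

definition Cohen_Macaulay_ring :: "('a, 'b) ring_scheme \<Rightarrow> bool" where
  "Cohen_Macaulay_ring R \<longleftrightarrow>
     cring R \<and> noetherian_ring R \<and>
     (\<forall>M. maximalideal M R \<longrightarrow> ideal_depth R M = prime_codim R M)"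

text \<open>
  The semigroup ring \<open>K[S]\<close> of a submonoid \<open>S\<close>, as a subring of the monoid ring of the ambient
  monoid; multiplication of finitely supported functions is convolution.
\<close>

definition semigroup_ring :: "'m::comm_monoid_add set \<Rightarrow> ('m \<Rightarrow>\<^sub>0 'k::comm_ring_1) ring" where
  "semigroup_ring S =
     \<lparr>carrier = {f. Poly_Mapping.keys f \<subseteq> S}, mult = (*), one = 1, zero = 0, add = (+)\<rparr>"


section \<open>Affine semigroups and cones in the plane\<close>

text \<open>Lattice points are represented as points of the real plane with natural coordinates.\<close>

abbreviation nat_plane :: "(real \<times> real) set" where
  "nat_plane \<equiv> \<nat> \<times> \<nat>"

abbreviation nonneg_plane :: "(real \<times> real) set" where
  "nonneg_plane \<equiv> {0..} \<times> {0..}"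

definition rat_cone :: "'a::real_vector set \<Rightarrow> 'a set" where
  "rat_cone G =
     {\<Sum>i<p. q i *\<^sub>R f i | (p::nat) q f. \<forall>i<p. q i \<in> \<rat> \<and> 0 \<le> q i \<and> f i \<in> G}"

definition generated_semigroup :: "'a::real_vector set \<Rightarrow> 'a set" where
  "generated_semigroup G =
     {\<Sum>i<p. real (c i) *\<^sub>R f i | (p::nat) (c::nat \<Rightarrow> nat) f. \<forall>i<p. f i \<in> G}"

text \<open>
  The dimension of a semigroup of lattice points is the rank of the group it generates, which
  is the dimension of its real span.
\<close>

definition simplicial_affine :: "(real \<times> real) set \<Rightarrow> bool" where
  "simplicial_affine S \<longleftrightarrow>
     S \<subseteq> nat_plane \<and> dim S = 2 \<and>
     (\<exists>G. finite G \<and> S = generated_semigroup G \<and>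
          (\<exists>a\<in>G. \<exists>b\<in>G. rat_cone {a, b} = rat_cone S))"

definition polygonal_semigroup :: "(real \<times> real) set \<Rightarrow> (real \<times> real) set" where
  "polygonal_semigroup F = (\<Union>i::nat. (\<lambda>X. real i *\<^sub>R X) ` F) \<inter> nat_plane"

text \<open>Positive iff \<open>w\<close> is counterclockwise from \<open>v\<close> (by an angle less than a half turn).\<close>

definition cross2 :: "real \<times> real \<Rightarrow> real \<times> real \<Rightarrow> real" where
  "cross2 v w = fst v * snd w - snd v * fst w"

definition extremal_ray :: "(real \<times> real) set \<Rightarrow> (real \<times> real) set \<Rightarrow> bool" where
  "extremal_ray C \<tau> \<longleftrightarrow>
     (\<exists>v. v \<noteq> 0 \<and> \<tau> = {t *\<^sub>R v | t. 0 \<le> t}) \<and> \<tau> face_of (convex_cone hull C)"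

text \<open>
  For vectors in the nonnegative quadrant, \<open>cross2 w v > 0\<close> says that \<open>v\<close> has greater slope than
  \<open>w\<close>, the slope of a vertical vector being infinite.
\<close>

definition greater_slope :: "(real \<times> real) set \<Rightarrow> (real \<times> real) set \<Rightarrow> bool" where
  "greater_slope \<tau> \<tau>' \<longleftrightarrow> (\<exists>v\<in>\<tau>. \<exists>w\<in>\<tau>'. cross2 w v > 0)"


section \<open>Polygons\<close>

definition nondegenerate_segment :: "'a::real_vector set \<Rightarrow> bool" where
  "nondegenerate_segment S \<longleftrightarrow> (\<exists>a b. a \<noteq> b \<and> S = closed_segment a b)"

text \<open>
  An edge of \<open>F\<close> is traversed counterclockwise iff \<open>F\<close> lies to the left of it.
\<close>

definition ccw_vertices :: "(real \<times> real) set \<Rightarrow> (real \<times> real) list \<Rightarrow> bool" where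
  "ccw_vertices F vs \<longleftrightarrow>
     distinct vs \<and> set vs = {x. x extreme_point_of F} \<and>
     (\<forall>i<length vs. \<forall>x\<in>F.
        0 \<le> cross2 (vs ! ((i + 1) mod length vs) - vs ! i) (x - vs ! i))"


section \<open>The strip of gaps along an extremal ray\<close>

text \<open>
  The two extremal rays \<open>\<tau>\<^sub>1\<close>, \<open>\<tau>\<^sub>2\<close> are treated uniformly. Here \<open>a\<close> is the only point of \<open>F\<close> on the
  ray, a vertex, and \<open>p\<close>, \<open>q\<close> are its neighbours: if the vertices are listed counterclockwise
  starting from \<open>a\<close>, then \<open>p\<close> is the last and \<open>q\<close> the second one for \<open>\<tau>\<^sub>1\<close> (the ray of greater
  slope), and conversely for \<open>\<tau>\<^sub>2\<close>. So \<open>q\<close> is on the side of \<open>F\<close> facing the origin, and \<open>gap_meet\<close>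
  intersects the edge from \<open>a\<close> to \<open>p\<close> of the \<open>h\<close>-fold polygon with the edge from \<open>a\<close> to \<open>q\<close> of
  the \<open>(h + 1)\<close>-fold polygon.
\<close>

definition gap_meet ::
    "real \<times> real \<Rightarrow> real \<times> real \<Rightarrow> real \<times> real \<Rightarrow> nat \<Rightarrow> (real \<times> real) set" where
  "gap_meet a p q h =
     (\<lambda>X. real h *\<^sub>R X) ` closed_segment a p \<inter>
     (\<lambda>X. real (h + 1) *\<^sub>R X) ` closed_segment a q"

definition gap_level :: "real \<times> real \<Rightarrow> real \<times> real \<Rightarrow> real \<times> real \<Rightarrow> nat" where
  "gap_level a p q = (LEAST j. 0 < j \<and> is_singleton (gap_meet a p q j))"

definition gap_point :: "real \<times> real \<Rightarrow> real \<times> real \<Rightarrow> real \<times> real \<Rightarrow> real \<times> real" where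
  "gap_point a p q = the_elem (gap_meet a p q (gap_level a p q))"

definition gap_triangle ::
    "real \<times> real \<Rightarrow> real \<times> real \<Rightarrow> real \<times> real \<Rightarrow> (real \<times> real) set" where
  "gap_triangle a p q = convex hull {0, a, gap_point a p q - real (gap_level a p q) *\<^sub>R a}"

definition gap_line ::
    "real \<times> real \<Rightarrow> real \<times> real \<Rightarrow> real \<times> real \<Rightarrow> (real \<times> real) set" where
  "gap_line a p q = affine hull (\<Union>h\<in>{gap_level a p q..}. gap_meet a p q h)"

text \<open>\<open>n\<close> is the least nonzero semigroup element on the ray, a multiple of \<open>a\<close>.\<close>

definition shifted_level ::
    "real \<times> real \<Rightarrow> real \<times> real \<Rightarrow> real \<times> real \<Rightarrow> real \<times> real \<Rightarrow> int" where
  "shifted_level a p q n =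
     (THE c. real_of_int c *\<^sub>R a = real (gap_level a p q) *\<^sub>R a + n)"

text \<open>
  In \<open>gap_region\<close>, \<open>\<tau>'\<close> is the other extremal ray, so that \<open>gap_line a p q \<inter> \<tau>'\<close> consists of a
  single point.
\<close>

definition gap_region ::
    "real \<times> real \<Rightarrow> real \<times> real \<Rightarrow> real \<times> real \<Rightarrow> real \<times> real \<Rightarrow> (real \<times> real) set
      \<Rightarrow> (real \<times> real) set" where
  "gap_region a p q n \<tau>' =
     convex hull ({0, real_of_int (shifted_level a p q n) *\<^sub>R a, gap_point a p q + n} \<union>
                  (gap_line a p q \<inter> \<tau>')) -
     (\<Union>h\<in>{h::nat. int h < shifted_level a p q n}.
        (\<lambda>X. X + real h *\<^sub>R a) ` (interior (gap_triangle a p q) \<union> open_segment 0 a))"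

text \<open>
  \<open>\<nu>\<^sub>1\<close>, \<open>\<Upsilon>\<^sub>1\<close> for the vertices \<open>A\<close> (with \<open>A ! 0\<close> on \<open>\<tau>\<^sub>1\<close>), and \<open>\<nu>\<^sub>2\<close>, \<open>\<Upsilon>\<^sub>2\<close> for the vertices \<open>B\<close>
  (with \<open>B ! 0\<close> on \<open>\<tau>\<^sub>2\<close>), both listed counterclockwise. The lists matter only if the ray
  meets \<open>F\<close> in a single point.
\<close>

definition nu1 :: "(real \<times> real) set \<Rightarrow> (real \<times> real) set \<Rightarrow> (real \<times> real) list
    \<Rightarrow> (real \<times> real) set" where
  "nu1 F \<tau>1 A =
     (if nondegenerate_segment (F \<inter> \<tau>1) then \<tau>1 else gap_line (A ! 0) (last A) (A ! 1))"

definition nu2 :: "(real \<times> real) set \<Rightarrow> (real \<times> real) set \<Rightarrow> (real \<times> real) list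
    \<Rightarrow> (real \<times> real) set" where
  "nu2 F \<tau>2 B =
     (if nondegenerate_segment (F \<inter> \<tau>2) then \<tau>2 else gap_line (B ! 0) (B ! 1) (last B))"

definition Upsilon1 :: "(real \<times> real) set \<Rightarrow> (real \<times> real) set \<Rightarrow> (real \<times> real) set
    \<Rightarrow> real \<times> real \<Rightarrow> (real \<times> real) list \<Rightarrow> (real \<times> real) set" where
  "Upsilon1 F \<tau>1 \<tau>2 n1 A =
     (if nondegenerate_segment (F \<inter> \<tau>1) then {0}
      else gap_region (A ! 0) (last A) (A ! 1) n1 \<tau>2)"

definition Upsilon2 :: "(real \<times> real) set \<Rightarrow> (real \<times> real) set \<Rightarrow> (real \<times> real) set
    \<Rightarrow> real \<times> real \<Rightarrow> (real \<times> real) list \<Rightarrow> (real \<times> real) set" where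
  "Upsilon2 F \<tau>1 \<tau>2 n2 B =
     (if nondegenerate_segment (F \<inter> \<tau>2) then {0}
      else gap_region (B ! 0) (B ! 1) (last B) n2 \<tau>1)"

end

theory Submission
  imports Defs
begin

text \<open>
  Both equivalences go through one combinatorial condition, the gap criterion: a plane vector \<open>z\<close>
  lies in \<open>P\<close> as soon as \<open>z + n1\<close> and \<open>z + n2\<close> do.

  \<^bold>\<open>The criterion characterizes Cohen-Macaulayness\<close> (\<open>Cohen_Macaulay_iff_gap_criterion\<close>). Write \<open>x\<^sup>p\<close> for
  the monomial of \<open>p \<in> P\<close>, and \<open>u\<close>, \<open>v\<close> for the monomials of \<open>n1\<close>, \<open>n2\<close>. Every element of \<open>P\<close> is an
  element of a finite set plus multiples of \<open>n1\<close> and \<open>n2\<close>, so \<open>K[P]\<close> is a finite module over \<open>K[u, v]\<close>,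
  and the criterion says that \<open>u\<close>, \<open>v\<close> is a regular sequence. If it fails, there is an exponent
  \<open>w\<close> outside \<open>P\<close> with \<open>w + q \<in> P\<close> for all nonzero \<open>q \<in> P\<close> (\<open>exists_socle_exponent\<close>). For \<open>f\<close>, \<open>g\<close> in the
  ideal \<open>M\<close> of polynomials without constant term, \<open>g (f x\<^sup>w)\<close> is then a multiple of \<open>f\<close> although
  \<open>f x\<^sup>w\<close> is not one, so \<open>M\<close> has depth at most 1, while its codimension is at least 2. If the
  criterion holds, let \<open>M\<close> be any maximal ideal. By a version of Zariski's lemma
  (\<open>maximal_quotient_finite\<close>) the field \<open>K[P] / M\<close> is finite over \<open>K\<close>, so \<open>M\<close> contains a nonzero
  polynomial in \<open>u\<close> and one in \<open>v\<close>. Comparing leading exponents turns the criterion into the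
  regularity of this pair (\<open>regular_pair\<close>), so the depth is at least 2. For primes of any commutative ring the depth
  is at most the codimension (\<open>ideal_depth_le_prime_codim\<close>), and here the codimension is at most 2 because three
  elements of \<open>K[P]\<close> are algebraically dependent (\<open>no_prime_chain_3\<close>).

  \<^bold>\<open>The gaps of a polygonal semigroup.\<close> A lattice point \<open>z\<close> of the cone is in \<open>P\<close> iff the set of all
  real \<open>r \<ge> 0\<close> with \<open>z \<in> r F\<close>, an interval, contains an integer. Near a ray that meets \<open>F\<close> in a vertex \<open>a\<close>
  only, the ends of this interval are the values at \<open>z\<close> of the two linear forms that are 1 on the
  edges at \<open>a\<close>. Their difference, the width, is proportional to the distance from the
  ray, and \<open>\<nu>\<close> is the line of width 1. Beyond the lines \<open>\<nu>\<^sub>1\<close> and \<open>\<nu>\<^sub>2\<close> and far from the origin the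
  interval has length at least 1, so nothing is missing there (\<open>clear_imp_cofinite\<close>). Hence the
  criterion gives \<open>\<Upsilon> \<subseteq> P\<close> by descent from infinity; and \<open>\<Upsilon>'\<close>, \<open>\<Upsilon>''\<close> consist of instances of the
  criterion. Conversely, let \<open>z + n1\<close> and \<open>z + n2\<close> be in \<open>P\<close>. If \<open>z\<close> has width at most 1 at one of the vertices,
  there is an integer between the two forms at \<open>z\<close>, because there is one at \<open>z + n\<close> and both forms grow by
  the same integer along \<open>n\<close>; so \<open>z\<close> is in \<open>P\<close> or in the strip described by \<open>\<Upsilon>\<^sub>1\<close> or \<open>\<Upsilon>\<^sub>2\<close>
  (\<open>strip_dichotomy\<close>). Otherwise \<open>z \<in> \<Upsilon>\<close>.

  \<^bold>\<open>Equal interiors.\<close> If \<open>int(C) = int(P)\<close>, then \<open>z + n2\<close> is in \<open>P\<close> for every nonzero lattice point \<open>z\<close> of the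
  first ray, so on that ray the criterion says that \<open>n1\<close> can be subtracted from an element of \<open>P\<close>
  whenever the result is a nonzero point of the ray. As \<open>n1\<close> is the shortest element, this
  leaves only its multiples (\<open>ray_multiples\<close>).
\<close>

section \<open>Plane vectors\<close>

lemma cross2_self [simp]: "cross2 x x = 0"
  by (simp add: cross2_def)
lemma cross2_flip: "cross2 y x = - cross2 x y"
  by (simp add: cross2_def)
lemma cross2_scale_right: "cross2 x (c *\<^sub>R y) = c * cross2 x y"
  by (simp add: cross2_def algebra_simps)
lemma cross2_scale_left: "cross2 (c *\<^sub>R x) y = c * cross2 x y"
  by (simp add: cross2_def algebra_simps)
lemma cross2_add_right: "cross2 x (y + z) = cross2 x y + cross2 x z"
  by (simp add: cross2_def algebra_simps)
lemma cross2_add_left: "cross2 (x + y) z = cross2 x z + cross2 y z"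
  by (simp add: cross2_def algebra_simps)
lemma cross2_diff_right: "cross2 x (y - z) = cross2 x y - cross2 x z"
  by (simp add: cross2_def algebra_simps)
lemma cross2_diff_left: "cross2 (x - y) z = cross2 x z - cross2 y z"
  by (simp add: cross2_def algebra_simps)
lemma cross2_zero [simp]: "cross2 0 x = 0" "cross2 x 0 = 0"
  by (simp_all add: cross2_def)

text \<open>Cramer's rule, without denominators.\<close>

lemma cramer_plane: "cross2 v w *\<^sub>R x = cross2 v x *\<^sub>R w + cross2 x w *\<^sub>R v"
  by (cases v; cases w; cases x) (simp add: cross2_def algebra_simps)

lemma cross2_nat_of_nonneg:
  assumes "x \<in> nat_plane" "y \<in> nat_plane" "0 \<le> cross2 x y"
  obtains n :: nat where "cross2 x y = real n"
proof -
  have "cross2 x y \<in> \<int>"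
    using assms(1,2) unfolding cross2_def mem_Times_iff
    using Nats_subset_Ints by (intro Ints_diff Ints_mult) blast+
  then show thesis
    using assms(3) that by (metis Ints_cases of_int_0_le_iff of_int_of_nat_eq zero_le_imp_eq_int)
qed

section \<open>Depth is at most codimension\<close>

text \<open>
  Krull's theorem: an ideal that is maximal among those avoiding a multiplicative set is prime.
\<close>

lemma exists_prime_avoiding:
  fixes R (structure)
  assumes "cring R" and I: "ideal I R"
    and W: "\<one> \<in> W" "\<And>v w. v \<in> W \<Longrightarrow> w \<in> W \<Longrightarrow> v \<otimes> w \<in> W" "W \<inter> I = {}"
  shows "\<exists>Q. primeideal Q R \<and> I \<subseteq> Q \<and> W \<inter> Q = {}"
proof -
  interpret cring R by fact
  define \<A> where "\<A> = {J. ideal J R \<and> I \<subseteq> J \<and> W \<inter> J = {}}"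
  have "\<exists>Q\<in>\<A>. \<forall>J\<in>\<A>. Q \<subseteq> J \<longrightarrow> J = Q"
  proof (rule subset_Zorn)
    fix C assume C: "subset.chain \<A> C"
    show "\<exists>U\<in>\<A>. \<forall>X\<in>C. X \<subseteq> U"
    proof (cases "C = {}")
      case True
      with I W show ?thesis by (auto simp: \<A>_def)
    next
      case False
      have "subset.chain {J. ideal J R} C"
        using C by (auto simp: \<A>_def pred_on.chain_def)
      then have "ideal (\<Union>C) R"
        using chain_Union_is_ideal[of C] False by auto
      moreover have "I \<subseteq> \<Union>C" "W \<inter> \<Union>C = {}"
        using C False unfolding \<A>_def pred_on.chain_def by blast+
      ultimately show ?thesis by (auto simp: \<A>_def)
    qed
  qed
  then obtain Q where Q: "ideal Q R" "I \<subseteq> Q" "W \<inter> Q = {}"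
    and max: "\<And>J. ideal J R \<Longrightarrow> Q \<subseteq> J \<Longrightarrow> W \<inter> J = {} \<Longrightarrow> J = Q"
    by (auto simp: \<A>_def)
  interpret Q: ideal Q R by fact
  have meets: "\<exists>w\<in>W. \<exists>y\<in>Q. \<exists>r\<in>carrier R. w = y \<oplus> r \<otimes> a" if a: "a \<in> carrier R" "a \<notin> Q" for a
  proof -
    have id: "ideal (Q <+>\<^bsub>R\<^esub> PIdl a) R"
      by (intro add_ideals Q cgenideal_ideal a)
    have "x \<in> Q <+>\<^bsub>R\<^esub> PIdl a" if "x \<in> Q" for x
    proof -
      have "x = x \<oplus> \<zero> \<otimes> a" using that a by (simp add: Q.Icarr)
      then show ?thesis unfolding set_add_def' cgenideal_def using that by blast
    qed
    moreover have "a \<in> Q <+>\<^bsub>R\<^esub> PIdl a"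
    proof -
      have "a = \<zero> \<oplus> \<one> \<otimes> a" using a by simp
      then show ?thesis unfolding set_add_def' cgenideal_def
        using Q.zero_closed one_closed by blast
    qed
    ultimately have "W \<inter> (Q <+>\<^bsub>R\<^esub> PIdl a) \<noteq> {}"
      using max[OF id] a by blast
    then show ?thesis unfolding set_add_def' cgenideal_def by blast
  qed
  have "primeideal Q R"
  proof (rule primeidealI[OF Q(1) assms(1)])
    show "carrier R \<noteq> Q" using W Q by auto
    fix a b assume ab: "a \<in> carrier R" "b \<in> carrier R" "a \<otimes> b \<in> Q"
    show "a \<in> Q \<or> b \<in> Q"
    proof (rule ccontr)
      assume "\<not> (a \<in> Q \<or> b \<in> Q)"
      then obtain v y r w z s where v: "v \<in> W" "y \<in> Q" "r \<in> carrier R" "v = y \<oplus> r \<otimes> a"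
        and w: "w \<in> W" "z \<in> Q" "s \<in> carrier R" "w = z \<oplus> s \<otimes> b"
        using meets ab by metis
      have yz: "y \<in> carrier R" "z \<in> carrier R" using v w by (auto simp: Q.Icarr)
      have "v \<otimes> w = y \<otimes> (z \<oplus> s \<otimes> b) \<oplus> (z \<otimes> (r \<otimes> a) \<oplus> (r \<otimes> s) \<otimes> (a \<otimes> b))"
        unfolding v(4) w(4) using v(3) w(3) ab(1,2) yz
        by (simp add: l_distr r_distr m_ac a_ac)
      moreover have "y \<otimes> (z \<oplus> s \<otimes> b) \<in> Q"
        by (rule Q.I_r_closed) (use v w ab yz in auto)
      moreover have "z \<otimes> (r \<otimes> a) \<in> Q"
        by (rule Q.I_r_closed) (use v w ab yz in auto)
      moreover have "(r \<otimes> s) \<otimes> (a \<otimes> b) \<in> Q"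
        by (rule Q.I_l_closed) (use v w ab yz in auto)
      ultimately have "v \<otimes> w \<in> Q" by simp
      then show False using W(2)[OF v(1) w(1)] Q(3) by blast
    qed
  qed
  then show ?thesis using Q by blast
qed

text \<open>
  The multiplicative set to avoid consists of the products \<open>s x\<^sup>n\<close> with \<open>s \<notin> M\<close>: the prime then lies
  inside \<open>M\<close> and does not contain \<open>x\<close>. It is disjoint from \<open>I\<close> since \<open>x\<close> can be cancelled modulo \<open>I\<close>.
\<close>

lemma prime_below_regular_element:
  fixes R (structure)
  assumes M: "primeideal M R" and I: "ideal I R" "I \<subseteq> M" and x: "x \<in> carrier R"
    and reg: "\<And>r. r \<in> carrier R \<Longrightarrow> x \<otimes> r \<in> I \<Longrightarrow> r \<in> I"
  shows "\<exists>Q. primeideal Q R \<and> I \<subseteq> Q \<and> Q \<subseteq> M \<and> x \<notin> Q"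
proof -
  interpret M: primeideal M R by fact
  interpret I: ideal I R by fact
  define W where "W = {s \<otimes> x [^] (n::nat) | s n. s \<in> carrier R - M}"
  have one: "\<one> \<notin> M" using M.one_imp_carrier M.I_notcarr by auto
  have "\<exists>Q. primeideal Q R \<and> I \<subseteq> Q \<and> W \<inter> Q = {}"
  proof (rule exists_prime_avoiding)
    show "cring R" by (rule M.is_cring)
    show "ideal I R" by fact
    have "\<one> = \<one> \<otimes> x [^] (0::nat)" by simp
    then show "\<one> \<in> W" using one unfolding W_def by blast
    show "v \<otimes> w \<in> W" if vw: "v \<in> W" "w \<in> W" for v w
    proof -
      obtain s n t m where st: "s \<in> carrier R - M" "t \<in> carrier R - M"
        and "v = s \<otimes> x [^] (n::nat)" "w = t \<otimes> x [^] (m::nat)"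
        using vw by (auto simp: W_def)
      then have "v \<otimes> w = (s \<otimes> t) \<otimes> x [^] (n + m)"
        using x by (simp add: M.m_ac M.nat_pow_mult[symmetric])
      moreover have "s \<otimes> t \<in> carrier R - M" using st M.I_prime by auto
      ultimately show ?thesis unfolding W_def by blast
    qed
    have pw: "r \<in> I" if "r \<in> carrier R" "x [^] (n::nat) \<otimes> r \<in> I" for r n
      using that
    proof (induction n)
      case (Suc n)
      have "x \<otimes> (x [^] n \<otimes> r) \<in> I" using Suc x by (simp add: M.m_ac)
      then have "x [^] n \<otimes> r \<in> I" using reg[of "x [^] n \<otimes> r"] Suc.prems x by simp
      then show ?case using Suc by blast
    qed simp
    show "W \<inter> I = {}"
    proof (rule ccontr)
      assume "W \<inter> I \<noteq> {}"
      then obtain s n where s: "s \<in> carrier R - M" "s \<otimes> x [^] (n::nat) \<in> I"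
        by (auto simp: W_def)
      then have "s \<in> I" using pw[of s n] x by (simp add: M.m_comm)
      then show False using s I by auto
    qed
  qed
  then obtain Q where Q: "primeideal Q R" "I \<subseteq> Q" "W \<inter> Q = {}" by blast
  interpret Q: primeideal Q R by fact
  have "Q \<subseteq> M"
  proof
    fix q assume q: "q \<in> Q"
    then have "q = q \<otimes> x [^] (0::nat)" by (simp add: Q.Icarr)
    then show "q \<in> M" using q Q unfolding W_def by (blast intro: Q.Icarr)
  qed
  moreover have "x \<notin> Q"
  proof -
    have "x = \<one> \<otimes> x [^] (1::nat)" using x by simp
    then show ?thesis using one Q unfolding W_def by blast
  qed
  ultimately show ?thesis using Q by blast
qed

text \<open>The chain is built from the top, each step removing the last element of the sequence.\<close>

lemma regular_sequence_imp_prime_chain: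
  fixes R (structure)
  assumes "primeideal M R" "set xs \<subseteq> M"
    and "\<And>i r. i < length xs \<Longrightarrow> r \<in> carrier R \<Longrightarrow> xs ! i \<otimes> r \<in> Idl (set (take i xs)) \<Longrightarrow>
           r \<in> Idl (set (take i xs))"
  shows "\<exists>p. (\<forall>i\<le>length xs. primeideal (p i) R) \<and> (\<forall>i<length xs. p i \<subset> p (Suc i)) \<and>
             p (length xs) = M"
  using assms
proof (induction xs arbitrary: M rule: rev_induct)
  case Nil
  then show ?case by auto
next
  case (snoc x ys)
  interpret M: primeideal M R by fact
  have sub: "set ys \<subseteq> M" "x \<in> M" using snoc by auto
  then have ysc: "set ys \<subseteq> carrier R" "x \<in> carrier R" using M.Icarr by auto
  have "\<exists>Q. primeideal Q R \<and> Idl (set ys) \<subseteq> Q \<and> Q \<subseteq> M \<and> x \<notin> Q"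
  proof (rule prime_below_regular_element)
    show "ideal (Idl (set ys)) R" by (rule M.genideal_ideal) fact
    show "Idl (set ys) \<subseteq> M" by (rule M.genideal_minimal) (use sub M.is_ideal in auto)
    show "r \<in> Idl (set ys)" if "r \<in> carrier R" "x \<otimes> r \<in> Idl (set ys)" for r
      using snoc.prems(3)[of "length ys" r] that by simp
  qed (use snoc ysc in auto)
  then obtain Q where Q: "primeideal Q R" "Idl (set ys) \<subseteq> Q" "Q \<subseteq> M" "x \<notin> Q" by blast
  have "\<exists>p. (\<forall>i\<le>length ys. primeideal (p i) R) \<and> (\<forall>i<length ys. p i \<subset> p (Suc i)) \<and>
             p (length ys) = Q"
  proof (rule snoc.IH)
    show "primeideal Q R" by fact
    show "set ys \<subseteq> Q" using M.genideal_self[OF ysc(1)] Q by blast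
    show "r \<in> Idl (set (take i ys))"
      if "i < length ys" "r \<in> carrier R" "ys ! i \<otimes> r \<in> Idl (set (take i ys))" for i r
      using snoc.prems(3)[of i r] that by (simp add: nth_append)
  qed
  then obtain p where p: "\<And>i. i \<le> length ys \<Longrightarrow> primeideal (p i) R"
    "\<And>i. i < length ys \<Longrightarrow> p i \<subset> p (Suc i)" "p (length ys) = Q" by blast
  show ?case
    by (rule exI[of _ "p(Suc (length ys) := M)"])
      (use p Q sub snoc.prems(1) in \<open>auto simp: le_Suc_eq less_Suc_eq\<close>)
qed

lemma ideal_depth_le_prime_codim:
  assumes "primeideal M R"
  shows "ideal_depth R M \<le> prime_codim R M"
  unfolding ideal_depth_def
proof (rule SUP_least)
  fix xs assume xs: "xs \<in> {xs. set xs \<subseteq> M \<and> regular_sequence R xs}"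
  have "length xs \<in> {n. \<exists>p. (\<forall>i\<le>n. primeideal (p i) R) \<and> (\<forall>i<n. p i \<subset> p (Suc i)) \<and> p n = M}"
    using regular_sequence_imp_prime_chain[OF assms, of xs] xs
    by (auto simp: regular_sequence_def)
  then show "enat (length xs) \<le> prime_codim R M"
    unfolding prime_codim_def by (rule SUP_upper)
qed

section \<open>Linear dependence\<close>

text \<open>
  Gaussian elimination; the vectors are indexed by \<open>I\<close> because repetitions among them must count
  as dependencies.
\<close>

lemma exists_linear_dependency:
  fixes v :: "'i \<Rightarrow> 'x \<Rightarrow> 'k::field"
  assumes "finite X" "finite I" "card X < card I"
  shows "\<exists>c. (\<exists>i\<in>I. c i \<noteq> 0) \<and> (\<forall>x\<in>X. (\<Sum>i\<in>I. c i * v i x) = 0)"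
  using assms
proof (induction X arbitrary: I v rule: finite_induct)
  case empty
  then have "I \<noteq> {}" by auto
  then show ?case by (intro exI[of _ "\<lambda>_. 1"]) auto
next
  case (insert x X)
  show ?case
  proof (cases "\<forall>i\<in>I. v i x = 0")
    case True
    have "card X < card I" using insert by simp
    then obtain c where "\<exists>i\<in>I. c i \<noteq> 0" "\<forall>x\<in>X. (\<Sum>i\<in>I. c i * v i x) = 0"
      using insert.IH[of I v] insert.prems by blast
    then show ?thesis using True by (intro exI[of _ c]) auto
  next
    case False
    then obtain j where j: "j \<in> I" "v j x \<noteq> 0" by auto
    define J where "J = I - {j}"
    define w where "w i y = v i y - v i x / v j x * v j y" for i y
    have "card X < card J" using insert j by (simp add: J_def)
    then obtain c where c: "\<exists>i\<in>J. c i \<noteq> 0" "\<forall>y\<in>X. (\<Sum>i\<in>J. c i * w i y) = 0"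
      using insert.IH[of J w] insert.prems by (auto simp: J_def)
    define d where "d i = (if i = j then - (\<Sum>i\<in>J. c i * (v i x / v j x)) else c i)" for i
    have "(\<Sum>i\<in>I. d i * v i y) = (\<Sum>i\<in>J. c i * w i y)" for y
    proof -
      have "(\<Sum>i\<in>I. d i * v i y) = d j * v j y + (\<Sum>i\<in>J. d i * v i y)"
        using insert.prems j by (simp add: J_def sum.remove)
      also have "(\<Sum>i\<in>J. d i * v i y) = (\<Sum>i\<in>J. c i * v i y)"
        by (rule sum.cong) (auto simp: d_def J_def)
      finally show ?thesis
        by (simp add: d_def w_def right_diff_distrib sum_subtractf sum_distrib_right mult.assoc)
    qed
    moreover have "(\<Sum>i\<in>J. c i * w i x) = 0" using j by (simp add: w_def)
    moreover have "\<exists>i\<in>I. d i \<noteq> 0" using c by (auto simp: d_def J_def)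
    ultimately show ?thesis using c by (intro exI[of _ d]) auto
  qed
qed

section \<open>Polynomials supported in a semigroup\<close>

abbreviation "single \<equiv> Poly_Mapping.single"
abbreviation "keys \<equiv> Poly_Mapping.keys"
abbreviation "lookup \<equiv> Poly_Mapping.lookup"

lemma lookup_scale: "lookup (single 0 c * f) p = c * lookup f p"
  for f :: "'m::comm_monoid_add \<Rightarrow>\<^sub>0 'k::comm_ring_1"
  by (simp flip: mult_map_scale_conv_mult add: map.rep_eq when_def)

lemma sum_single_keys: "(\<Sum>p\<in>keys f. single p (lookup f p)) = f"
  by (rule poly_mapping_eqI)
    (auto simp: lookup_sum lookup_single when_def sum.delta' in_keys_iff)

lemma exists_poly_mapping_dependency:
  fixes v :: "'i \<Rightarrow> 'm::comm_monoid_add \<Rightarrow>\<^sub>0 'k::field"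
  assumes "finite X" "finite I" "card X < card I" "\<And>i. i \<in> I \<Longrightarrow> keys (v i) \<subseteq> X"
  shows "\<exists>c. (\<exists>i\<in>I. c i \<noteq> 0) \<and> (\<Sum>i\<in>I. single 0 (c i) * v i) = 0"
proof -
  obtain c where c: "\<exists>i\<in>I. c i \<noteq> 0" "\<forall>x\<in>X. (\<Sum>i\<in>I. c i * lookup (v i) x) = 0"
    using exists_linear_dependency[OF assms(1-3), of "\<lambda>i. lookup (v i)"] by blast
  have "(\<Sum>i\<in>I. single 0 (c i) * v i) = 0"
  proof (rule poly_mapping_eqI)
    fix x
    show "lookup (\<Sum>i\<in>I. single 0 (c i) * v i) x = lookup 0 x"
    proof (cases "x \<in> X")
      case True
      then show ?thesis using c by (simp add: lookup_sum lookup_scale)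
    next
      case False
      then have "lookup (v i) x = 0" if "i \<in> I" for i
        using assms(4)[OF that] by (auto simp: in_keys_iff)
      then show ?thesis by (simp add: lookup_sum lookup_scale)
    qed
  qed
  with c show ?thesis by blast
qed

text \<open>For a submonoid \<open>S\<close> this is the carrier of \<open>K[S]\<close>.\<close>

definition supported :: "'m set \<Rightarrow> ('m \<Rightarrow>\<^sub>0 'k::zero) set" where
  "supported S = {f. keys f \<subseteq> S}"

text \<open>
  The exponent \<open>p\<close> is the only one of maximal \<open>\<phi>\<close>-value. Nothing is asked of \<open>\<phi>\<close> on other exponents, so
  the same notion serves for a height that separates all lattice points and for weights with
  ties.
\<close>

definition leads :: "('m \<Rightarrow> real) \<Rightarrow> 'm \<Rightarrow> ('m \<Rightarrow>\<^sub>0 'k::zero) \<Rightarrow> bool" where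
  "leads \<phi> p f \<longleftrightarrow> p \<in> keys f \<and> (\<forall>q\<in>keys f. q \<noteq> p \<longrightarrow> \<phi> q < \<phi> p)"

lemma exists_leads:
  assumes "f \<noteq> 0" "inj_on \<phi> (keys f)"
  shows "\<exists>p. leads \<phi> p f"
proof -
  have ne: "keys f \<noteq> {}"
    using assms(1) by (auto simp: in_keys_iff intro!: poly_mapping_eqI)
  then have "Max (\<phi> ` keys f) \<in> \<phi> ` keys f" by simp
  then obtain p where p: "p \<in> keys f" "Max (\<phi> ` keys f) = \<phi> p" by blast
  have "\<phi> q < \<phi> p" if "q \<in> keys f" "q \<noteq> p" for q
  proof -
    have "\<phi> q \<le> \<phi> p" using that p(2)[symmetric] by simp
    moreover have "\<phi> q \<noteq> \<phi> p" using inj_onD[OF assms(2)] that p by blast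
    ultimately show ?thesis by simp
  qed
  then show ?thesis unfolding leads_def using p by blast
qed

text \<open>
  All products of other pairs of terms have smaller \<open>\<phi>\<close>-value, as \<open>\<phi>\<close> is additive.
\<close>

lemma leads_mult:
  fixes f g :: "'m::comm_monoid_add \<Rightarrow>\<^sub>0 'k::idom"
  assumes add: "\<And>x y. \<phi> (x + y) = \<phi> x + \<phi> y" and f: "leads \<phi> p f" and g: "leads \<phi> q g"
  shows "leads \<phi> (p + q) (f * g)"
    and "lookup (f * g) (p + q) = lookup f p * lookup g q"
proof -
  let ?a = "lookup f p" and ?b = "lookup g q"
  define f' where "f' = f - single p ?a"
  define g' where "g' = g - single q ?b"
  define r where "r = single p ?a * g' + f' * g"
  have f': "\<phi> x < \<phi> p" if "x \<in> keys f'" for x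
    using that f by (auto simp: f'_def leads_def in_keys_iff lookup_minus lookup_single when_def split: if_splits)
  have g': "\<phi> x < \<phi> q" if "x \<in> keys g'" for x
    using that g by (auto simp: g'_def leads_def in_keys_iff lookup_minus lookup_single when_def split: if_splits)
  have gle: "\<phi> x \<le> \<phi> q" if "x \<in> keys g" for x
    using that g by (force simp: leads_def)
  have r: "\<phi> x < \<phi> (p + q)" if "x \<in> keys r" for x
  proof -
    have "x \<in> keys (single p ?a * g') \<or> x \<in> keys (f' * g)"
      using that Poly_Mapping.keys_add[of "single p ?a * g'" "f' * g"]
      unfolding r_def by blast
    then show ?thesis
    proof
      assume "x \<in> keys (single p ?a * g')"
      then obtain y where "x = p + y" "y \<in> keys g'"
        using keys_mult[of "single p ?a" g'] by (auto split: if_splits)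
      then show ?thesis using g' add by auto
    next
      assume "x \<in> keys (f' * g)"
      then obtain y z where "x = y + z" "y \<in> keys f'" "z \<in> keys g"
        using keys_mult[of f' g] by auto
      then show ?thesis using f' gle add by (simp add: add_less_le_mono)
    qed
  qed
  have eq: "f * g = single (p + q) (?a * ?b) + r"
    by (simp add: r_def f'_def g'_def mult_single algebra_simps)
  have r0: "lookup r (p + q) = 0"
    using r[of "p + q"] by (auto simp: in_keys_iff)
  have ab: "?a \<noteq> 0" "?b \<noteq> 0" using f g by (auto simp: leads_def in_keys_iff)
  show l: "lookup (f * g) (p + q) = ?a * ?b"
    unfolding eq by (simp add: lookup_add r0)
  have "\<phi> x < \<phi> (p + q)" if "x \<in> keys (f * g)" "x \<noteq> p + q" for x
  proof -
    have "x \<in> keys r" using that unfolding eq in_keys_iff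
      by (simp add: lookup_add lookup_single when_def)
    then show ?thesis by (rule r)
  qed
  with l ab show "leads \<phi> (p + q) (f * g)" by (auto simp: leads_def in_keys_iff)
qed

lemma leads_single: "c \<noteq> 0 \<Longrightarrow> leads \<phi> p (single p c)"
  by (auto simp: leads_def)

lemma leads_cancel:
  fixes f g :: "'m::comm_monoid_add \<Rightarrow>\<^sub>0 'k::comm_ring_1"
  assumes "leads \<phi> p f" "leads \<phi> p g" "lookup f p = lookup g p"
    "q \<in> keys (f - g)"
  shows "\<phi> q < \<phi> p"
proof -
  have "q \<noteq> p" using assms by (auto simp: in_keys_iff lookup_minus)
  moreover have "q \<in> keys f \<or> q \<in> keys g"
    using assms(4) by (auto simp: in_keys_iff lookup_minus)
  ultimately show ?thesis using assms by (auto simp: leads_def)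
qed

locale submonoid =
  fixes S :: "'m::comm_monoid_add set"
  assumes zero_mem: "0 \<in> S" and add_mem: "x \<in> S \<Longrightarrow> y \<in> S \<Longrightarrow> x + y \<in> S"
begin

lemma supported_0 [simp]: "0 \<in> supported S" by (simp add: supported_def)
lemma supported_1 [simp]: "(1::'m \<Rightarrow>\<^sub>0 'k::comm_ring_1) \<in> supported S"
  by (auto simp: supported_def zero_mem in_keys_iff lookup_one when_def split: if_splits)
lemma supported_add: "f \<in> supported S \<Longrightarrow> g \<in> supported S \<Longrightarrow> f + g \<in> supported S"
  using Poly_Mapping.keys_add[of f g] by (auto simp: supported_def)
lemma supported_uminus: "f \<in> supported S \<Longrightarrow> - f \<in> supported S"
  for f :: "'m \<Rightarrow>\<^sub>0 'k::comm_ring_1"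
  by (auto simp: supported_def in_keys_iff)
lemma supported_diff: "f \<in> supported S \<Longrightarrow> g \<in> supported S \<Longrightarrow> f - g \<in> supported S"
  for f :: "'m \<Rightarrow>\<^sub>0 'k::comm_ring_1"
  using supported_add[of f "- g"] supported_uminus[of g] by simp
lemma supported_mult: "f \<in> supported S \<Longrightarrow> g \<in> supported S \<Longrightarrow> f * g \<in> supported S"
  for f :: "'m \<Rightarrow>\<^sub>0 'k::comm_ring_1"
  using keys_mult[of f g] add_mem by (force simp: supported_def)
lemma supported_single [simp]: "p \<in> S \<Longrightarrow> single p c \<in> supported S"
  by (auto simp: supported_def split: if_splits)
lemma supported_const [simp]: "single 0 c \<in> supported S"
  by (simp add: zero_mem)
lemma supported_power: "f \<in> supported S \<Longrightarrow> f ^ n \<in> supported S"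
  for f :: "'m \<Rightarrow>\<^sub>0 'k::comm_ring_1"
  by (induction n) (auto intro: supported_mult)
lemma supported_sum: "(\<And>i. i \<in> I \<Longrightarrow> f i \<in> supported S) \<Longrightarrow> sum f I \<in> supported S"
  by (induction I rule: infinite_finite_induct) (auto intro: supported_add)

lemma carrier_sr: "carrier (semigroup_ring S) = supported S"
  by (simp add: semigroup_ring_def supported_def)
lemma mult_sr: "x \<otimes>\<^bsub>semigroup_ring S\<^esub> y = x * y"
  by (simp add: semigroup_ring_def)
lemma add_sr: "x \<oplus>\<^bsub>semigroup_ring S\<^esub> y = x + y"
  by (simp add: semigroup_ring_def)
lemma one_sr: "\<one>\<^bsub>semigroup_ring S\<^esub> = 1"
  by (simp add: semigroup_ring_def)
lemma zero_sr: "\<zero>\<^bsub>semigroup_ring S\<^esub> = 0"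
  by (simp add: semigroup_ring_def)
lemmas sr_simps = carrier_sr mult_sr add_sr one_sr zero_sr

lemma cring_sr: "cring (semigroup_ring S :: ('m \<Rightarrow>\<^sub>0 'k::comm_ring_1) ring)"
proof (rule cringI)
  show "abelian_group (semigroup_ring S :: ('m \<Rightarrow>\<^sub>0 'k) ring)"
  proof (rule abelian_groupI, unfold sr_simps)
    show "\<exists>y\<in>supported S. y + x = 0" if "x \<in> supported S" for x :: "'m \<Rightarrow>\<^sub>0 'k"
      using supported_uminus[OF that] by (intro bexI[of _ "- x"]) auto
  qed (auto intro: supported_add simp: algebra_simps)
  show "comm_monoid (semigroup_ring S :: ('m \<Rightarrow>\<^sub>0 'k) ring)"
    by (rule comm_monoidI) (auto simp: sr_simps algebra_simps intro: supported_mult)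
qed (auto simp: sr_simps algebra_simps)

text \<open>
  From here on, ideals of \<open>K[S]\<close> are handled in the type of all polynomials, without the ring record.
\<close>

lemma ideal_sr_iff:
  fixes I :: "('m \<Rightarrow>\<^sub>0 'k::comm_ring_1) set"
  shows "ideal I (semigroup_ring S) \<longleftrightarrow>
    I \<subseteq> supported S \<and> 0 \<in> I \<and> (\<forall>x\<in>I. \<forall>y\<in>I. x + y \<in> I) \<and> (\<forall>r\<in>supported S. \<forall>x\<in>I. r * x \<in> I)"
proof
  assume "ideal I (semigroup_ring S)"
  then interpret ideal I "semigroup_ring S" .
  show "I \<subseteq> supported S \<and> 0 \<in> I \<and> (\<forall>x\<in>I. \<forall>y\<in>I. x + y \<in> I) \<and> (\<forall>r\<in>supported S. \<forall>x\<in>I. r * x \<in> I)"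
    using a_subset additive_subgroup.zero_closed[OF additive_subgroup_axioms]
      additive_subgroup.a_closed[OF additive_subgroup_axioms] I_l_closed
    unfolding sr_simps by blast
next
  assume *: "I \<subseteq> supported S \<and> 0 \<in> I \<and> (\<forall>x\<in>I. \<forall>y\<in>I. x + y \<in> I) \<and> (\<forall>r\<in>supported S. \<forall>x\<in>I. r * x \<in> I)"
  interpret cring "semigroup_ring S :: ('m \<Rightarrow>\<^sub>0 'k) ring" by (rule cring_sr)
  show "ideal I (semigroup_ring S)"
  proof (rule idealI)
    show "ring (semigroup_ring S :: ('m \<Rightarrow>\<^sub>0 'k) ring)" by (rule ring_axioms)
    show "subgroup I (add_monoid (semigroup_ring S))"
    proof (rule add.subgroupI)
      show "I \<subseteq> carrier (semigroup_ring S)" using * by (simp add: sr_simps)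
      show "I \<noteq> {}" using * by auto
      show "\<ominus>\<^bsub>semigroup_ring S\<^esub> a \<in> I" if "a \<in> I" for a
      proof -
        have "- 1 * a \<in> I" using * that supported_uminus[OF supported_1] by blast
        then have m: "- a \<in> I" by simp
        have "\<ominus>\<^bsub>semigroup_ring S\<^esub> a = - a"
          by (rule minus_equality) (use * that m in \<open>auto simp: sr_simps\<close>)
        then show ?thesis using m by simp
      qed
      show "a \<oplus>\<^bsub>semigroup_ring S\<^esub> b \<in> I" if "a \<in> I" "b \<in> I" for a b
        using * that by (simp add: sr_simps)
    qed
    show "x \<otimes>\<^bsub>semigroup_ring S\<^esub> a \<in> I" "a \<otimes>\<^bsub>semigroup_ring S\<^esub> x \<in> I"
      if "a \<in> I" "x \<in> carrier (semigroup_ring S)" for a x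
      using * that by (simp_all add: sr_simps mult.commute[of a x])
  qed
qed

lemma Idl_empty_sr: "Idl\<^bsub>semigroup_ring S\<^esub> {} = {0 :: 'm \<Rightarrow>\<^sub>0 'k::comm_ring_1}"
proof -
  interpret cring "semigroup_ring S :: ('m \<Rightarrow>\<^sub>0 'k) ring" by (rule cring_sr)
  show ?thesis
    using genideal_minimal[OF zeroideal, of "{}"] genideal_ideal[of "{}"]
    unfolding sr_simps ideal_sr_iff by blast
qed

lemma Idl_singleton_sr:
  fixes f :: "'m \<Rightarrow>\<^sub>0 'k::comm_ring_1"
  assumes "f \<in> supported S"
  shows "Idl\<^bsub>semigroup_ring S\<^esub> {f} = {x * f | x. x \<in> supported S}"
proof -
  interpret cring "semigroup_ring S :: ('m \<Rightarrow>\<^sub>0 'k) ring" by (rule cring_sr)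
  show ?thesis
    using cgenideal_eq_genideal[of f] assms unfolding cgenideal_def sr_simps by simp
qed

lemma primeideal_sr_iff:
  fixes I :: "('m \<Rightarrow>\<^sub>0 'k::comm_ring_1) set"
  shows "primeideal I (semigroup_ring S) \<longleftrightarrow> ideal I (semigroup_ring S) \<and> 1 \<notin> I \<and>
    (\<forall>x\<in>supported S. \<forall>y\<in>supported S. x * y \<in> I \<longrightarrow> x \<in> I \<or> y \<in> I)"
proof
  assume "primeideal I (semigroup_ring S)"
  then interpret primeideal I "semigroup_ring S" .
  have "1 \<notin> I" using one_imp_carrier I_notcarr unfolding sr_simps by metis
  then show "ideal I (semigroup_ring S) \<and> 1 \<notin> I \<and>
    (\<forall>x\<in>supported S. \<forall>y\<in>supported S. x * y \<in> I \<longrightarrow> x \<in> I \<or> y \<in> I)"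
    using is_ideal I_prime unfolding sr_simps by blast
next
  assume *: "ideal I (semigroup_ring S) \<and> 1 \<notin> I \<and>
    (\<forall>x\<in>supported S. \<forall>y\<in>supported S. x * y \<in> I \<longrightarrow> x \<in> I \<or> y \<in> I)"
  show "primeideal I (semigroup_ring S)"
  proof (rule primeidealI)
    show "carrier (semigroup_ring S) \<noteq> I" using * supported_1 unfolding sr_simps by metis
    show "ideal I (semigroup_ring S)" using * by blast
    show "cring (semigroup_ring S :: ('m \<Rightarrow>\<^sub>0 'k) ring)" by (rule cring_sr)
    show "a \<in> I \<or> b \<in> I" if "a \<in> carrier (semigroup_ring S)" "b \<in> carrier (semigroup_ring S)"
      "a \<otimes>\<^bsub>semigroup_ring S\<^esub> b \<in> I" for a b
      using * that unfolding sr_simps by blast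
  qed
qed

end

section \<open>A height function on the lattice\<close>

lemma exists_positive_irrational: "\<exists>c::real. 0 < c \<and> c \<notin> \<rat>"
proof -
  obtain c :: real where c: "c \<notin> \<rat>"
    using countable_rat uncountable_UNIV_real by (metis UNIV_eq_I)
  then have "c \<noteq> 0" "- c \<notin> \<rat>" by (auto simp: Rats_minus_iff)
  then show ?thesis using c by (metis linorder_neqE_linordered_idom neg_0_less_iff_less)
qed

text \<open>
  With an irrational slope, the linear form \<open>height\<close> below separates lattice points; it replaces a
  monomial order and is still discrete on the quadrant.
\<close>

definition irr :: real where "irr = (SOME c. 0 < c \<and> c \<notin> \<rat>)"

lemma irr: "0 < irr" "irr \<notin> \<rat>"
  using someI_ex[OF exists_positive_irrational] by (auto simp: irr_def)

definition height :: "real \<times> real \<Rightarrow> real" where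
  "height p = fst p + irr * snd p"

lemma height_add: "height (x + y) = height x + height y"
  by (simp add: height_def algebra_simps)

lemma inj_on_height: "inj_on height nat_plane"
proof (rule inj_onI)
  fix x y assume xy: "x \<in> nat_plane" "y \<in> nat_plane" "height x = height y"
  have r: "fst y - fst x \<in> \<rat>" "snd x - snd y \<in> \<rat>"
    using xy by (auto simp: mem_Times_iff intro!: Rats_diff dest: Nats_subset_Rats[THEN subsetD])
  have eq: "irr * (snd x - snd y) = fst y - fst x"
    using xy by (simp add: height_def algebra_simps)
  have "snd x = snd y"
  proof (rule ccontr)
    assume "snd x \<noteq> snd y"
    then have "irr = (fst y - fst x) / (snd x - snd y)" using eq by (simp add: field_simps)
    then show False using irr r by (metis Rats_divide)
  qed
  then show "x = y" using eq by (simp add: prod_eq_iff)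
qed

text \<open>The quadratic growth is what bounds the Krull dimension by 2.\<close>

lemma card_nat_plane_le:
  shows "finite {p \<in> nat_plane. fst p + snd p \<le> real m}"
    and "card {p \<in> nat_plane. fst p + snd p \<le> real m} \<le> (m + 1) ^ 2"
proof -
  let ?X = "{p \<in> nat_plane. fst p + snd p \<le> real m}"
  have sub: "?X \<subseteq> (\<lambda>(i, j). (real i, real j)) ` ({..m} \<times> {..m})"
  proof
    fix p assume "p \<in> ?X"
    moreover from this obtain i j where "p = (real i, real j)"
      by (auto elim!: Nats_cases)
    ultimately show "p \<in> (\<lambda>(i, j). (real i, real j)) ` ({..m} \<times> {..m})"
      by (auto intro!: image_eqI[of _ _ "(i, j)"])
  qed
  then show "finite ?X" by (rule finite_subset) auto
  have "card ?X \<le> card ((\<lambda>(i, j). (real i, real j)) ` ({..m} \<times> {..m}))"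
    by (rule card_mono[OF _ sub]) auto
  also have "\<dots> \<le> card ({..m} \<times> {..m})" by (rule card_image_le) auto
  finally show "card ?X \<le> (m + 1) ^ 2" by (simp add: power2_eq_square)
qed

lemma finite_height_le: "finite {p \<in> nat_plane. height p \<le> c}"
proof -
  define d where "d = min 1 irr"
  have d: "0 < d" "d \<le> 1" "d \<le> irr" using irr by (auto simp: d_def)
  obtain m where m: "c / d \<le> real m" using real_arch_simple by blast
  have "{p \<in> nat_plane. height p \<le> c} \<subseteq> {p \<in> nat_plane. fst p + snd p \<le> real m}"
  proof clarsimp
    fix x y :: real assume xy: "x \<in> \<nat>" "y \<in> \<nat>" "height (x, y) \<le> c"
    then have nn: "0 \<le> x" "0 \<le> y" by (auto elim!: Nats_cases)
    have "d * (x + y) \<le> x + irr * y"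
      using nn d by (simp add: distrib_left add_mono mult_right_mono mult_left_le_one_le)
    then have "d * (x + y) \<le> c" using xy by (simp add: height_def)
    then have "x + y \<le> c / d" using d by (simp add: field_simps)
    then show "x + y \<le> real m" using m by simp
  qed
  then show ?thesis using card_nat_plane_le(1) finite_subset by blast
qed

lemma height_induct [consumes 1, case_names less]:
  assumes "p \<in> nat_plane"
    and "\<And>p. p \<in> nat_plane \<Longrightarrow> (\<And>q. q \<in> nat_plane \<Longrightarrow> height q < height p \<Longrightarrow> P q) \<Longrightarrow> P p"
  shows "P p"
  using assms(1)
proof (induction "card {q \<in> nat_plane. height q < height p}" arbitrary: p rule: less_induct)
  case less
  show ?case
  proof (rule assms(2)[OF less.prems])
    fix q assume q: "q \<in> nat_plane" "height q < height p"
    show "P q"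
    proof (rule less.hyps[OF _ q(1)])
      have "finite {q \<in> nat_plane. height q < height p}"
        by (rule finite_subset[OF _ finite_height_le[of "height p"]]) auto
      then show "card {r \<in> nat_plane. height r < height q} < card {q \<in> nat_plane. height q < height p}"
        using q by (intro psubset_card_mono) auto
    qed
  qed
qed

lemma height_pos: "p \<in> nat_plane \<Longrightarrow> p \<noteq> 0 \<Longrightarrow> 0 < height p"
  using irr by (cases p) (auto simp: height_def zero_prod_def elim!: Nats_cases
      intro: add_pos_nonneg add_nonneg_pos)

section \<open>Dickson's lemma in two variables\<close>

text \<open>
  Besides a fixed element \<open>(a0, b0)\<close> of \<open>X\<close>, a basis needs the least elements of the columns left of it
  and of the rows below it.
\<close>

lemma dickson_two:
  fixes X :: "(nat \<times> nat) set"
  shows "\<exists>T. finite T \<and> T \<subseteq> X \<and> (\<forall>(a, b)\<in>X. \<exists>(c, d)\<in>T. c \<le> a \<and> d \<le> b)"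
proof (cases "X = {}")
  case False
  then obtain a0 b0 where 0: "(a0, b0) \<in> X" by auto
  define T where "T = {(a0, b0)} \<union> (\<lambda>i. (i, LEAST b. (i, b) \<in> X)) ` {i. i < a0 \<and> (\<exists>b. (i, b) \<in> X)}
    \<union> (\<lambda>j. (LEAST a. (a, j) \<in> X, j)) ` {j. j < b0 \<and> (\<exists>a. (a, j) \<in> X)}"
  have "finite T" by (simp add: T_def)
  moreover have "T \<subseteq> X" unfolding T_def using 0 by (auto intro: LeastI)
  moreover have "\<exists>(c, d)\<in>T. c \<le> a \<and> d \<le> b" if ab: "(a, b) \<in> X" for a b
  proof -
    consider "a < a0" | "b < b0" | "a0 \<le> a" "b0 \<le> b" by linarith
    then show ?thesis
    proof cases
      case 1
      then have "(a, LEAST b. (a, b) \<in> X) \<in> T" using ab by (auto simp: T_def)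
      then show ?thesis using Least_le[of "\<lambda>b. (a, b) \<in> X" b] ab by blast
    next
      case 2
      then have "(LEAST a. (a, b) \<in> X, b) \<in> T" using ab by (auto simp: T_def)
      then show ?thesis using Least_le[of "\<lambda>a. (a, b) \<in> X" a] ab by blast
    next
      case 3
      then show ?thesis using T_def by blast
    qed
  qed
  ultimately show ?thesis by (intro exI[of _ T]) auto
qed auto

section \<open>Simplicial lattice semigroups in the plane\<close>

text \<open>
  The algebraic side uses only these properties of \<open>P\<close>. \<open>B\<close> generates \<open>K[S]\<close> as a module over
  \<open>K[u, v]\<close>, and the last assumption says that every monomial divides one of \<open>K[u, v]\<close>.
\<close>

locale simplicial_semigroup = submonoid S for S :: "(real \<times> real) set" +
  fixes n1 n2 :: "real \<times> real" and B :: "(real \<times> real) set"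
  assumes lattice: "S \<subseteq> nat_plane"
    and n1_mem: "n1 \<in> S" and n2_mem: "n2 \<in> S" and indep: "cross2 n2 n1 > 0"
    and finite_B: "finite B" and B_sub: "B \<subseteq> S"
    and apery: "p \<in> S \<Longrightarrow> \<exists>b\<in>B. \<exists>i j::nat. p = b + real i *\<^sub>R n1 + real j *\<^sub>R n2"
    and in_cone: "p \<in> S \<Longrightarrow> 0 \<le> cross2 p n1" "p \<in> S \<Longrightarrow> 0 \<le> cross2 n2 p"
    and completion: "p \<in> S \<Longrightarrow> \<exists>p'\<in>S. \<exists>i j::nat. p + p' = real i *\<^sub>R n1 + real j *\<^sub>R n2"
begin

lemma scale_mem: "p \<in> S \<Longrightarrow> real i *\<^sub>R p \<in> S"
  by (induction i) (auto simp: zero_mem add_mem scaleR_left_distrib)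

lemma combination_mem: "real i *\<^sub>R n1 + real j *\<^sub>R n2 \<in> S"
  by (intro add_mem scale_mem n1_mem n2_mem)

lemma inj_height: "inj_on height S"
  using inj_on_height lattice by (rule inj_on_subset)

lemma supported_exists_leads:
  assumes "f \<in> supported S" "f \<noteq> 0"
  obtains p where "leads height p f" "p \<in> S"
proof -
  have "inj_on height (keys f)"
    using inj_height by (rule inj_on_subset) (use assms in \<open>auto simp: supported_def\<close>)
  then obtain p where "leads height p f" using exists_leads assms by blast
  moreover from this have "p \<in> S" using assms by (auto simp: leads_def supported_def)
  ultimately show thesis using that by blast
qed

text \<open>Leading exponents add up, so \<open>K[S]\<close> is a domain.\<close>

lemma supported_mult_eq_0:
  fixes f g :: "real \<times> real \<Rightarrow>\<^sub>0 'k::idom"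
  assumes "f \<in> supported S" "g \<in> supported S" "f * g = 0"
  shows "f = 0 \<or> g = 0"
proof (rule ccontr)
  assume "\<not> (f = 0 \<or> g = 0)"
  then obtain p q where "leads height p f" "leads height q g"
    using supported_exists_leads assms by metis
  then have "leads height (p + q) (f * g)" using leads_mult(1) height_add by blast
  then show False using assms by (simp add: leads_def)
qed

text \<open>
  Reduction by leading terms terminates, because there are only finitely many lattice points
  below a given height.
\<close>

lemma leads_induct [consumes 1, case_names less]:
  fixes f :: "real \<times> real \<Rightarrow>\<^sub>0 'k::zero"
  assumes "f \<in> supported S"
    and "\<And>f. f \<in> supported S \<Longrightarrow>
      (\<And>g p. g \<in> supported S \<Longrightarrow> leads height p f \<Longrightarrow>
         (\<And>q. q \<in> keys g \<Longrightarrow> height q < height p) \<Longrightarrow> P g) \<Longrightarrow> P f"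
  shows "P f"
proof -
  have zero: "P f" if "f = 0" for f
    by (rule assms(2)) (use that in \<open>auto simp: leads_def\<close>)
  have ind: "P f" if "f \<in> supported S" "leads height p f" "p \<in> nat_plane" for f p
    using that(3,1,2)
  proof (induction arbitrary: f rule: height_induct)
    case (less p)
    show ?case
    proof (rule assms(2)[OF less.prems(1)])
      fix g :: "real \<times> real \<Rightarrow>\<^sub>0 'k" and q assume g: "g \<in> supported S" "leads height q f"
        and lt: "\<And>r. r \<in> keys g \<Longrightarrow> height r < height q"
      have "q = p" using less.prems(2) g(2) unfolding leads_def by force
      show "P g"
      proof (cases "g = 0")
        case False
        then obtain r where r: "leads height r g" "r \<in> S"
          using supported_exists_leads g(1) by blast
        show ?thesis
          by (rule less.IH[OF _ _ g(1) r(1)]) (use r lt \<open>q = p\<close> lattice in \<open>auto simp: leads_def\<close>)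
      qed (rule zero)
    qed
  qed
  show ?thesis
  proof (cases "f = 0")
    case False
    then obtain p where "leads height p f" "p \<in> S" using supported_exists_leads assms(1) by blast
    then show ?thesis using ind assms(1) lattice by blast
  qed (rule zero)
qed

section \<open>Noetherianity\<close>

text \<open>
  Hilbert's argument: the leading exponents of an ideal are generated by finitely many of them,
  by Dickson's lemma on each translate \<open>b + \<nat> n1 + \<nat> n2\<close>, and polynomials with these leading
  exponents generate the ideal by division.
\<close>

lemma noetherian_sr: "noetherian_ring (semigroup_ring S :: (real \<times> real \<Rightarrow>\<^sub>0 'k::field) ring)"
proof -
  interpret R: cring "semigroup_ring S :: (real \<times> real \<Rightarrow>\<^sub>0 'k) ring" by (rule cring_sr)
  show ?thesis
  proof (rule R.noetherian_ringI)
    fix I :: "(real \<times> real \<Rightarrow>\<^sub>0 'k) set" assume I: "ideal I (semigroup_ring S)"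
    then have Isub: "I \<subseteq> supported S" and Iadd: "\<And>x y. x \<in> I \<Longrightarrow> y \<in> I \<Longrightarrow> x + y \<in> I"
      and Imult: "\<And>r x. r \<in> supported S \<Longrightarrow> x \<in> I \<Longrightarrow> r * x \<in> I"
      unfolding ideal_sr_iff by blast+
    define L where "L = {p. \<exists>f\<in>I. leads height p f}"
    define e where "e b ij = b + real (fst ij) *\<^sub>R n1 + real (snd ij) *\<^sub>R n2" for b and ij :: "nat \<times> nat"
    define basis where "basis b T \<longleftrightarrow> finite T \<and> T \<subseteq> {ij. e b ij \<in> L} \<and>
        (\<forall>(i, j)\<in>{ij. e b ij \<in> L}. \<exists>(c, d)\<in>T. c \<le> i \<and> d \<le> j)" for b T
    have "\<forall>b. \<exists>T. basis b T" unfolding basis_def using dickson_two by blast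
    then obtain T where T: "\<And>b. basis b (T b)" using choice[of basis] by blast
    define U where "U = (\<Union>b\<in>B. e b ` T b)"
    have U: "finite U" "U \<subseteq> L" using T finite_B unfolding U_def basis_def by blast+
    have below: "\<exists>t\<in>U. \<exists>s\<in>S. p = t + s" if p: "p \<in> L" for p
    proof -
      have "p \<in> S" using p Isub by (auto simp: L_def leads_def supported_def)
      then obtain b i j where b: "b \<in> B" "p = e b (i, j)" using apery unfolding e_def by fastforce
      then obtain c d where cd: "(c, d) \<in> T b" "c \<le> i" "d \<le> j"
        using T[of b] p unfolding basis_def by blast
      have "p = e b (c, d) + (real (i - c) *\<^sub>R n1 + real (j - d) *\<^sub>R n2)"
        using cd b by (simp add: e_def of_nat_diff algebra_simps)
      moreover have "e b (c, d) \<in> U" unfolding U_def using b cd by blast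
      ultimately show ?thesis using combination_mem by blast
    qed
    have "\<forall>t\<in>U. \<exists>f. f \<in> I \<and> leads height t f" using U by (auto simp: L_def)
    then obtain F where F: "\<And>t. t \<in> U \<Longrightarrow> F t \<in> I" "\<And>t. t \<in> U \<Longrightarrow> leads height t (F t)"
      using bchoice[of U "\<lambda>t f. f \<in> I \<and> leads height t f"] by blast
    let ?J = "Idl\<^bsub>semigroup_ring S\<^esub> (F ` U)"
    have FU: "F ` U \<subseteq> carrier (semigroup_ring S)" using F Isub by (auto simp: sr_simps)
    have J: "ideal ?J (semigroup_ring S)" by (rule R.genideal_ideal[OF FU])
    have Fin: "F t \<in> ?J" if "t \<in> U" for t using R.genideal_self[OF FU] that by auto
    have "f \<in> I \<longrightarrow> f \<in> ?J" if "f \<in> supported S" for f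
      using that
    proof (induction f rule: leads_induct)
      case (less f)
      show ?case
      proof
        assume f: "f \<in> I"
        show "f \<in> ?J"
        proof (cases "f = 0")
          case True
          then show ?thesis using J by (simp add: ideal_sr_iff)
        next
          case False
          then obtain p where p: "leads height p f" using supported_exists_leads less.hyps by blast
          then have "p \<in> L" using f by (auto simp: L_def)
          then obtain t s where ts: "t \<in> U" "s \<in> S" "p = t + s" using below by blast
          define c where "c = lookup f p / lookup (F t) t"
          define g where "g = single s c * F t"
          have nz: "lookup (F t) t \<noteq> 0" "lookup f p \<noteq> 0"
            using F(2)[OF ts(1)] p by (auto simp: leads_def in_keys_iff)
          then have "leads height s (single s c)" by (intro leads_single) (simp add: c_def)
          from leads_mult[of height, OF height_add this F(2)[OF ts(1)]]
          have g: "leads height p g" "lookup g p = lookup f p"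
            using nz by (auto simp: g_def ts(3) add.commute c_def)
          have gI: "g \<in> I" "g \<in> ?J" using Imult F Fin ts J
            unfolding g_def ideal_sr_iff by auto
          then have neg: "- 1 * g \<in> I" using Imult supported_uminus[OF supported_1] by blast
          then have fgI: "f - g \<in> I" using Iadd[OF f neg] by simp
          have "f - g \<in> I \<longrightarrow> f - g \<in> ?J"
            by (rule less.IH[OF _ p]) (use fgI Isub leads_cancel[OF p g(1)] g(2) in auto)
          then have "(f - g) + g \<in> ?J" using fgI gI J unfolding ideal_sr_iff by blast
          then show ?thesis by simp
        qed
      qed
    qed
    then have "I \<subseteq> ?J" using Isub by blast
    moreover have "?J \<subseteq> I" by (rule R.genideal_minimal[OF I]) (use F in auto)
    ultimately show "\<exists>A\<subseteq>carrier (semigroup_ring S). finite A \<and> I = Idl\<^bsub>semigroup_ring S\<^esub> A"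
      using FU U by (intro exI[of _ "F ` U"]) auto
  qed
qed

end

section \<open>Prime chains have length at most two\<close>

context submonoid begin

text \<open>
  Divide the relation by the power \<open>x ^ a0\<close>, which the prime \<open>p\<close> does not contain; the other terms keep
  a factor \<open>x \<in> p'\<close>.
\<close>

lemma lowest_coefficient_in_prime:
  fixes g :: "nat \<Rightarrow> 'm \<Rightarrow>\<^sub>0 'k::comm_ring_1"
  assumes p: "primeideal p (semigroup_ring S)" and p': "ideal p' (semigroup_ring S)" "p \<subseteq> p'"
    and x: "x \<in> p'" "x \<notin> p" and g: "\<And>a. g a \<in> supported S"
    and mem: "(\<Sum>a<N. x ^ a * g a) \<in> p" and a0: "a0 < N" "\<And>a. a < a0 \<Longrightarrow> g a = 0"
  shows "g a0 \<in> p'"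
proof -
  have xS: "x \<in> supported S" using p' x unfolding ideal_sr_iff by blast
  define h where "h = (\<Sum>a\<in>{Suc a0..<N}. x ^ (a - Suc a0) * g a)"
  have hS: "h \<in> supported S" unfolding h_def
    by (intro supported_sum supported_mult supported_power xS g)
  have "(\<Sum>a<N. x ^ a * g a) = (\<Sum>a\<in>{a0..<N}. x ^ a * g a)"
    by (rule sum.mono_neutral_right) (use a0 in auto)
  also have "\<dots> = x ^ a0 * g a0 + (\<Sum>a\<in>{Suc a0..<N}. x ^ a * g a)"
    using a0(1) by (simp add: sum.atLeast_Suc_lessThan)
  also have "(\<Sum>a\<in>{Suc a0..<N}. x ^ a * g a) = x ^ a0 * (x * h)"
    unfolding h_def sum_distrib_left
    by (rule sum.cong) (simp_all add: mult.assoc[symmetric] power_add[symmetric] flip: power_Suc)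
  finally have eq: "(\<Sum>a<N. x ^ a * g a) = x ^ a0 * (g a0 + x * h)"
    by (simp add: distrib_left)
  have prime: "u \<in> p \<or> v \<in> p" if "u \<in> supported S" "v \<in> supported S" "u * v \<in> p" for u v
    using p that unfolding primeideal_sr_iff by blast
  have one: "1 \<notin> p" using p unfolding primeideal_sr_iff by blast
  have pow: "x ^ n \<notin> p" for n
  proof (induction n)
    case (Suc n)
    then show ?case using prime[OF xS supported_power[OF xS, of n]] x by auto
  qed (simp add: one)
  have "g a0 + x * h \<in> p"
    using prime[of "x ^ a0" "g a0 + x * h"] pow mem eq
    by (auto intro: supported_power supported_add supported_mult xS g hS)
  moreover have "(- 1 * h) * x \<in> p'"
    using p' x hS supported_mult[OF supported_uminus[OF supported_1] hS] unfolding ideal_sr_iff by blast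
  ultimately have "(g a0 + x * h) + (- 1 * h) * x \<in> p'"
    using p' unfolding ideal_sr_iff by blast
  then show ?thesis by (simp add: mult.commute)
qed

end

definition deg_le :: "nat \<Rightarrow> (real \<times> real \<Rightarrow>\<^sub>0 'k::zero) \<Rightarrow> bool" where
  "deg_le d f \<longleftrightarrow> (\<forall>p\<in>keys f. fst p + snd p \<le> real d)"

lemma deg_le_mult: "deg_le d f \<Longrightarrow> deg_le e g \<Longrightarrow> deg_le (d + e) (f * g)"
  for f g :: "real \<times> real \<Rightarrow>\<^sub>0 'k::comm_ring_1"
  unfolding deg_le_def
proof
  fix p assume *: "\<forall>p\<in>keys f. fst p + snd p \<le> real d"
    "\<forall>p\<in>keys g. fst p + snd p \<le> real e" "p \<in> keys (f * g)"
  then obtain a b where "p = a + b" "a \<in> keys f" "b \<in> keys g"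
    using keys_mult[of f g] by auto
  then have "fst a + snd a \<le> real d" "fst b + snd b \<le> real e" "p = a + b" using * by auto
  then show "fst p + snd p \<le> real (d + e)" by simp
qed

lemma deg_le_power: "deg_le d f \<Longrightarrow> deg_le (n * d) (f ^ n)"
  for f :: "real \<times> real \<Rightarrow>\<^sub>0 'k::comm_ring_1"
proof (induction n)
  case 0
  then show ?case by (auto simp: deg_le_def in_keys_iff lookup_one when_def)
next
  case (Suc n)
  then show ?case using deg_le_mult[of d f "n * d" "f ^ n"] by simp
qed

lemma deg_le_mono: "deg_le d f \<Longrightarrow> d \<le> e \<Longrightarrow> deg_le e f"
  unfolding deg_le_def by (meson of_nat_le_iff order_trans)

lemma exists_deg_le: "\<exists>d. deg_le d f"
proof -
  obtain M where "\<forall>x\<in>(\<lambda>p. fst p + snd p) ` keys f. x \<le> M"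
    using finite_imp_bounded[of "(\<lambda>p. fst p + snd p) ` keys f"] 
    by (meson finite_imageI finite_keys bdd_above_finite bdd_above.unfold)
  moreover obtain d where "M \<le> real d" using real_arch_simple by blast
  ultimately show ?thesis unfolding deg_le_def by (intro exI[of _ d]) force
qed

context simplicial_semigroup begin

text \<open>
  The \<open>N\<^sup>3\<close> monomials in \<open>x\<close>, \<open>y\<close>, \<open>z\<close> of degree below \<open>N\<close> in each involve only \<open>O(N\<^sup>2)\<close> exponents.
\<close>

lemma algebraic_relation:
  fixes x y z :: "real \<times> real \<Rightarrow>\<^sub>0 'k::field"
  assumes "x \<in> supported S" "y \<in> supported S" "z \<in> supported S"
  shows "\<exists>N k. (\<exists>a<N. \<exists>b<N. \<exists>c<N. k a b c \<noteq> 0) \<and>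
    (\<Sum>a<N. x ^ a * (\<Sum>b<N. y ^ b * (\<Sum>c<N. z ^ c * single 0 (k a b c)))) = 0"
proof -
  obtain d1 d2 d3 where "deg_le d1 x" "deg_le d2 y" "deg_le d3 z"
    using exists_deg_le by metis
  then obtain D where D: "deg_le D x" "deg_le D y" "deg_le D z"
    using deg_le_mono[of d1 x "d1 + d2 + d3"] deg_le_mono[of d2 y "d1 + d2 + d3"]
      deg_le_mono[of d3 z "d1 + d2 + d3"] by auto
  \<comment> \<open>The exponents have degree at most \<open>3 D N\<close>, so there are at most \<open>((3 D + 1) N)\<^sup>2\<close> of them, which is below \<open>N\<^sup>3\<close>.\<close>
  define N where "N = (3 * D + 1) ^ 2 + 1"
  define I where "I = {..<N} \<times> {..<N} \<times> {..<N}"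
  define X where "X = {p \<in> nat_plane. fst p + snd p \<le> real (3 * D * N)}"
  define v where "v = (\<lambda>(a, b, c). x ^ a * (y ^ b * z ^ c))"
  have "card X \<le> (3 * D * N + 1) ^ 2" unfolding X_def by (rule card_nat_plane_le)
  also have "\<dots> \<le> ((3 * D + 1) * N) ^ 2" by (rule power_mono) (auto simp: N_def)
  also have "\<dots> = (3 * D + 1) ^ 2 * N ^ 2" by (rule power_mult_distrib)
  also have "\<dots> < N * N ^ 2" by (rule mult_strict_right_mono) (auto simp: N_def)
  also have "\<dots> = card I" by (simp add: I_def power2_eq_square card_cartesian_product)
  finally have card: "card X < card I" .
  have keys: "keys (v i) \<subseteq> X" if i': "i \<in> I" for i
  proof -
    obtain a b c where i: "i = (a, b, c)" "a < N" "b < N" "c < N" using i' unfolding I_def by (cases i) auto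
    have "deg_le (a * D + (b * D + c * D)) (v i)"
      unfolding v_def i by (simp add: deg_le_mult deg_le_power D)
    moreover have "a * D + (b * D + c * D) \<le> 3 * D * N"
    proof -
      have "a * D \<le> N * D" "b * D \<le> N * D" "c * D \<le> N * D" using i by auto
      moreover have "3 * D * N = N * D + (N * D + N * D)" by simp
      ultimately show ?thesis by linarith
    qed
    ultimately have "deg_le (3 * D * N) (v i)" by (rule deg_le_mono)
    moreover have "v i \<in> supported S" unfolding v_def i
      using assms by (auto intro!: supported_mult supported_power)
    ultimately show ?thesis using lattice by (auto simp: deg_le_def supported_def X_def)
  qed
  have "finite X" unfolding X_def by (rule card_nat_plane_le)
  moreover have "finite I" by (simp add: I_def)
  ultimately have "\<exists>c. (\<exists>i\<in>I. c i \<noteq> 0) \<and> (\<Sum>i\<in>I. single 0 (c i) * v i) = 0"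
    by (rule exists_poly_mapping_dependency[OF _ _ card keys])
  then obtain c where c: "\<exists>i\<in>I. c i \<noteq> 0" "(\<Sum>i\<in>I. single 0 (c i) * v i) = 0"
    by (elim exE conjE) (rule that)
  define k where "k a b e = c (a, b, e)" for a b e
  have split: "(\<Sum>i\<in>I. h i) = (\<Sum>a<N. \<Sum>b<N. \<Sum>e<N. h (a, b, e))"
    for h :: "nat \<times> nat \<times> nat \<Rightarrow> real \<times> real \<Rightarrow>\<^sub>0 'k"
    unfolding I_def by (simp add: sum.cartesian_product case_prod_unfold)
  have "(\<Sum>a<N. x ^ a * (\<Sum>b<N. y ^ b * (\<Sum>e<N. z ^ e * single 0 (k a b e)))) =
    (\<Sum>i\<in>I. single 0 (c i) * v i)"
    unfolding split sum_distrib_left by (intro sum.cong refl) (simp add: v_def k_def mult_ac)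
  moreover have "\<exists>a<N. \<exists>b<N. \<exists>e<N. k a b e \<noteq> 0" using c(1) by (auto simp: I_def k_def)
  ultimately show ?thesis using c(2) by (intro exI[of _ N] exI[of _ k]) auto
qed

text \<open>
  Elements \<open>x\<close>, \<open>y\<close>, \<open>z\<close> of the three successive differences satisfy a polynomial relation. Its lowest
  coefficient in \<open>x\<close> is in \<open>p1\<close>, the lowest coefficient in \<open>y\<close> of that one is in \<open>p2\<close>, and the lowest one
  in \<open>z\<close> of the latter is a nonzero constant in \<open>p3\<close>.
\<close>

lemma no_prime_chain_3:
  fixes p0 p1 p2 p3 :: "(real \<times> real \<Rightarrow>\<^sub>0 'k::field) set"
  assumes p: "primeideal p0 (semigroup_ring S)" "primeideal p1 (semigroup_ring S)"
    "primeideal p2 (semigroup_ring S)" "primeideal p3 (semigroup_ring S)"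
    and sub: "p0 \<subset> p1" "p1 \<subset> p2" "p2 \<subset> p3"
  shows False
proof -
  have id: "ideal p0 (semigroup_ring S)" "ideal p1 (semigroup_ring S)" "ideal p2 (semigroup_ring S)"
      "ideal p3 (semigroup_ring S)"
    using p unfolding primeideal_sr_iff by blast+
  obtain x y z where x: "x \<in> p1" "x \<notin> p0" and y: "y \<in> p2" "y \<notin> p1" and z: "z \<in> p3" "z \<notin> p2"
    using sub by blast
  have S: "x \<in> supported S" "y \<in> supported S" "z \<in> supported S"
    using id x y z unfolding ideal_sr_iff by blast+
  obtain N k where k: "\<exists>a<N. \<exists>b<N. \<exists>c<N. k a b c \<noteq> 0" and
    rel: "(\<Sum>a<N. x ^ a * (\<Sum>b<N. y ^ b * (\<Sum>c<N. z ^ c * single 0 (k a b c)))) = 0"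
    using algebraic_relation[OF S] by blast
  define G2 where "G2 a b = (\<Sum>c<N. z ^ c * single 0 (k a b c))" for a b
  define G1 where "G1 a = (\<Sum>b<N. y ^ b * G2 a b)" for a
  define a0 where "a0 = (LEAST a. a < N \<and> (\<exists>b<N. \<exists>c<N. k a b c \<noteq> 0))"
  have a0: "a0 < N \<and> (\<exists>b<N. \<exists>c<N. k a0 b c \<noteq> 0)"
    unfolding a0_def by (rule LeastI_ex) (use k in blast)
  have a0': "k a b c = 0" if "a < a0" "b < N" "c < N" for a b c
    using not_less_Least[of a "\<lambda>a. a < N \<and> (\<exists>b<N. \<exists>c<N. k a b c \<noteq> 0)"] that a0
    unfolding a0_def by auto
  define b0 where "b0 = (LEAST b. b < N \<and> (\<exists>c<N. k a0 b c \<noteq> 0))"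
  have b0: "b0 < N \<and> (\<exists>c<N. k a0 b0 c \<noteq> 0)"
    unfolding b0_def by (rule LeastI_ex) (use a0 in blast)
  have b0': "k a0 b c = 0" if "b < b0" "c < N" for b c
    using not_less_Least[of b "\<lambda>b. b < N \<and> (\<exists>c<N. k a0 b c \<noteq> 0)"] that b0
    unfolding b0_def by auto
  define c0 where "c0 = (LEAST c. c < N \<and> k a0 b0 c \<noteq> 0)"
  have c0: "c0 < N \<and> k a0 b0 c0 \<noteq> 0"
    unfolding c0_def by (rule LeastI_ex) (use b0 in blast)
  have c0': "k a0 b0 c = 0" if "c < c0" for c
    using not_less_Least[of c "\<lambda>c. c < N \<and> k a0 b0 c \<noteq> 0"] that c0
    unfolding c0_def by auto
  have G2S: "G2 a b \<in> supported S" for a b unfolding G2_def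
    by (intro supported_sum supported_mult supported_power S supported_const)
  have G1S: "G1 a \<in> supported S" for a unfolding G1_def
    by (intro supported_sum supported_mult supported_power S G2S)
  have 0: "(\<Sum>a<N. x ^ a * G1 a) \<in> p0"
    using id(1) rel unfolding G1_def G2_def ideal_sr_iff by simp
  have "G1 a0 \<in> p1"
    by (rule lowest_coefficient_in_prime[OF p(1) id(2) _ x G1S 0])
      (use sub a0 a0' in \<open>auto simp: G1_def G2_def\<close>)
  then have 1: "(\<Sum>b<N. y ^ b * G2 a0 b) \<in> p1" by (simp add: G1_def)
  have "G2 a0 b0 \<in> p2"
    by (rule lowest_coefficient_in_prime[OF p(2) id(3) _ y G2S 1])
      (use sub b0 b0' in \<open>auto simp: G2_def\<close>)
  then have 2: "(\<Sum>c<N. z ^ c * single 0 (k a0 b0 c)) \<in> p2" by (simp add: G2_def)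
  have "single 0 (k a0 b0 c0) \<in> p3"
    by (rule lowest_coefficient_in_prime[OF p(3) id(4) _ z _ 2]) (use sub c0 c0' in auto)
  then have "single 0 (inverse (k a0 b0 c0)) * single 0 (k a0 b0 c0) \<in> p3"
    using id(4) supported_const unfolding ideal_sr_iff by blast
  then have "1 \<in> p3" using c0 by (simp add: mult_single)
  then show False using p(4) unfolding primeideal_sr_iff by blast
qed

lemma prime_codim_sr_le_2:
  fixes M :: "(real \<times> real \<Rightarrow>\<^sub>0 'k::field) set"
  shows "prime_codim (semigroup_ring S) M \<le> 2"
  unfolding prime_codim_def
proof (rule SUP_least)
  fix n assume "n \<in> {n. \<exists>p. (\<forall>i\<le>n. primeideal (p i) (semigroup_ring S)) \<and> (\<forall>i<n. p i \<subset> p (Suc i)) \<and> p n = M}"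
  then obtain p :: "nat \<Rightarrow> (real \<times> real \<Rightarrow>\<^sub>0 'k) set"
    where p: "\<forall>i\<le>n. primeideal (p i) (semigroup_ring S)" "\<forall>i<n. p i \<subset> p (Suc i)"
    by blast
  have "n \<le> 2"
  proof (rule ccontr)
    assume "\<not> n \<le> 2"
    then show False using no_prime_chain_3[of "p 0" "p 1" "p 2" "p 3"] p
      by (simp add: numeral_2_eq_2 numeral_3_eq_3)
  qed
  then show "enat n \<le> 2" by (simp add: numeral_eq_enat)
qed

section \<open>Failure of the gap criterion\<close>

lemma supported_sub_ideal:
  assumes "T \<subseteq> S" "\<And>a b. a \<in> S \<Longrightarrow> b \<in> T \<Longrightarrow> a + b \<in> T"
  shows "ideal (supported T :: (real \<times> real \<Rightarrow>\<^sub>0 'k::comm_ring_1) set) (semigroup_ring S)"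
  unfolding ideal_sr_iff
proof (intro conjI ballI)
  show "supported T \<subseteq> (supported S :: (real \<times> real \<Rightarrow>\<^sub>0 'k) set)"
    using assms by (auto simp: supported_def)
  show "x + y \<in> supported T" if "x \<in> supported T" "y \<in> supported T" for x y :: "real \<times> real \<Rightarrow>\<^sub>0 'k"
    using that Poly_Mapping.keys_add[of x y] by (auto simp: supported_def)
  show "r * x \<in> supported T" if "r \<in> supported S" "x \<in> supported T" for r x :: "real \<times> real \<Rightarrow>\<^sub>0 'k"
    using that assms(2) keys_mult[of r x] by (force simp: supported_def)
qed (simp add: supported_def)

lemma zero_prime: "primeideal {0 :: real \<times> real \<Rightarrow>\<^sub>0 'k::field} (semigroup_ring S)"
  unfolding primeideal_sr_iff ideal_sr_iff using supported_mult_eq_0 by auto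

text \<open>
  The prime between zero and the irrelevant ideal: its residue ring is the semigroup ring of the
  elements on the ray of \<open>n1\<close>.
\<close>

definition off_ray :: "(real \<times> real) set" where "off_ray = {p \<in> S. 0 < cross2 p n1}"

text \<open>
  Modulo this ideal a polynomial may be replaced by its part on the ray of \<open>n1\<close>, and products of
  such parts stay on the ray.
\<close>

lemma off_ray_prime: "primeideal (supported off_ray :: (real \<times> real \<Rightarrow>\<^sub>0 'k::field) set) (semigroup_ring S)"
  unfolding primeideal_sr_iff
proof (intro conjI ballI impI)
  show id: "ideal (supported off_ray :: (real \<times> real \<Rightarrow>\<^sub>0 'k) set) (semigroup_ring S)"
    by (rule supported_sub_ideal)
      (auto simp: off_ray_def add_mem cross2_add_left intro!: add_nonneg_pos in_cone(1))
  show "1 \<notin> (supported off_ray :: (real \<times> real \<Rightarrow>\<^sub>0 'k) set)"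
    by (auto simp: supported_def off_ray_def cross2_def)
  fix f g :: "real \<times> real \<Rightarrow>\<^sub>0 'k"
  assume fg: "f \<in> supported S" "g \<in> supported S" "f * g \<in> supported off_ray"
  have restr: "\<exists>f0\<in>supported {p \<in> S. cross2 p n1 = 0}. f - f0 \<in> supported off_ray"
    if "f \<in> supported S" for f :: "real \<times> real \<Rightarrow>\<^sub>0 'k"
  proof -
    define f0 where "f0 = (\<Sum>p\<in>{p \<in> keys f. cross2 p n1 = 0}.
      single p (lookup f p))"
    have l: "lookup f0 q = (if cross2 q n1 = 0 then lookup f q else 0)" for q
      unfolding f0_def by (simp add: lookup_sum lookup_single when_def in_keys_iff)
    have "f0 \<in> supported {p \<in> S. cross2 p n1 = 0}"
      using that by (auto simp: supported_def in_keys_iff l split: if_splits)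
    moreover have "f - f0 \<in> supported off_ray"
      using that in_cone by (force simp: supported_def in_keys_iff l lookup_minus off_ray_def
          split: if_splits)
    ultimately show ?thesis by blast
  qed
  obtain f0 where f0: "f0 \<in> supported {p \<in> S. cross2 p n1 = 0}" "f - f0 \<in> supported off_ray"
    using restr fg by blast
  obtain g0 where g0: "g0 \<in> supported {p \<in> S. cross2 p n1 = 0}" "g - g0 \<in> supported off_ray"
    using restr fg by blast
  have S: "f0 \<in> supported S" "g0 \<in> supported S" using f0 g0 by (auto simp: supported_def)
  have I1: "x + y \<in> supported off_ray"
    if "x \<in> supported off_ray" "y \<in> supported off_ray" for x y :: "real \<times> real \<Rightarrow>\<^sub>0 'k"
    using id that unfolding ideal_sr_iff by blast
  have I2: "r * x \<in> supported off_ray"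
    if "r \<in> supported S" "x \<in> supported off_ray" for x r :: "real \<times> real \<Rightarrow>\<^sub>0 'k"
    using id that unfolding ideal_sr_iff by blast
  have eq: "f0 * g0 = f * g + (- f * (g - g0) + - g0 * (f - f0))" by (simp add: algebra_simps)
  have "f0 * g0 \<in> supported off_ray"
    unfolding eq
    by (rule I1[OF fg(3) I1[OF I2[OF supported_uminus[OF fg(1)] g0(2)] I2[OF supported_uminus[OF S(2)] f0(2)]]])
  moreover have "keys (f0 * g0) \<subseteq> {p. cross2 p n1 = 0}"
  proof
    fix r assume "r \<in> keys (f0 * g0)"
    then obtain a b where "r = a + b" "a \<in> keys f0" "b \<in> keys g0"
      using keys_mult[of f0 g0] by blast
    moreover from this have "cross2 a n1 = 0" "cross2 b n1 = 0"
      using f0(1) g0(1) by (auto simp: supported_def)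
    ultimately show "r \<in> {p. cross2 p n1 = 0}" by (simp add: cross2_add_left)
  qed
  ultimately have "p \<notin> keys (f0 * g0)" for p
    unfolding supported_def off_ray_def by fastforce
  then have "f0 * g0 = 0" using keys_eq_empty by blast
  then have "f0 = 0 \<or> g0 = 0" using supported_mult_eq_0 S by blast
  then show "f \<in> supported off_ray \<or> g \<in> supported off_ray" using f0 g0 by auto
qed

lemma add_eq_0: "a \<in> S \<Longrightarrow> b \<in> S \<Longrightarrow> a + b = 0 \<Longrightarrow> b = 0"
proof (rule ccontr)
  assume ab: "a \<in> S" "b \<in> S" "a + b = 0" "b \<noteq> 0"
  have "0 < height b" using height_pos ab lattice by blast
  moreover have "0 \<le> height a" using height_pos[of a] ab lattice by (cases "a = 0") (auto simp: height_def less_imp_le)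
  ultimately show False using height_add[of a b] ab by (simp add: height_def)
qed

lemma irrelevant_maximal:
  "maximalideal (supported (S - {0}) :: (real \<times> real \<Rightarrow>\<^sub>0 'k::field) set) (semigroup_ring S)"
proof (rule maximalidealI)
  let ?M = "supported (S - {0}) :: (real \<times> real \<Rightarrow>\<^sub>0 'k) set"
  show "ideal ?M (semigroup_ring S)"
    by (rule supported_sub_ideal) (use add_eq_0 add_mem in auto)
  have "1 \<notin> ?M" by (auto simp: supported_def)
  then show "carrier (semigroup_ring S) \<noteq> ?M" using supported_1 unfolding sr_simps by blast
  fix J :: "(real \<times> real \<Rightarrow>\<^sub>0 'k) set"
  assume J: "ideal J (semigroup_ring S)" "?M \<subseteq> J" "J \<subseteq> carrier (semigroup_ring S)"
  show "J = ?M \<or> J = carrier (semigroup_ring S)"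
  proof (cases "J = ?M")
    case False
    then obtain f where f: "f \<in> J" "f \<notin> ?M" using J by blast
    then have fS: "f \<in> supported S" using J unfolding sr_simps by blast
    define c where "c = lookup f 0"
    have c: "c \<noteq> 0" using f fS by (auto simp: c_def supported_def in_keys_iff)
    have "single 0 c - f \<in> ?M"
      using fS by (auto simp: supported_def in_keys_iff lookup_minus lookup_single when_def c_def
          zero_mem split: if_splits)
    then have "(single 0 c - f) + f \<in> J" using J f unfolding ideal_sr_iff by blast
    then have "single 0 c \<in> J" by simp
    then have "single 0 (inverse c) * single 0 c \<in> J"
      using J supported_const unfolding ideal_sr_iff by blast
    then have 1: "1 \<in> J" using c by (simp add: mult_single)
    have "r \<in> J" if "r \<in> supported S" for r
      using J 1 that unfolding ideal_sr_iff by (metis mult.right_neutral)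
    then show ?thesis using J unfolding sr_simps by blast
  qed simp
qed

text \<open>
  The \<open>p \<in> S\<close> with \<open>z + p \<notin> S\<close> are all in the finite set \<open>B\<close>, since subtracting \<open>n1\<close> or \<open>n2\<close> from
  such a \<open>p\<close> leaves \<open>S\<close>; a highest one gives \<open>w = z + p\<close>.
\<close>

lemma exists_socle_exponent:
  assumes z: "z \<notin> S" "z + n1 \<in> S" "z + n2 \<in> S"
  shows "\<exists>w. w \<notin> S \<and> (\<forall>q\<in>S. q \<noteq> 0 \<longrightarrow> w + q \<in> S)"
proof -
  define Z where "Z = {p \<in> S. z + p \<notin> S}"
  have "Z \<subseteq> B"
  proof
    fix p assume p: "p \<in> Z"
    then obtain b i j where b: "b \<in> B" "p = b + real i *\<^sub>R n1 + real j *\<^sub>R n2"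
      using apery unfolding Z_def by blast
    have bS: "b \<in> S" using b B_sub by blast
    have "i = 0"
    proof (rule ccontr)
      assume "i \<noteq> 0"
      then obtain i' where "i = Suc i'" using not0_implies_Suc by blast
      then have eq: "z + p = (z + n1) + (b + (real i' *\<^sub>R n1 + real j *\<^sub>R n2))"
        using b by (simp add: algebra_simps)
      have "z + p \<in> S" unfolding eq by (rule add_mem[OF z(2) add_mem[OF bS combination_mem]])
      then show False using p by (simp add: Z_def)
    qed
    moreover have "j = 0"
    proof (rule ccontr)
      assume "j \<noteq> 0"
      then obtain j' where "j = Suc j'" using not0_implies_Suc by blast
      then have eq: "z + p = (z + n2) + (b + (real i *\<^sub>R n1 + real j' *\<^sub>R n2))"
        using b by (simp add: algebra_simps)
      have "z + p \<in> S" unfolding eq by (rule add_mem[OF z(3) add_mem[OF bS combination_mem]])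
      then show False using p by (simp add: Z_def)
    qed
    ultimately show "p \<in> B" using b by simp
  qed
  then have fin: "finite Z" using finite_B finite_subset by blast
  have "0 \<in> Z" using z zero_mem by (simp add: Z_def)
  then have "Max (height ` Z) \<in> height ` Z" using fin by (intro Max_in) auto
  then obtain p where p: "p \<in> Z" "Max (height ` Z) = height p" by blast
  have "(z + p) + q \<in> S" if q: "q \<in> S" "q \<noteq> 0" for q
  proof (rule ccontr)
    assume "(z + p) + q \<notin> S"
    then have "p + q \<in> Z" using p q add_mem by (simp add: Z_def add.assoc)
    then have "height (p + q) \<le> height p" using fin p(2)[symmetric] by simp
    moreover have "0 < height q" using height_pos q lattice by blast
    ultimately show False by (simp add: height_add)
  qed
  then show ?thesis using p by (intro exI[of _ "z + p"]) (auto simp: Z_def)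
qed

text \<open>
  Let \<open>f\<close>, \<open>g\<close> begin a regular sequence. Then \<open>g (f x\<^sup>w) = (g x\<^sup>w) f\<close> is a multiple of \<open>f\<close> in \<open>K[S]\<close>, hence so is
  \<open>f x\<^sup>w\<close>; cancelling \<open>f\<close> puts \<open>w\<close> into \<open>S\<close>.
\<close>

lemma depth_irrelevant_le_1:
  fixes f1 :: "real \<times> real \<Rightarrow>\<^sub>0 'k::field"
  assumes w: "w \<notin> S" "\<And>q. q \<in> S \<Longrightarrow> q \<noteq> 0 \<Longrightarrow> w + q \<in> S"
  shows "ideal_depth (semigroup_ring S) (supported (S - {0}) :: (real \<times> real \<Rightarrow>\<^sub>0 'k) set) \<le> 1"
  unfolding ideal_depth_def
proof (rule SUP_least)
  let ?R = "semigroup_ring S :: (real \<times> real \<Rightarrow>\<^sub>0 'k) ring"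
  interpret R: cring ?R by (rule cring_sr)
  fix xs :: "(real \<times> real \<Rightarrow>\<^sub>0 'k) list"
  assume "xs \<in> {xs. set xs \<subseteq> supported (S - {0}) \<and> regular_sequence ?R xs}"
  then have M: "set xs \<subseteq> supported (S - {0})" and reg: "regular_sequence ?R xs" by auto
  have "\<not> 2 \<le> length xs"
  proof
    assume len: "2 \<le> length xs"
    define f g where "f = xs ! 0" and "g = xs ! 1"
    have "f \<in> set xs" "g \<in> set xs"
      unfolding f_def g_def by (rule nth_mem, use len in linarith)+
    then have fM: "f \<in> supported (S - {0})" "g \<in> supported (S - {0})" using M by blast+
    then have fS: "f \<in> supported S" "g \<in> supported S" by (auto simp: supported_def)
    have nzd: "r \<in> Idl\<^bsub>?R\<^esub> (set (take i xs))"
      if "i < length xs" "r \<in> supported S" "xs ! i * r \<in> Idl\<^bsub>?R\<^esub> (set (take i xs))" for i r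
      using reg that unfolding regular_sequence_def sr_simps by blast
    have r0: "r \<in> Idl\<^bsub>?R\<^esub> {}" if "r \<in> supported S" "f * r \<in> Idl\<^bsub>?R\<^esub> {}" for r
    proof -
      have "0 < length xs" using len by linarith
      from nzd[OF this that(1)] that(2) show ?thesis unfolding f_def by simp
    qed
    have tk: "take 1 xs = [f]" using len by (cases xs) (auto simp: f_def)
    have r1: "r \<in> Idl\<^bsub>?R\<^esub> {f}" if "r \<in> supported S" "g * r \<in> Idl\<^bsub>?R\<^esub> {f}" for r
    proof -
      have "1 < length xs" using len by linarith
      from nzd[OF this that(1)] that(2) show ?thesis unfolding tk g_def[symmetric] list.set .
    qed
    note e0 = Idl_empty_sr[where ?'k = 'k]
    have f0: "f \<noteq> 0" using r0[of 1] by (auto simp: e0)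
    define G where "G = single w (1::'k)"
    have GS: "h * G \<in> supported S" if "h \<in> supported (S - {0})" for h :: "real \<times> real \<Rightarrow>\<^sub>0 'k"
    proof -
      have "r \<in> S" if r: "r \<in> keys (h * G)" for r
      proof -
        obtain a b where "r = a + b" "a \<in> keys h" "b \<in> keys G"
          using keys_mult[of h G] r by blast
        then show ?thesis using w(2)[of a] \<open>h \<in> supported (S - {0})\<close>
          by (auto simp: supported_def G_def add.commute)
      qed
      then show ?thesis by (auto simp: supported_def)
    qed
    have "g * (f * G) = (g * G) * f" by (simp add: mult_ac)
    then have "g * (f * G) \<in> Idl\<^bsub>?R\<^esub> {f}"
      unfolding Idl_singleton_sr[OF fS(1)] using GS[OF fM(2)] by blast
    then have "f * G \<in> Idl\<^bsub>?R\<^esub> {f}" using r1 GS[OF fM(1)] by blast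
    then obtain x where x: "x \<in> supported S" "f * G = x * f"
      unfolding Idl_singleton_sr[OF fS(1)] by blast
    \<comment> \<open>As \<open>G - x\<close> need not be supported in \<open>S\<close>, multiply by \<open>u\<close> before cancelling \<open>f\<close>.\<close>
    define u where "u = single n1 (1::'k)"
    have n1: "n1 \<noteq> 0" using indep by (auto simp: cross2_def)
    have uS: "u \<in> supported S" "u * G \<in> supported S"
      using n1_mem w(2)[OF n1_mem n1] by (simp_all add: u_def G_def mult_single add.commute)
    have "f * (u * G - u * x) = u * (f * G - x * f)" by (simp add: algebra_simps)
    then have "f * (u * G - u * x) = 0" using x(2) by simp
    moreover have "u * G - u * x \<in> supported S" 
      by (rule supported_diff[OF uS(2) supported_mult[OF uS(1) x(1)]])
    ultimately have "u * G = u * x" using supported_mult_eq_0[OF fS(1)] f0 by force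
    moreover have "n1 + w \<in> keys (u * G)" by (simp add: u_def G_def mult_single)
    ultimately have "n1 + w \<in> keys (u * x)" by simp
    then obtain a b where "n1 + w = a + b" "a \<in> keys u" "b \<in> keys x"
      using keys_mult[of u x] by blast
    then have "w \<in> keys x" by (simp add: u_def)
    then show False using x w by (auto simp: supported_def)
  qed
  then show "enat (length xs) \<le> 1" by (simp add: one_enat_def)
qed

lemma codim_irrelevant_ge_2:
  "2 \<le> prime_codim (semigroup_ring S) (supported (S - {0}) :: (real \<times> real \<Rightarrow>\<^sub>0 'k::field) set)"
proof -
  let ?M = "supported (S - {0}) :: (real \<times> real \<Rightarrow>\<^sub>0 'k) set"
  have n: "n1 \<noteq> 0" "n2 \<noteq> 0" using indep by (auto simp: cross2_def)
  have sub1: "{0} \<subset> (supported off_ray :: (real \<times> real \<Rightarrow>\<^sub>0 'k) set)"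
  proof
    show "{0} \<subseteq> (supported off_ray :: (real \<times> real \<Rightarrow>\<^sub>0 'k) set)" by (simp add: supported_def)
    have "single n2 1 \<in> (supported off_ray :: (real \<times> real \<Rightarrow>\<^sub>0 'k) set)"
      using n2_mem indep by (simp add: supported_def off_ray_def)
    moreover have "single n2 (1::'k) \<noteq> 0" by (metis lookup_single_eq lookup_zero zero_neq_one)
    ultimately show "{0} \<noteq> (supported off_ray :: (real \<times> real \<Rightarrow>\<^sub>0 'k) set)" by blast
  qed
  have sub2: "(supported off_ray :: (real \<times> real \<Rightarrow>\<^sub>0 'k) set) \<subset> ?M"
  proof
    have "off_ray \<subseteq> S - {0}" by (auto simp: off_ray_def cross2_def)
    then show "(supported off_ray :: (real \<times> real \<Rightarrow>\<^sub>0 'k) set) \<subseteq> ?M" by (auto simp: supported_def)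
    have "single n1 1 \<in> ?M" using n1_mem n by (simp add: supported_def)
    moreover have "single n1 (1::'k) \<notin> supported off_ray"
      by (simp add: supported_def off_ray_def cross2_def)
    ultimately show "(supported off_ray :: (real \<times> real \<Rightarrow>\<^sub>0 'k) set) \<noteq> ?M" by blast
  qed
  have "primeideal ?M (semigroup_ring S)"
    using cring.maximalideal_prime[OF cring_sr irrelevant_maximal] .
  define p where "p i = (if i = 0 then {0} else if i = 1 then supported off_ray else ?M)" for i :: nat
  have "primeideal (p i) (semigroup_ring S)" for i
    unfolding p_def using \<open>primeideal ?M (semigroup_ring S)\<close> zero_prime off_ray_prime by (auto split: if_splits)
  moreover have "p i \<subset> p (Suc i)" if "i < 2" for i
  proof -
    consider "i = 0" | "i = 1" using \<open>i < 2\<close> by linarith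
    then show ?thesis by cases (use sub1 sub2 in \<open>simp_all add: p_def\<close>)
  qed
  moreover have "p 2 = ?M" by (simp add: p_def)
  ultimately have "2 \<in> {n. \<exists>p. (\<forall>i\<le>n. primeideal (p i) (semigroup_ring S)) \<and> (\<forall>i<n. p i \<subset> p (Suc i)) \<and> p n = ?M}"
    by blast
  then have "enat 2 \<le> prime_codim (semigroup_ring S) ?M"
    unfolding prime_codim_def by (rule SUP_upper)
  then show ?thesis by (simp add: numeral_eq_enat)
qed

lemma CM_imp_gap_criterion:
  assumes CM: "Cohen_Macaulay_ring (semigroup_ring S :: (real \<times> real \<Rightarrow>\<^sub>0 'k::field) ring)"
    and z: "z + n1 \<in> S" "z + n2 \<in> S"
  shows "z \<in> S"
proof (rule ccontr)
  assume "z \<notin> S"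
  then obtain w where w: "w \<notin> S" "\<And>q. q \<in> S \<Longrightarrow> q \<noteq> 0 \<Longrightarrow> w + q \<in> S"
    using exists_socle_exponent z by blast
  let ?M = "supported (S - {0}) :: (real \<times> real \<Rightarrow>\<^sub>0 'k) set"
  have "ideal_depth (semigroup_ring S) ?M = prime_codim (semigroup_ring S) ?M"
    using CM irrelevant_maximal unfolding Cohen_Macaulay_ring_def by blast
  moreover have "2 \<le> prime_codim (semigroup_ring S) ?M" by (rule codim_irrelevant_ge_2)
  moreover have "ideal_depth (semigroup_ring S) ?M \<le> 1" by (rule depth_irrelevant_le_1[OF w])
  ultimately have "(2::enat) \<le> 1" by (metis order_trans)
  then show False by (simp add: numeral_eq_enat one_enat_def)
qed

end

context submonoid begin

text \<open>
  The linear span of \<open>E\<close> over the coefficient field, plus \<open>M\<close>; working with it avoids the quotient ring.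
\<close>

inductive_set span_mod :: "('m \<Rightarrow>\<^sub>0 'k::comm_ring_1) set \<Rightarrow> ('m \<Rightarrow>\<^sub>0 'k) set \<Rightarrow> ('m \<Rightarrow>\<^sub>0 'k) set"
  for M E where
  base: "m \<in> M \<Longrightarrow> m \<in> span_mod M E"
| gen: "e \<in> E \<Longrightarrow> single 0 c * e \<in> span_mod M E"
| add: "x \<in> span_mod M E \<Longrightarrow> y \<in> span_mod M E \<Longrightarrow> x + y \<in> span_mod M E"

lemma span_mod_gen: "e \<in> E \<Longrightarrow> e \<in> span_mod M E"
  using span_mod.gen[of e E 1 M] by simp

lemma span_mod_mono:
  assumes "x \<in> span_mod M E" "E \<subseteq> E'"
  shows "x \<in> span_mod M E'"
  using assms by (induction rule: span_mod.induct) (auto intro: span_mod.intros)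

lemma span_mod_zero: "ideal M (semigroup_ring S) \<Longrightarrow> 0 \<in> span_mod M E"
  by (rule span_mod.base) (simp add: ideal_sr_iff)

lemma span_mod_sum:
  assumes "ideal M (semigroup_ring S)" "\<And>i. i \<in> I \<Longrightarrow> f i \<in> span_mod M E"
  shows "sum f I \<in> span_mod M E"
  using assms(2) by (induction I rule: infinite_finite_induct)
    (auto intro: span_mod_zero[OF assms(1)] span_mod.add)

text \<open>The span is mapped into another one as soon as its generators are.\<close>

lemma span_mod_mult_closed:
  fixes M :: "('m \<Rightarrow>\<^sub>0 'k::comm_ring_1) set"
  assumes M: "ideal M (semigroup_ring S)" and y: "y \<in> supported S"
    and gen: "\<And>e c. e \<in> E \<Longrightarrow> y * (single 0 c * e) \<in> span_mod M E'"
    and x: "x \<in> span_mod M E"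
  shows "y * x \<in> span_mod M E'"
  using x
proof (induction rule: span_mod.induct)
  case (base m)
  then show ?case using M y by (intro span_mod.base) (auto simp: ideal_sr_iff)
next
  case (gen e c)
  then show ?case by (rule assms(3))
next
  case (add x x')
  then show ?case by (simp add: distrib_left span_mod.add)
qed

lemma span_mod_scale:
  assumes M: "ideal M (semigroup_ring S)" and x: "x \<in> span_mod M E"
  shows "single 0 c * x \<in> span_mod M E"
  by (rule span_mod_mult_closed[OF M supported_const _ x])
    (simp add: mult.assoc[symmetric] mult_single span_mod.gen)

lemma span_mod_scale_iff:
  fixes x :: "'m \<Rightarrow>\<^sub>0 'k::field"
  assumes M: "ideal M (semigroup_ring S)" and "c \<noteq> 0" and x: "single 0 c * x \<in> span_mod M E"
  shows "x \<in> span_mod M E"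
  using span_mod_scale[OF M x, of "inverse c"] \<open>c \<noteq> 0\<close> by (simp add: mult.assoc[symmetric] mult_single)

lemma span_mod_trans:
  assumes M: "ideal M (semigroup_ring S)" and x: "x \<in> span_mod M E"
    and E: "\<And>e. e \<in> E \<Longrightarrow> e \<in> span_mod M E'"
  shows "x \<in> span_mod M E'"
  using x by (induction rule: span_mod.induct)
    (auto intro: span_mod.base span_mod.add span_mod_scale[OF M E])

lemma span_mod_diff:
  assumes M: "ideal M (semigroup_ring S)" and "x \<in> span_mod M E" "y \<in> span_mod M E"
  shows "x - y \<in> span_mod M E"
  using span_mod.add[OF assms(2) span_mod_scale[OF M assms(3), of "-1"]]
  by (simp add: single_uminus)

lemma span_mod_finite:
  assumes M: "ideal M (semigroup_ring S)" and "finite E" and "x \<in> span_mod M E"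
  shows "\<exists>c. x - (\<Sum>e\<in>E. single 0 (c e) * e) \<in> M"
  using assms(3)
proof (induction rule: span_mod.induct)
  case (base m)
  then show ?case by (intro exI[of _ "\<lambda>_. 0"]) simp
next
  case (gen e c)
  have "(\<Sum>e'\<in>E. single 0 (if e' = e then c else 0) * e') =
    (\<Sum>e'\<in>E. if e' = e then single 0 c * e else 0)"
    by (rule sum.cong) auto
  also have "\<dots> = single 0 c * e"
    using gen assms(2) by simp
  finally have "single 0 c * e - (\<Sum>e'\<in>E. single 0 (if e' = e then c else 0) * e') \<in> M"
    using M by (simp add: ideal_sr_iff)
  then show ?case by (rule exI[of _ "\<lambda>e'. if e' = e then c else 0"])
next
  case (add x y)
  then obtain c d where "x - (\<Sum>e\<in>E. single 0 (c e) * e) \<in> M"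
    "y - (\<Sum>e\<in>E. single 0 (d e) * e) \<in> M" by blast
  then have "(x - (\<Sum>e\<in>E. single 0 (c e) * e)) + (y - (\<Sum>e\<in>E. single 0 (d e) * e)) \<in> M"
    using M unfolding ideal_sr_iff by blast
  then have "(x + y) - (\<Sum>e\<in>E. single 0 (c e + d e) * e) \<in> M"
    by (simp add: single_add distrib_right sum.distrib algebra_simps)
  then show ?case by (rule exI[of _ "\<lambda>e. c e + d e"])
qed

text \<open>Applied to the powers of one element, this makes it algebraic modulo \<open>M\<close>.\<close>

lemma dependency_mod_ideal:
  fixes M :: "('m \<Rightarrow>\<^sub>0 'k::field) set"
  assumes M: "ideal M (semigroup_ring S)" and E: "finite E" and a: "\<And>m::nat. a m \<in> span_mod M E"
  shows "\<exists>N k. (\<exists>m\<in>{..N}. k m \<noteq> 0) \<and> (\<Sum>m\<le>N. single 0 (k m) * a m) \<in> M"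
proof -
  have "\<forall>m. \<exists>c. a m - (\<Sum>e\<in>E. single 0 (c e) * e) \<in> M"
    using span_mod_finite[OF M E a] by blast
  from choice[OF this] obtain c
    where c: "\<And>m. a m - (\<Sum>e\<in>E. single 0 (c m e) * e) \<in> M" by blast
  have "card E < card {..card E}" by simp
  from exists_linear_dependency[OF E finite_atMost this, of c]
  obtain k where k: "\<exists>m\<in>{..card E}. k m \<noteq> 0" "\<forall>e\<in>E. (\<Sum>m\<le>card E. k m * c m e) = 0" by blast
  let ?N = "card E"
  have Msum: "sum f I \<in> M" if "\<And>i. i \<in> I \<Longrightarrow> f i \<in> M" for f and I :: "nat set"
    using that M by (induction I rule: infinite_finite_induct) (auto simp: ideal_sr_iff)
  have "(\<Sum>m\<le>?N. single 0 (k m) * (\<Sum>e\<in>E. single 0 (c m e) * e)) =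
      (\<Sum>e\<in>E. (\<Sum>m\<le>?N. single 0 (k m * c m e)) * e)"
    unfolding sum_distrib_left sum_distrib_right
    by (subst sum.swap) (simp add: mult.assoc[symmetric] mult_single)
  also have "\<dots> = 0"
  proof (rule sum.neutral, rule ballI)
    fix e assume "e \<in> E"
    have "(\<Sum>m\<le>?N. single 0 (k m * c m e)) = (single 0 (\<Sum>m\<le>?N. k m * c m e) :: 'm \<Rightarrow>\<^sub>0 'k)"
      by (rule poly_mapping_eqI) (simp add: lookup_sum lookup_single when_def)
    then show "(\<Sum>m\<le>?N. single 0 (k m * c m e)) * e = 0" using k(2) \<open>e \<in> E\<close> by simp
  qed
  finally have "(\<Sum>m\<le>?N. single 0 (k m) * a m) =
      (\<Sum>m\<le>?N. single 0 (k m) * (a m - (\<Sum>e\<in>E. single 0 (c m e) * e)))"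
    by (simp add: right_diff_distrib sum_subtractf)
  also have "\<dots> \<in> M"
    by (rule Msum) (use c M supported_const in \<open>auto simp: ideal_sr_iff\<close>)
  finally show ?thesis using k(1) by (intro exI[of _ ?N] exI[of _ k]) auto
qed

lemma maximal_inverse:
  fixes M :: "('m \<Rightarrow>\<^sub>0 'k::comm_ring_1) set"
  assumes M: "maximalideal M (semigroup_ring S)" and w: "w \<in> supported S" "w \<notin> M"
  shows "\<exists>y\<in>supported S. y * w - 1 \<in> M"
proof -
  have id: "ideal M (semigroup_ring S)" using M by (simp add: maximalideal_def)
  define J where "J = {m + y * w | m y. m \<in> M \<and> y \<in> supported S}"
  have idM: "M \<subseteq> supported S" "0 \<in> M" "\<And>x y. x \<in> M \<Longrightarrow> y \<in> M \<Longrightarrow> x + y \<in> M"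
      "\<And>r x. r \<in> supported S \<Longrightarrow> x \<in> M \<Longrightarrow> r * x \<in> M"
    using id unfolding ideal_sr_iff by blast+
  have "ideal J (semigroup_ring S)"
    unfolding ideal_sr_iff
  proof (intro conjI ballI)
    show "J \<subseteq> supported S"
      using idM(1) w(1) unfolding J_def by (auto intro!: supported_add supported_mult)
    have "(0::'m \<Rightarrow>\<^sub>0 'k) = 0 + 0 * w" by simp
    then show "0 \<in> J" unfolding J_def using idM(2) supported_0 by blast
    show "x + x' \<in> J" if xJ: "x \<in> J" "x' \<in> J" for x x'
    proof -
      obtain m y m' y' where "x = m + y * w" "x' = m' + y' * w"
        and *: "m \<in> M" "m' \<in> M" "y \<in> supported S" "y' \<in> supported S"
        using xJ unfolding J_def by blast
      then have "x + x' = (m + m') + (y + y') * w" by (simp add: algebra_simps)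
      then show ?thesis unfolding J_def using idM(3) * supported_add by blast
    qed
    show "r * x \<in> J" if rx: "r \<in> supported S" "x \<in> J" for r x
    proof -
      obtain m y where "x = m + y * w" and *: "m \<in> M" "y \<in> supported S"
        using rx unfolding J_def by blast
      then have "r * x = (r * m) + (r * y) * w" by (simp add: algebra_simps)
      then show ?thesis unfolding J_def using idM(4) * rx supported_mult by blast
    qed
  qed
  moreover have "M \<subseteq> J"
  proof
    fix m assume "m \<in> M"
    moreover have "m = m + 0 * w" by simp
    ultimately show "m \<in> J" unfolding J_def using supported_0 by blast
  qed
  moreover have "w \<in> J"
  proof -
    have "w = 0 + 1 * w" by simp
    then show ?thesis unfolding J_def using idM(2) supported_1 by blast
  qed
  moreover from calculation have "J \<subseteq> carrier (semigroup_ring S)" unfolding sr_simps ideal_sr_iff by blast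
  ultimately have "J = supported S"
    using maximalideal.I_maximal[OF M, of J] w unfolding sr_simps by blast
  then have "1 \<in> J" by simp
  then obtain m y where my: "1 = m + y * w" "m \<in> M" "y \<in> supported S" unfolding J_def by blast
  have "- 1 * m \<in> M" by (rule idM(4)[OF supported_uminus[OF supported_1] my(2)])
  moreover have "y * w - 1 = - 1 * m" using my(1) by (simp add: algebra_simps)
  ultimately have "y * w - 1 \<in> M" by (simp only:)
  then show ?thesis using my(3) by blast
qed

end

context simplicial_semigroup begin

lemma maximal_nonzero:
  fixes M :: "(real \<times> real \<Rightarrow>\<^sub>0 'k::field) set"
  assumes M: "maximalideal M (semigroup_ring S)"
  shows "\<exists>h\<in>M. h \<noteq> 0"
proof (rule ccontr)
  assume *: "\<not> (\<exists>h\<in>M. h \<noteq> 0)"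
  let ?I = "supported (S - {0}) :: (real \<times> real \<Rightarrow>\<^sub>0 'k) set"
  interpret I: maximalideal ?I "semigroup_ring S" by (rule irrelevant_maximal)
  have "M \<subseteq> ?I" using * by (auto simp: supported_def)
  then have "?I = M"
    using maximalideal.I_maximal[OF M I.is_ideal _ I.a_subset] I.I_notcarr by blast
  moreover have "single n1 1 \<in> ?I" using n1_mem indep by (auto simp: supported_def cross2_def)
  ultimately have "single n1 1 = (0 :: real \<times> real \<Rightarrow>\<^sub>0 'k)" using * by blast
  then show False by (metis lookup_single_eq lookup_zero zero_neq_one)
qed

text \<open>
  The criterion for \<open>n1\<close>, \<open>n2\<close> implies the one for their multiples, just as powers of a regular
  sequence form a regular sequence.
\<close>

lemma gap_criterion_iterated:
  assumes crit: "\<And>z. z + n1 \<in> S \<Longrightarrow> z + n2 \<in> S \<Longrightarrow> z \<in> S"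
  shows "z + real d *\<^sub>R n1 \<in> S \<Longrightarrow> z + real e *\<^sub>R n2 \<in> S \<Longrightarrow> z \<in> S"
proof -
  have step: "z \<in> S" if "z + n1 \<in> S" "z + real e *\<^sub>R n2 \<in> S" for z e
    using that
  proof (induction e)
    case (Suc e)
    have "(z + n1) + real e *\<^sub>R n2 \<in> S" by (rule add_mem[OF Suc.prems(1) scale_mem[OF n2_mem]])
    then have "(z + real e *\<^sub>R n2) + n1 \<in> S" by (simp add: add_ac)
    moreover have "(z + real e *\<^sub>R n2) + n2 \<in> S" using Suc.prems(2) by (simp add: algebra_simps)
    ultimately have "z + real e *\<^sub>R n2 \<in> S" by (rule crit)
    then show ?case using Suc by blast
  qed simp
  show "z + real d *\<^sub>R n1 \<in> S \<Longrightarrow> z + real e *\<^sub>R n2 \<in> S \<Longrightarrow> z \<in> S"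
  proof (induction d)
    case (Suc d)
    have "(z + real e *\<^sub>R n2) + real d *\<^sub>R n1 \<in> S" by (rule add_mem[OF Suc.prems(2) scale_mem[OF n1_mem]])
    then have "(z + real d *\<^sub>R n1) + real e *\<^sub>R n2 \<in> S" by (simp add: add_ac)
    moreover have "(z + real d *\<^sub>R n1) + n1 \<in> S" using Suc.prems(1) by (simp add: algebra_simps)
    ultimately have "z + real d *\<^sub>R n1 \<in> S" by (rule step[rotated])
    then show ?case using Suc by blast
  qed simp
qed

lemma leads_unique: "leads \<phi> p f \<Longrightarrow> leads \<phi> q f \<Longrightarrow> p = q"
  unfolding leads_def by force

text \<open>
  In \<open>g r = f s\<close> the leading exponents \<open>p\<close> of \<open>r\<close> and \<open>q\<close> of \<open>s\<close> satisfy \<open>p + e n2 = q + d n1\<close>, so \<open>p - d n1\<close> is in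
  \<open>S\<close> by the criterion. Hence the leading term of \<open>r\<close> is a multiple of that of \<open>f\<close> and can be removed.
\<close>

lemma regular_pair:
  fixes f g r s :: "real \<times> real \<Rightarrow>\<^sub>0 'k::field"
  assumes crit: "\<And>z. z + n1 \<in> S \<Longrightarrow> z + n2 \<in> S \<Longrightarrow> z \<in> S"
    and f: "f \<in> supported S" "leads height (real d *\<^sub>R n1) f"
    and g: "g \<in> supported S" "leads height (real e *\<^sub>R n2) g"
    and r: "r \<in> supported S" and s: "s \<in> supported S" and eq: "g * r = f * s"
  shows "\<exists>t\<in>supported S. r = f * t"
  using r s eq
proof (induction r arbitrary: s rule: leads_induct)
  case (less r)
  show ?case
  proof (cases "r = 0")
    case True
    then show ?thesis by (intro bexI[of _ 0]) auto
  next
    case False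
    then obtain p where p: "leads height p r" "p \<in> S" using supported_exists_leads less.hyps by blast
    have lp: "leads height (real e *\<^sub>R n2 + p) (f * s)"
      using leads_mult(1)[of height, OF height_add g(2) p(1)] less.prems(2) by simp
    then have "s \<noteq> 0" by (auto simp: leads_def)
    then obtain q where q: "leads height q s" "q \<in> S" using supported_exists_leads less.prems(1) by blast
    have "real e *\<^sub>R n2 + p = real d *\<^sub>R n1 + q"
      using leads_unique[OF lp leads_mult(1)[of height, OF height_add f(2) q(1)]] .
    define z where "z = p - real d *\<^sub>R n1"
    have "z + real d *\<^sub>R n1 \<in> S" using p by (simp add: z_def)
    moreover have "z + real e *\<^sub>R n2 = q"
      using \<open>real e *\<^sub>R n2 + p = real d *\<^sub>R n1 + q\<close> by (simp add: z_def algebra_simps)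
    ultimately have z: "z \<in> S" using gap_criterion_iterated[OF crit, of z d e] q by simp
    define c where "c = lookup r p / lookup f (real d *\<^sub>R n1)"
    define t0 where "t0 = single z c"
    have nz: "lookup f (real d *\<^sub>R n1) \<noteq> 0" "lookup r p \<noteq> 0"
      using f(2) p(1) by (auto simp: leads_def in_keys_iff)
    then have "leads height z t0" unfolding t0_def by (intro leads_single) (simp add: c_def)
    from leads_mult[of height, OF height_add this f(2)]
    have lt: "leads height p (t0 * f)" "lookup (t0 * f) p = lookup r p"
      using nz by (auto simp: z_def t0_def c_def)
    have t0S: "t0 \<in> supported S" unfolding t0_def using z by simp
    have "\<exists>t\<in>supported S. r - t0 * f = f * t"
    proof (rule less.IH[OF _ p(1)])
      show "r - t0 * f \<in> supported S"
        by (rule supported_diff[OF less.hyps supported_mult[OF t0S f(1)]])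
      show "\<And>q. q \<in> keys (r - t0 * f) \<Longrightarrow> height q < height p"
        using leads_cancel[OF p(1) lt(1)] lt(2) by simp
      show "s - g * t0 \<in> supported S"
        by (rule supported_diff[OF less.prems(1) supported_mult[OF g(1) t0S]])
      show "g * (r - t0 * f) = f * (s - g * t0)"
        using less.prems(2) by (simp add: algebra_simps)
    qed
    then obtain t where t: "t \<in> supported S" "r - t0 * f = f * t" by blast
    then have "r = f * (t + t0)" by (simp add: algebra_simps)
    then show ?thesis using supported_add[OF t(1) t0S] by blast
  qed
qed

end


context submonoid begin

lemma power_minus_1_mem:
  assumes M: "ideal M (semigroup_ring S)" and x: "x \<in> supported S" "x - 1 \<in> M"
  shows "x ^ m - 1 \<in> M"
proof (induction m)
  case 0
  then show ?case using M by (simp add: ideal_sr_iff)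
next
  case (Suc m)
  then have "x * (x ^ m - 1) + (x - 1) \<in> M" using M x unfolding ideal_sr_iff by blast
  then show ?case by (simp add: algebra_simps)
qed

lemma power_span_truncate:
  assumes "x \<in> span_mod M {w ^ i * e | i e. e \<in> E}"
  shows "\<exists>N::nat. x \<in> span_mod M {w ^ i * e | i e. i < N \<and> e \<in> E}"
  using assms
proof (induction rule: span_mod.induct)
  case (base m)
  then show ?case by (blast intro: span_mod.base)
next
  case (gen e c)
  then obtain i e' where "e = w ^ i * e'" "e' \<in> E" by blast
  then have "e \<in> {w ^ i * e | i e. i < Suc i \<and> e \<in> E}" by blast
  moreover have "{w ^ i * e | i e. i < Suc i \<and> e \<in> E} = {w ^ i * e | i e. e \<in> E}" by auto
  ultimately have "e \<in> {w ^ j * e | j e. j < Suc i \<and> e \<in> E}"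
    using \<open>e = w ^ i * e'\<close> \<open>e' \<in> E\<close> by blast
  then show ?case by (blast intro: span_mod.gen)
next
  case (add x y)
  then obtain N N' where "x \<in> span_mod M {w ^ i * e | i e. i < N \<and> e \<in> E}"
    "y \<in> span_mod M {w ^ i * e | i e. i < N' \<and> e \<in> E}" by blast
  moreover have "i < N \<Longrightarrow> i < max N N'" "i < N' \<Longrightarrow> i < max N N'" for i by auto
  then have "{w ^ i * e | i e. i < N \<and> e \<in> E} \<subseteq> {w ^ i * e | i e. i < max N N' \<and> e \<in> E}"
    "{w ^ i * e | i e. i < N' \<and> e \<in> E} \<subseteq> {w ^ i * e | i e. i < max N N' \<and> e \<in> E}" by blast+
  ultimately have "x \<in> span_mod M {w ^ i * e | i e. i < max N N' \<and> e \<in> E}"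
    "y \<in> span_mod M {w ^ i * e | i e. i < max N N' \<and> e \<in> E}"
    by (simp_all only: span_mod_mono)
  then show ?case by (blast intro: span_mod.add)
qed

text \<open>
  If \<open>K[S]\<close> is a finite module over \<open>K[w]\<close> modulo \<open>M\<close>, then \<open>w\<close> is algebraic modulo \<open>M\<close>. Let \<open>y\<close> be an inverse
  of \<open>w\<close>. Multiplication by \<open>y\<close> lowers the power of \<open>w\<close> in \<open>w\<^sup>i e\<close> and sends the generators \<open>e\<close> to bounded
  powers, so it preserves a finite-dimensional space. A dependency between the powers of \<open>y\<close>,
  multiplied by a power of \<open>w\<close>, is one between the powers of \<open>w\<close>.
\<close>

lemma integral_power:
  fixes M :: "('m \<Rightarrow>\<^sub>0 'k::field) set"
  assumes M: "maximalideal M (semigroup_ring S)" and w: "w \<in> supported S"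
    and E: "finite E" "E \<subseteq> supported S" "1 \<in> E"
    and spans: "supported S \<subseteq> span_mod M {w ^ i * e | i e. e \<in> E}"
  shows "\<exists>D. w ^ D \<in> span_mod M ((^) w ` {..<D})"
proof (cases "w \<in> M")
  case True
  then show ?thesis by (intro exI[of _ 1]) (simp add: span_mod.base)
next
  case False
  have id: "ideal M (semigroup_ring S)" using M by (simp add: maximalideal_def)
  obtain y where y: "y \<in> supported S" "y * w - 1 \<in> M" using maximal_inverse[OF M w False] by blast
  define W where "W N = {w ^ i * e | i e. i < N \<and> e \<in> E}" for N :: nat
  have "\<forall>e\<in>E. \<exists>N. y * e \<in> span_mod M (W N)"
    unfolding W_def using power_span_truncate spans E(2) supported_mult[OF y(1)] by blast
  from bchoice[OF this] obtain N where N: "\<And>e. e \<in> E \<Longrightarrow> y * e \<in> span_mod M (W (N e))" by blast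
  \<comment> \<open>A common bound; it is positive so that \<open>1 = w\<^sup>0\<close> is among the generators.\<close>
  define N0 where "N0 = Suc (\<Sum>e\<in>E. N e)"
  have ye: "y * e \<in> span_mod M (W N0)" if "e \<in> E" for e
  proof (rule span_mod_mono[OF N[OF that]])
    have "N e \<le> N0" using member_le_sum[of e E N] E(1) that by (simp add: N0_def)
    then show "W (N e) \<subseteq> W N0" unfolding W_def by (blast intro: less_le_trans)
  qed
  have fin: "finite (W N0)"
  proof -
    have "W N0 = (\<lambda>(i, e). w ^ i * e) ` ({..<N0} \<times> E)" unfolding W_def by auto
    then show ?thesis using E(1) by simp
  qed
  have WS: "W N0 \<subseteq> supported S" unfolding W_def using E(2) w by (auto intro!: supported_mult supported_power)
  have closed: "y * x \<in> span_mod M (W N0)" if "x \<in> span_mod M (W N0)" for x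
  proof (rule span_mod_mult_closed[OF id y(1) _ that])
    fix e' c assume "e' \<in> W N0"
    then obtain i e where e: "e' = w ^ i * e" "i < N0" "e \<in> E" unfolding W_def by blast
    have "y * e' \<in> span_mod M (W N0)"
    proof (cases i)
      case 0
      then show ?thesis using ye e by simp
    next
      case (Suc l)
      have "w ^ l * e \<in> W N0" unfolding W_def using e Suc Suc_lessD by blast
      moreover have "(w ^ l * e) * (y * w - 1) \<in> M"
        using id y(2) WS calculation unfolding ideal_sr_iff by blast
      ultimately have "(w ^ l * e) * (y * w - 1) + w ^ l * e \<in> span_mod M (W N0)"
        by (intro span_mod.add span_mod_gen span_mod.base)
      then show ?thesis using e Suc by (simp add: algebra_simps)
    qed
    from span_mod_scale[OF id this, of c]
    show "y * (single 0 c * e') \<in> span_mod M (W N0)" by (simp add: mult_ac)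
  qed
  have one: "1 \<in> W N0" unfolding W_def using E(3) by (force simp: N0_def)
  have ym: "y ^ m \<in> span_mod M (W N0)" for m
  proof (induction m)
    case 0
    then show ?case using span_mod_gen[OF one] by simp
  next
    case (Suc m)
    then show ?case using closed by simp
  qed
  from dependency_mod_ideal[OF id fin, of "\<lambda>m. y ^ m", OF ym]
  obtain C k where k: "\<exists>m\<in>{..C}. k m \<noteq> 0" "(\<Sum>m\<le>C. single 0 (k m) * y ^ m) \<in> M"
    by (elim exE conjE) (rule that)
  have terms: "single 0 (k m) * (w ^ (C - m) * (1 - (y * w) ^ m)) \<in> M" for m
  proof -
    have "(y * w) ^ m - 1 \<in> M" by (rule power_minus_1_mem[OF id supported_mult[OF y(1) w] y(2)])
    moreover have "- (single 0 (k m) * w ^ (C - m)) \<in> supported S"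
      by (intro supported_uminus supported_mult supported_const supported_power w)
    ultimately have "- (single 0 (k m) * w ^ (C - m)) * ((y * w) ^ m - 1) \<in> M"
      using id unfolding ideal_sr_iff by blast
    then show ?thesis by (simp add: algebra_simps)
  qed
  have Madd: "\<And>x y. x \<in> M \<Longrightarrow> y \<in> M \<Longrightarrow> x + y \<in> M"
    and Mmult: "\<And>r x. r \<in> supported S \<Longrightarrow> x \<in> M \<Longrightarrow> r * x \<in> M" and M0: "0 \<in> M"
    using id unfolding ideal_sr_iff by blast+
  have Msum: "sum f I \<in> M" if "\<And>i. f i \<in> M" for f and I :: "nat set"
    using that by (induction I rule: infinite_finite_induct) (auto intro: Madd M0)
  have "w ^ C * (\<Sum>m\<le>C. single 0 (k m) * y ^ m) +
      (\<Sum>m\<le>C. single 0 (k m) * (w ^ (C - m) * (1 - (y * w) ^ m))) \<in> M"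
    by (rule Madd[OF Mmult[OF supported_power[OF w] k(2)] Msum[OF terms]])
  also have "w ^ C * (\<Sum>m\<le>C. single 0 (k m) * y ^ m) +
      (\<Sum>m\<le>C. single 0 (k m) * (w ^ (C - m) * (1 - (y * w) ^ m))) =
      (\<Sum>m\<le>C. single 0 (k m) * w ^ (C - m))"
    unfolding sum_distrib_left sum.distrib[symmetric]
  proof (rule sum.cong[OF refl])
    fix m assume "m \<in> {..C}"
    then have "w ^ C = w ^ (C - m) * w ^ m" by (simp flip: power_add)
    then show "w ^ C * (single 0 (k m) * y ^ m) +
        single 0 (k m) * (w ^ (C - m) * (1 - (y * w) ^ m)) =
        single 0 (k m) * w ^ (C - m)"
      by (simp add: power_mult_distrib algebra_simps)
  qed
  finally have G: "(\<Sum>m\<le>C. single 0 (k m) * w ^ (C - m)) \<in> M" .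
  \<comment> \<open>The least index of the dependency between powers of \<open>y\<close> gives the highest power of \<open>w\<close>.\<close>
  define m0 where "m0 = (LEAST m. m \<le> C \<and> k m \<noteq> 0)"
  have m0: "m0 \<le> C \<and> k m0 \<noteq> 0" unfolding m0_def by (rule LeastI_ex) (use k(1) in auto)
  have m0': "k m = 0" if "m < m0" for m
    using not_less_Least[of m "\<lambda>m. m \<le> C \<and> k m \<noteq> 0"] that m0 unfolding m0_def by auto
  define D where "D = C - m0"
  let ?Y = "(^) w ` {..<D}"
  have "(\<Sum>m\<le>C. single 0 (k m) * w ^ (C - m)) =
      single 0 (k m0) * w ^ D + (\<Sum>m\<in>{..C} - {m0}. single 0 (k m) * w ^ (C - m))"
    unfolding D_def using m0 by (intro sum.remove) auto
  moreover have "(\<Sum>m\<in>{..C} - {m0}. single 0 (k m) * w ^ (C - m)) \<in> span_mod M ?Y"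
  proof (rule span_mod_sum[OF id])
    fix m assume m: "m \<in> {..C} - {m0}"
    show "single 0 (k m) * w ^ (C - m) \<in> span_mod M ?Y"
    proof (cases "m < m0")
      case True
      then show ?thesis using m0' span_mod_zero[OF id] by simp
    next
      case False
      then have "C - m < D" using m by (auto simp: D_def)
      then show ?thesis by (intro span_mod.gen) auto
    qed
  qed
  ultimately have "single 0 (k m0) * w ^ D = (\<Sum>m\<le>C. single 0 (k m) * w ^ (C - m)) -
      (\<Sum>m\<in>{..C} - {m0}. single 0 (k m) * w ^ (C - m))"
    and "(\<Sum>m\<in>{..C} - {m0}. single 0 (k m) * w ^ (C - m)) \<in> span_mod M ?Y"
    by simp_all
  then have "single 0 (k m0) * w ^ D \<in> span_mod M ?Y"
    using span_mod_diff[OF id span_mod.base[OF G]] by (simp only:)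
  from span_mod_scale_iff[OF id _ this] m0 have "w ^ D \<in> span_mod M ?Y" by blast
  then show ?thesis by (rule exI[of _ D])
qed

text \<open>
  Higher powers of \<open>w\<close> are reduced by means of the relation for \<open>w ^ D\<close>.
\<close>

lemma power_span_finite:
  fixes M :: "('m \<Rightarrow>\<^sub>0 'k::field) set"
  assumes M: "ideal M (semigroup_ring S)" and w: "w \<in> supported S" and E: "E \<subseteq> supported S"
    and D: "w ^ D \<in> span_mod M ((^) w ` {..<D})" and e: "e \<in> E"
  shows "w ^ i * e \<in> span_mod M {w ^ i * e | i e. i < D \<and> e \<in> E}"
proof (induction i rule: less_induct)
  case (less i)
  show ?case
  proof (cases "i < D")
    case True
    then show ?thesis using e by (intro span_mod_gen) blast
  next
    case False
    have "(w ^ (i - D) * e) * w ^ D \<in> span_mod M {w ^ i * e | i e. i < D \<and> e \<in> E}"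
    proof (rule span_mod_mult_closed[OF M _ _ D])
      show "w ^ (i - D) * e \<in> supported S" using w E e by (intro supported_mult supported_power) auto
      fix e' c assume "e' \<in> (^) w ` {..<D}"
      then obtain l where l: "l < D" "e' = w ^ l" by blast
      have "w ^ (i - D + l) * e \<in> span_mod M {w ^ i * e | i e. i < D \<and> e \<in> E}"
        by (rule less.IH) (use l False in linarith)
      from span_mod_scale[OF M this, of c]
      show "w ^ (i - D) * e * (single 0 c * e') \<in> span_mod M {w ^ i * e | i e. i < D \<and> e \<in> E}"
        using l by (simp add: power_add mult_ac)
    qed
    moreover have "(w ^ (i - D) * e) * w ^ D = w ^ i * e"
      using False by (simp add: mult_ac flip: power_add)
    ultimately show ?thesis by simp
  qed
qed

end

context simplicial_semigroup begin

lemma cross2_nat: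
  assumes "p \<in> S"
  obtains a b :: nat where "cross2 n2 p = real a" "cross2 p n1 = real b"
proof -
  have "p \<in> nat_plane" "n1 \<in> nat_plane" "n2 \<in> nat_plane" using assms n1_mem n2_mem lattice by blast+
  then show thesis using cross2_nat_of_nonneg in_cone[OF assms] that by metis
qed

text \<open>
  A grading in which \<open>u\<close> and \<open>v\<^sup>k\<close> have the same degree, so that \<open>u - v\<^sup>k\<close> is homogeneous.
\<close>

definition weight :: "nat \<Rightarrow> real \<times> real \<Rightarrow> real" where
  "weight k p = real k * cross2 n2 p + cross2 p n1"

lemma weight_add: "weight k (p + q) = weight k p + weight k q"
  by (simp add: weight_def cross2_def algebra_simps)

lemma weight_scale: "weight k (c *\<^sub>R p) = c * weight k p"
  by (simp add: weight_def cross2_def algebra_simps)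

lemma weight_n1: "weight k n1 = real k * cross2 n2 n1" and weight_n2: "weight k n2 = cross2 n2 n1"
  by (simp_all add: weight_def cross2_def algebra_simps)

lemma weight_nat:
  assumes "p \<in> S"
  obtains m :: nat where "weight k p = real m"
proof -
  obtain a b :: nat where "cross2 n2 p = real a" "cross2 p n1 = real b" using cross2_nat assms by blast
  then have "weight k p = real (k * a + b)" by (simp add: weight_def)
  then show thesis by (rule that)
qed

text \<open>
  For large \<open>k\<close> the weight \<open>k a + b\<close> is an expansion to base \<open>k\<close> of the coordinates \<open>a\<close>, \<open>b\<close> of the
  finitely many exponents.
\<close>

lemma exists_separating_weight:
  fixes h :: "real \<times> real \<Rightarrow>\<^sub>0 'k::zero"
  assumes "h \<in> supported S" "h \<noteq> 0"
  shows "\<exists>k p. 0 < k \<and> leads (weight k) p h"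
proof -
  have keys: "keys h \<subseteq> S" using assms by (simp add: supported_def)
  obtain M where M: "\<And>p. p \<in> keys h \<Longrightarrow> cross2 p n1 \<le> M"
    using bdd_above_finite[of "(\<lambda>p. cross2 p n1) ` keys h"]
    unfolding bdd_above_def by auto
  obtain K where K: "M \<le> real K" using real_arch_simple by blast
  define k where "k = Suc K"
  have "inj_on (weight k) (keys h)"
  proof (rule inj_onI)
    fix p q assume pq: "p \<in> keys h" "q \<in> keys h" "weight k p = weight k q"
    obtain a b :: nat where ab: "cross2 n2 p = real a" "cross2 p n1 = real b" using cross2_nat keys pq by blast
    obtain c d :: nat where cd: "cross2 n2 q = real c" "cross2 q n1 = real d" using cross2_nat keys pq by blast
    have "real b \<le> real K" "real d \<le> real K" using M[OF pq(1)] M[OF pq(2)] K ab cd by auto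
    then have bd: "b < k" "d < k" by (auto simp: k_def)
    have "real (k * a + b) = real (k * c + d)" using pq(3) ab cd by (simp add: weight_def)
    then have eq: "k * a + b = k * c + d" by (simp only: of_nat_eq_iff)
    have "a = c" using arg_cong[OF eq, of "\<lambda>x. x div k"] bd by simp
    moreover from this have "b = d" using eq by simp
    ultimately have "cross2 n2 n1 *\<^sub>R p = cross2 n2 n1 *\<^sub>R q" unfolding cramer_plane[of n2 n1] ab cd by simp
    then show "p = q" using indep by simp
  qed
  then show ?thesis using exists_leads assms(2) by (metis k_def zero_less_Suc)
qed

text \<open>
  Noether normalization modulo an element \<open>h\<close>: in the grading by \<open>weight k\<close>, the ring \<open>K[S]\<close> modulo \<open>h\<close> is
  finite over \<open>K[w]\<close>, where \<open>w = u - v\<^sup>k\<close>. By induction on the weight one works modulo \<open>w\<close> and monomials of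
  lower weight. Then \<open>u\<close> may be replaced by \<open>v\<^sup>k\<close>, and only the monomials of \<open>b + l n2\<close> with \<open>b \<in> B\<close>
  matter; for large \<open>l\<close> they are divisible by the leading monomial of \<open>h\<close>.
\<close>

lemma supported_span:
  fixes h :: "real \<times> real \<Rightarrow>\<^sub>0 'k::field"
  assumes M: "ideal M (semigroup_ring S)" and h: "h \<in> M" and k: "0 < k" and lead: "leads (weight k) p0 h"
  defines "w \<equiv> single n1 1 - single (real k *\<^sub>R n2) 1"
  shows "\<exists>E. finite E \<and> E \<subseteq> supported S \<and> 1 \<in> E \<and> supported S \<subseteq> span_mod M {w ^ i * e | i e. e \<in> E}"
proof -
  define X where "X p = single p (1::'k)" for p :: "real \<times> real"
  have Xadd: "X (p + q) = X p * X q" for p q by (simp add: X_def mult_single)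
  have w: "w = X n1 - X (real k *\<^sub>R n2)" by (simp add: w_def X_def)
  have wS: "w \<in> supported S" unfolding w X_def
    by (intro supported_diff supported_single n1_mem scale_mem n2_mem)
  have hS: "h \<in> supported S" using M h unfolding ideal_sr_iff by blast
  have p0: "p0 \<in> S" using lead hS by (auto simp: leads_def supported_def)
  obtain p' i0 j0 where p': "p' \<in> S" "p0 + p' = real i0 *\<^sub>R n1 + real j0 *\<^sub>R n2"
    using completion[OF p0] by blast
  \<comment> \<open>Modulo \<open>w\<close>, the monomial of \<open>p0 + p'\<close> becomes that of \<open>(k i0 + j0) n2\<close>; the summand 1 keeps the monomial 1 in \<open>E\<close>.\<close>
  define J where "J = k * i0 + j0 + 1"
  define E where "E = (\<lambda>(b, j). X (b + real j *\<^sub>R n2)) ` (B \<times> {..<J})"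
  define T where "T = span_mod M {w ^ i * e | i e. e \<in> E}"
  have Tw: "w * x \<in> T" if "x \<in> T" for x
    unfolding T_def
  proof (rule span_mod_mult_closed[OF M wS _ that[unfolded T_def]])
    fix e' c assume "e' \<in> {w ^ i * e |i e. e \<in> E}"
    then obtain i e where e: "e' = w ^ i * e" "e \<in> E" by blast
    then have "single 0 c * (w ^ Suc i * e) \<in> span_mod M {w ^ i * e | i e. e \<in> E}"
      by (intro span_mod.gen) blast
    then show "w * (single 0 c * e') \<in> span_mod M {w ^ i * e |i e. e \<in> E}"
      using e by (simp add: mult_ac)
  qed
  have Tadd: "x + y \<in> T" "x - y \<in> T" if "x \<in> T" "y \<in> T" for x y
    using that span_mod.add span_mod_diff[OF M] unfolding T_def by blast+
  have Tsum: "f \<in> T" if "\<And>q. q \<in> keys f \<Longrightarrow> X q \<in> T" for f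
  proof -
    have "(\<Sum>q\<in>keys f. single q (lookup f q)) \<in> T"
      unfolding T_def
    proof (rule span_mod_sum[OF M])
      fix q assume "q \<in> keys f"
      from span_mod_scale[OF M that[OF this, unfolded T_def], of "lookup f q"]
      show "single q (lookup f q) \<in> span_mod M {w ^ i * e | i e. e \<in> E}"
        by (simp add: X_def mult_single)
    qed
    then show ?thesis by (simp only: sum_single_keys)
  qed
  have ET: "x \<in> T" if "x \<in> E" for x
  proof -
    have "w ^ 0 * x \<in> {w ^ i * e | i e. e \<in> E}" using that by blast
    from span_mod_gen[OF this, of M] show ?thesis unfolding T_def by simp
  qed
  have mono: "X p \<in> T" if "p \<in> S" "weight k p = real n" for p n
    using that
  proof (induction n arbitrary: p rule: less_induct)
    case (less n)
    have lower: "X q \<in> T" if q: "q \<in> S" "weight k q < real n" for q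
    proof -
      obtain m where m: "weight k q = real m" using weight_nat[OF q(1)] by blast
      then show ?thesis using less.IH[of m q] q by simp
    qed
    \<comment> \<open>Replacing \<open>u\<close> by \<open>v\<^sup>k\<close> changes the monomial by a multiple of \<open>w\<close> of lower weight.\<close>
    have swap: "X (s + n1) \<in> T \<longleftrightarrow> X (s + real k *\<^sub>R n2) \<in> T"
      if s: "s \<in> S" "weight k (s + n1) = real n" for s
    proof -
      have "0 < real k * cross2 n2 n1" using k indep by simp
      then have "weight k s < real n" using s(2) by (simp add: weight_add weight_n1)
      then have ws: "w * X s \<in> T" by (intro Tw lower s)
      have eq: "X (s + n1) = X (s + real k *\<^sub>R n2) + w * X s"
        by (simp add: w Xadd algebra_simps)
      show ?thesis
      proof
        assume "X (s + n1) \<in> T"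
        from Tadd(2)[OF this ws] show "X (s + real k *\<^sub>R n2) \<in> T" by (simp add: eq)
      next
        assume "X (s + real k *\<^sub>R n2) \<in> T"
        from Tadd(1)[OF this ws] show "X (s + n1) \<in> T" by (simp only: eq)
      qed
    qed
    have swaps: "X (s + real i *\<^sub>R n1) \<in> T \<longleftrightarrow> X (s + real (k * i) *\<^sub>R n2) \<in> T"
      if "s \<in> S" "weight k (s + real i *\<^sub>R n1) = real n" for s i
      using that
    proof (induction i arbitrary: s)
      case (Suc i)
      have eq: "s + real (Suc i) *\<^sub>R n1 = (s + n1) + real i *\<^sub>R n1" by (simp add: algebra_simps)
      have "X ((s + n1) + real i *\<^sub>R n1) \<in> T \<longleftrightarrow> X ((s + n1) + real (k * i) *\<^sub>R n2) \<in> T"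
      proof (rule Suc.IH)
        show "s + n1 \<in> S" by (rule add_mem[OF Suc.prems(1) n1_mem])
        show "weight k ((s + n1) + real i *\<^sub>R n1) = real n" using Suc.prems(2) by (simp only: eq)
      qed
      also have "(s + n1) + real (k * i) *\<^sub>R n2 = (s + real (k * i) *\<^sub>R n2) + n1" by (simp add: add_ac)
      also have "X ((s + real (k * i) *\<^sub>R n2) + n1) \<in> T \<longleftrightarrow> X ((s + real (k * i) *\<^sub>R n2) + real k *\<^sub>R n2) \<in> T"
      proof (rule swap)
        show "s + real (k * i) *\<^sub>R n2 \<in> S" by (intro add_mem scale_mem n2_mem Suc.prems)
        show "weight k ((s + real (k * i) *\<^sub>R n2) + n1) = real n"
          using Suc.prems(2) by (simp add: weight_add weight_scale weight_n1 weight_n2 algebra_simps)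
      qed
      also have "(s + real (k * i) *\<^sub>R n2) + real k *\<^sub>R n2 = s + real (k * Suc i) *\<^sub>R n2"
        by (simp add: algebra_simps)
      finally show ?case unfolding eq .
    qed simp
    obtain b i j where b: "b \<in> B" "p = b + real i *\<^sub>R n1 + real j *\<^sub>R n2" using apery less.prems by blast
    have bS: "b \<in> S" using b B_sub by blast
    define l where "l = j + k * i"
    have wl: "weight k (b + real l *\<^sub>R n2) = real n"
      using less.prems(2) b by (simp add: l_def weight_add weight_scale weight_n1 weight_n2 algebra_simps)
    have "X (b + real l *\<^sub>R n2) \<in> T"
    proof (cases "l < J")
      case True
      then show ?thesis using b by (intro ET) (auto simp: E_def)
    next
      case False
      define l' where "l' = l - k * i0 - j0"
      have l: "l = l' + j0 + k * i0" using False by (simp add: l'_def J_def)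
      define s where "s = b + real (l' + j0) *\<^sub>R n2"
      have sS: "s \<in> S" unfolding s_def by (intro add_mem bS scale_mem n2_mem)
      define q where "q = b + real l' *\<^sub>R n2 + p'"
      have qS: "q \<in> S" unfolding q_def by (intro add_mem bS scale_mem n2_mem p')
      have sq: "s + real i0 *\<^sub>R n1 = q + p0"
        using p'(2) by (simp add: s_def q_def algebra_simps)
      have ws: "weight k (s + real i0 *\<^sub>R n1) = real n"
        using wl by (simp add: s_def l weight_add weight_scale weight_n1 weight_n2 algebra_simps)
      define c where "c = lookup h p0"
      have c: "c \<noteq> 0" using lead by (auto simp: c_def leads_def in_keys_iff)
      have lqh: "leads (weight k) (q + p0) (X q * h)" "lookup (X q * h) (q + p0) = c"
        using leads_mult[of "weight k", OF weight_add leads_single lead, of 1 q] by (simp_all add: X_def c_def)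
      define r where "r = X q * h - single (q + p0) c"
      have XqS: "X q \<in> supported S" using qS by (simp add: X_def)
      have rS: "r \<in> supported S" unfolding r_def
        by (rule supported_diff[OF supported_mult[OF XqS hS] supported_single[OF add_mem[OF qS p0]]])
      have "r \<in> T"
      proof (rule Tsum, rule lower)
        fix x assume x: "x \<in> keys r"
        then show "x \<in> S" using rS by (auto simp: supported_def)
        have "weight k x < weight k (q + p0)"
          using leads_cancel[OF lqh(1) leads_single[OF c], of x] lqh(2) x by (simp add: r_def)
        then show "weight k x < real n" using ws sq by simp
      qed
      moreover have "X q * h \<in> T"
        unfolding T_def using M h XqS by (intro span_mod.base) (auto simp: ideal_sr_iff)
      ultimately have "X q * h - r \<in> T" using Tadd by blast
      then have "single 0 c * X (q + p0) \<in> T" by (simp add: r_def X_def mult_single)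
      then have "X (q + p0) \<in> T" unfolding T_def by (rule span_mod_scale_iff[OF M c])
      then have "X (s + real (k * i0) *\<^sub>R n2) \<in> T" using swaps[OF sS ws] sq by simp
      moreover have "s + real (k * i0) *\<^sub>R n2 = b + real l *\<^sub>R n2"
        by (simp add: s_def l algebra_simps)
      ultimately show ?thesis by simp
    qed
    moreover have "b + real l *\<^sub>R n2 = (b + real j *\<^sub>R n2) + real (k * i) *\<^sub>R n2"
      by (simp add: l_def algebra_simps)
    moreover have "p = (b + real j *\<^sub>R n2) + real i *\<^sub>R n1" using b by (simp add: add_ac)
    ultimately show ?case
      using swaps[of "b + real j *\<^sub>R n2" i] less.prems(2) add_mem[OF bS scale_mem[OF n2_mem]] by simp
  qed
  have "supported S \<subseteq> T"
  proof
    fix f :: "real \<times> real \<Rightarrow>\<^sub>0 'k" assume f: "f \<in> supported S"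
    show "f \<in> T"
    proof (rule Tsum)
      fix q assume "q \<in> keys f"
      then have "q \<in> S" using f by (auto simp: supported_def)
      then obtain m where "weight k q = real m" using weight_nat by blast
      then show "X q \<in> T" using mono \<open>q \<in> S\<close> by blast
    qed
  qed
  moreover have "1 \<in> E"
  proof -
    obtain b i j where b: "b \<in> B" "0 = b + real i *\<^sub>R n1 + real j *\<^sub>R n2" using apery zero_mem by blast
    then have "(real i *\<^sub>R n1 + real j *\<^sub>R n2) + b = 0" by (simp add: add_ac)
    then have "b = 0" using add_eq_0[OF combination_mem, of b i j] b B_sub by blast
    then have "(0, 0) \<in> B \<times> {..<J}" using b by (simp add: J_def)
    moreover have "1 = X (0 + real 0 *\<^sub>R n2)" by (simp add: X_def)
    ultimately show ?thesis unfolding E_def by (auto intro!: image_eqI[of _ _ "(0, 0)"])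
  qed
  moreover have "finite E" unfolding E_def using finite_B by simp
  moreover have "E \<subseteq> supported S"
    unfolding E_def X_def using B_sub by (auto intro!: supported_single add_mem scale_mem n2_mem)
  ultimately show ?thesis unfolding T_def by blast
qed

text \<open>Zariski's lemma for semigroup rings.\<close>

lemma maximal_quotient_finite:
  fixes M :: "(real \<times> real \<Rightarrow>\<^sub>0 'k::field) set"
  assumes M: "maximalideal M (semigroup_ring S)"
  shows "\<exists>E. finite E \<and> supported S \<subseteq> span_mod M E"
proof -
  have id: "ideal M (semigroup_ring S)" using M by (simp add: maximalideal_def)
  obtain h where h: "h \<in> M" "h \<noteq> 0" using maximal_nonzero[OF M] by blast
  then have "h \<in> supported S" using id unfolding ideal_sr_iff by blast
  then obtain k p where k: "0 < k" "leads (weight k) p h" using exists_separating_weight h by blast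
  define w where "w = single n1 (1::'k) - single (real k *\<^sub>R n2) 1"
  have wS: "w \<in> supported S" unfolding w_def
    by (intro supported_diff supported_single n1_mem scale_mem n2_mem)
  from supported_span[OF id h(1) k, folded w_def] obtain E where E: "finite E" "E \<subseteq> supported S" "1 \<in> E"
    "supported S \<subseteq> span_mod M {w ^ i * e | i e. e \<in> E}" by (elim exE conjE) (rule that)
  obtain D where D: "w ^ D \<in> span_mod M ((^) w ` {..<D})"
    using integral_power[OF M wS E] by blast
  let ?W = "{w ^ i * e | i e. i < D \<and> e \<in> E}"
  have "?W = (\<lambda>(i, e). w ^ i * e) ` ({..<D} \<times> E)" by auto
  then have "finite ?W" using E(1) by simp
  moreover have "supported S \<subseteq> span_mod M ?W"
  proof
    fix x :: "real \<times> real \<Rightarrow>\<^sub>0 'k" assume "x \<in> supported S"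
    then have x: "x \<in> span_mod M {w ^ i * e | i e. e \<in> E}" using E(4) by blast
    show "x \<in> span_mod M ?W"
    proof (rule span_mod_trans[OF id x])
      fix e' assume "e' \<in> {w ^ i * e | i e. e \<in> E}"
      then obtain i e where "e' = w ^ i * e" "e \<in> E" by blast
      then show "e' \<in> span_mod M ?W" using power_span_finite[OF id wS E(2) D] by simp
    qed
  qed
  ultimately show ?thesis by blast
qed

lemma maximal_contains_ray_polynomial:
  fixes M :: "(real \<times> real \<Rightarrow>\<^sub>0 'k::field) set"
  assumes M: "maximalideal M (semigroup_ring S)" and n: "n \<in> S" "n \<noteq> 0"
  shows "\<exists>f\<in>M. \<exists>d. leads height (real d *\<^sub>R n) f"
proof -
  have id: "ideal M (semigroup_ring S)" using M by (simp add: maximalideal_def)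
  obtain E where E: "finite E" "supported S \<subseteq> span_mod M E" using maximal_quotient_finite[OF M] by blast
  define a where "a m = single (real m *\<^sub>R n) (1::'k)" for m :: nat
  have "a m \<in> span_mod M E" for m using E(2) scale_mem[OF n(1)] unfolding a_def by (blast intro: supported_single)
  from dependency_mod_ideal[OF id E(1), of a, OF this]
  obtain N k where k: "\<exists>m\<in>{..N}. k m \<noteq> 0" "(\<Sum>m\<le>N. single 0 (k m) * a m) \<in> M"
    by (elim exE conjE) (rule that)
  define f where "f = (\<Sum>m\<le>N. single 0 (k m) * a m)"
  have f: "f = (\<Sum>m\<le>N. single (real m *\<^sub>R n) (k m))"
    by (simp add: f_def a_def mult_single)
  define d where "d = Max {m. m \<le> N \<and> k m \<noteq> 0}"
  have fin: "finite {m. m \<le> N \<and> k m \<noteq> 0}" by simp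
  have "d \<in> {m. m \<le> N \<and> k m \<noteq> 0}" unfolding d_def by (rule Max_in[OF fin]) (use k(1) in auto)
  then have d: "d \<le> N" "k d \<noteq> 0" by auto
  have dmax: "m \<le> d" if "m \<le> N" "k m \<noteq> 0" for m unfolding d_def by (rule Max_ge[OF fin]) (use that in simp)
  have inj: "real m *\<^sub>R n = real m' *\<^sub>R n \<longleftrightarrow> m = m'" for m m' using n by simp
  have "lookup f (real d *\<^sub>R n) = k d"
    using d(1) by (simp add: f lookup_sum lookup_single when_def n(2))
  moreover have "height q < height (real d *\<^sub>R n)"
    if q: "q \<in> keys f" "q \<noteq> real d *\<^sub>R n" for q
  proof -
    obtain m where m: "m \<le> N" "q \<in> keys (single (real m *\<^sub>R n) (k m))"
      using q(1) keys_sum[of "\<lambda>m. single (real m *\<^sub>R n) (k m)" "{..N}"] unfolding f by blast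
    then have qm: "q = real m *\<^sub>R n" "k m \<noteq> 0" by (auto split: if_splits)
    then have "m < d" using dmax[OF m(1)] q(2) by (cases "m = d") auto
    moreover have "height (real m *\<^sub>R n) = real m * height n" for m
      by (simp add: height_def algebra_simps)
    moreover have "0 < height n" using height_pos n lattice by blast
    ultimately show ?thesis using qm by simp
  qed
  ultimately have "leads height (real d *\<^sub>R n) f"
    using d(2) unfolding leads_def by (simp add: in_keys_iff)
  then show ?thesis using k(2) unfolding f_def by blast
qed

text \<open>
  \<open>M\<close> contains a polynomial in \<open>u\<close> and a polynomial in \<open>v\<close>, which form a regular sequence.
\<close>

lemma gap_criterion_imp_depth_ge_2:
  fixes M :: "(real \<times> real \<Rightarrow>\<^sub>0 'k::field) set"
  assumes crit: "\<And>z. z + n1 \<in> S \<Longrightarrow> z + n2 \<in> S \<Longrightarrow> z \<in> S"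
    and M: "maximalideal M (semigroup_ring S)"
  shows "2 \<le> ideal_depth (semigroup_ring S) M"
proof -
  let ?R = "semigroup_ring S :: (real \<times> real \<Rightarrow>\<^sub>0 'k) ring"
  interpret R: cring ?R by (rule cring_sr)
  interpret M: maximalideal M ?R by fact
  have n: "n1 \<noteq> 0" "n2 \<noteq> 0" using indep by (auto simp: cross2_def)
  obtain f d where f: "f \<in> M" "leads height (real d *\<^sub>R n1) f"
    using maximal_contains_ray_polynomial[OF M n1_mem n(1)] by blast
  obtain g e where g: "g \<in> M" "leads height (real e *\<^sub>R n2) g"
    using maximal_contains_ray_polynomial[OF M n2_mem n(2)] by blast
  have fg: "f \<in> supported S" "g \<in> supported S"
    using f(1) g(1) M.a_subset unfolding sr_simps by blast+
  have f0: "f \<noteq> 0" using f(2) by (auto simp: leads_def)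
  note e0 = Idl_empty_sr[where ?'k = 'k] and ef = Idl_singleton_sr[OF fg(1)]
  have "Idl\<^bsub>?R\<^esub> {f, g} \<subseteq> M" by (rule R.genideal_minimal[OF M.is_ideal]) (use f g in auto)
  then have proper: "Idl\<^bsub>?R\<^esub> {f, g} \<noteq> carrier ?R" using M.I_notcarr M.a_subset by blast
  have "regular_sequence ?R [f, g]"
    unfolding regular_sequence_def
  proof (intro conjI allI impI ballI)
    show "set [f, g] \<subseteq> carrier ?R" using fg unfolding sr_simps by simp
    show "Idl\<^bsub>?R\<^esub> (set [f, g]) \<noteq> carrier ?R" using proper by simp
    fix i r assume i: "i < length [f, g]" and r: "r \<in> carrier ?R"
      and mem: "[f, g] ! i \<otimes>\<^bsub>?R\<^esub> r \<in> Idl\<^bsub>?R\<^esub> set (take i [f, g])"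
    have rS: "r \<in> supported S" using r unfolding sr_simps .
    consider "i = 0" | "i = 1" using i by fastforce
    then show "r \<in> Idl\<^bsub>?R\<^esub> set (take i [f, g])"
    proof cases
      case 1
      then have "f * r = 0" using mem by (simp add: e0 mult_sr)
      then show ?thesis using supported_mult_eq_0[OF fg(1) rS] f0 1 e0 by simp
    next
      case 2
      then have "g * r \<in> Idl\<^bsub>?R\<^esub> {f}" using mem by (simp add: mult_sr)
      then obtain s where s: "s \<in> supported S" "g * r = f * s" unfolding ef by (auto simp: mult.commute)
      obtain t where "t \<in> supported S" "r = f * t"
        using regular_pair[OF crit fg(1) f(2) fg(2) g(2) rS s] by blast
      then have "r \<in> Idl\<^bsub>?R\<^esub> {f}" unfolding ef by (auto simp: mult.commute)
      then show ?thesis using 2 by simp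
    qed
  qed
  then have "enat (length [f, g]) \<le> ideal_depth ?R M"
    unfolding ideal_depth_def using f g by (intro SUP_upper) auto
  then show ?thesis by (simp add: numeral_eq_enat numeral_2_eq_2)
qed

theorem Cohen_Macaulay_iff_gap_criterion:
  "Cohen_Macaulay_ring (semigroup_ring S :: (real \<times> real \<Rightarrow>\<^sub>0 'k::field) ring) \<longleftrightarrow>
    (\<forall>z. z + n1 \<in> S \<and> z + n2 \<in> S \<longrightarrow> z \<in> S)"
proof
  assume "Cohen_Macaulay_ring (semigroup_ring S :: (real \<times> real \<Rightarrow>\<^sub>0 'k) ring)"
  then show "\<forall>z. z + n1 \<in> S \<and> z + n2 \<in> S \<longrightarrow> z \<in> S" using CM_imp_gap_criterion by blast
next
  let ?R = "semigroup_ring S :: (real \<times> real \<Rightarrow>\<^sub>0 'k) ring"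
  assume crit: "\<forall>z. z + n1 \<in> S \<and> z + n2 \<in> S \<longrightarrow> z \<in> S"
  show "Cohen_Macaulay_ring ?R"
    unfolding Cohen_Macaulay_ring_def
  proof (intro conjI allI impI)
    show "cring ?R" by (rule cring_sr)
    show "noetherian_ring ?R" by (rule noetherian_sr)
    fix M assume M: "maximalideal M ?R"
    have "primeideal M ?R" using cring.maximalideal_prime[OF cring_sr M] .
    then have "ideal_depth ?R M \<le> prime_codim ?R M" by (rule ideal_depth_le_prime_codim)
    moreover have "prime_codim ?R M \<le> 2" by (rule prime_codim_sr_le_2)
    moreover have "2 \<le> ideal_depth ?R M"
      using crit by (intro gap_criterion_imp_depth_ge_2 M) blast
    ultimately show "ideal_depth ?R M = prime_codim ?R M" by (metis order_antisym order_trans)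
  qed
qed

end

section \<open>A corner of the polygon on an extremal ray\<close>

text \<open>The linear form that is 1 on the line through \<open>a\<close> and \<open>p\<close>.\<close>

definition edge_form :: "real \<times> real \<Rightarrow> real \<times> real \<Rightarrow> real \<times> real \<Rightarrow> real" where
  "edge_form p a x = cross2 (p - a) x / cross2 p a"

lemma edge_form_add: "edge_form p a (x + y) = edge_form p a x + edge_form p a y"
  by (simp add: edge_form_def cross2_add_right add_divide_distrib)
lemma edge_form_diff: "edge_form p a (x - y) = edge_form p a x - edge_form p a y"
  by (simp add: edge_form_def cross2_diff_right diff_divide_distrib)
lemma edge_form_scale: "edge_form p a (c *\<^sub>R x) = c * edge_form p a x"
  by (simp add: edge_form_def cross2_scale_right)
lemma edge_form_0 [simp]: "edge_form p a 0 = 0"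
  by (simp add: edge_form_def)
lemma edge_form_ends: "cross2 p a \<noteq> 0 \<Longrightarrow> edge_form p a a = 1" "cross2 p a \<noteq> 0 \<Longrightarrow> edge_form p a p = 1"
  by (simp_all add: edge_form_def cross2_diff_left cross2_flip[of a p])

lemma convex_triangle_mem:
  assumes "convex F" "a \<in> F" "p \<in> F" "q \<in> F" "0 \<le> s" "0 \<le> t" "s + t \<le> 1"
  shows "a + s *\<^sub>R (p - a) + t *\<^sub>R (q - a) \<in> F"
proof (cases "s + t = 0")
  case True
  then have "s = 0" "t = 0" using assms by auto
  then show ?thesis using assms by simp
next
  case False
  define y where "y = (s / (s + t)) *\<^sub>R p + (t / (s + t)) *\<^sub>R q"
  have "y \<in> F" unfolding y_def
    by (rule convexD[OF assms(1,3,4)]) (use assms False in \<open>auto simp: add_divide_distrib[symmetric]\<close>)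
  then have "(1 - (s + t)) *\<^sub>R a + (s + t) *\<^sub>R y \<in> F"
    using assms by (intro convexD[OF assms(1)]) auto
  moreover have "(s + t) *\<^sub>R y = s *\<^sub>R p + t *\<^sub>R q"
    using False by (simp add: y_def scaleR_add_right)
  ultimately show ?thesis by (simp add: algebra_simps)
qed

text \<open>
  A nonconstant affine function has no maximum in the interior; \<open>v\<close> is a direction in which \<open>f\<close>
  increases.
\<close>

lemma interior_below_linear:
  fixes f :: "real \<times> real \<Rightarrow> real"
  assumes x: "x \<in> interior T" and T: "\<And>y. y \<in> T \<Longrightarrow> f y \<le> c"
    and f: "\<And>t. f (x + t *\<^sub>R v) = f x + t * d" "0 < d"
  shows "f x < c"
proof -
  obtain e where e: "0 < e" "cball x e \<subseteq> T"
    using x mem_interior_cball by blast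
  define t where "t = e / (norm v + 1)"
  have t: "0 < t" using e by (simp add: t_def add_nonneg_pos)
  have "norm (t *\<^sub>R v) = e * norm v / (norm v + 1)" using e(1) by (simp add: t_def add_nonneg_pos)
  also have "\<dots> \<le> e" using e(1) by (subst pos_divide_le_eq) (auto simp: add_nonneg_pos distrib_left)
  finally have "norm (t *\<^sub>R v) \<le> e" .
  then have "x + t *\<^sub>R v \<in> T" using e(2) by (auto simp: dist_norm mem_cball)
  then have "f x + t * d \<le> c" using T f by metis
  moreover have "0 < t * d" using t f(2) by simp
  ultimately show ?thesis by linarith
qed

text \<open>
  \<open>a\<close> is a vertex of \<open>F\<close> and \<open>p\<close>, \<open>q\<close> are its neighbours, \<open>q\<close> on the side facing the origin. The bounds say
  that \<open>z \<in> r F\<close> requires \<open>edge_form p a z \<le> r \<le> edge_form q a z\<close>.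
\<close>

locale corner =
  fixes F :: "(real \<times> real) set" and a p q :: "real \<times> real"
  assumes conv: "convex F" and aF: "a \<in> F" and pF: "p \<in> F" and qF: "q \<in> F"
    and pa: "cross2 p a \<noteq> 0" and qa: "cross2 q a \<noteq> 0"
    and upper: "x \<in> F \<Longrightarrow> edge_form p a x \<le> 1"
    and lower: "x \<in> F \<Longrightarrow> 1 \<le> edge_form q a x"
    and strict_p: "1 < edge_form q a p" and strict_q: "edge_form p a q < 1"
begin

text \<open>
  The length of the interval that the two edge forms allow for the dilation factor of \<open>x\<close>; it vanishes on the ray through \<open>a\<close>.
\<close>

definition width :: "real \<times> real \<Rightarrow> real" where
  "width x = edge_form q a x - edge_form p a x"

text \<open>
  The direction of the edge from \<open>a\<close> to \<open>p\<close>, scaled to width 1. The third vertex of the gap triangle.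
\<close>

definition apex :: "real \<times> real" where
  "apex = (1 / width p) *\<^sub>R (p - a)"

lemma a_nonzero: "a \<noteq> 0" using pa by auto

lemma width_add: "width (x + y) = width x + width y"
  and width_scale: "width (c *\<^sub>R x) = c * width x"
  and width_diff: "width (x - y) = width x - width y"
  by (simp_all add: width_def edge_form_add edge_form_scale edge_form_diff algebra_simps)

lemma width_a [simp]: "width a = 0"
  using pa qa by (simp add: width_def edge_form_ends)

lemma edge_vals: "edge_form p a a = 1" "edge_form q a a = 1" "edge_form p a p = 1" "edge_form q a q = 1"
  using pa qa by (simp_all add: edge_form_ends)

lemma width_p: "width p = edge_form q a p - 1" "0 < width p"
  using strict_p edge_vals by (simp_all add: width_def)
lemma width_q: "width q = 1 - edge_form p a q" "0 < width q"
  using strict_q edge_vals by (simp_all add: width_def)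

text \<open>
  In the basis \<open>a\<close>, \<open>apex\<close> the two edge forms are the first coordinate and the sum of the coordinates.
\<close>

lemma coordinates: "x = edge_form p a x *\<^sub>R a + width x *\<^sub>R apex"
proof -
  define c d where "c = cross2 p x / cross2 p a" and "d = cross2 x a / cross2 p a"
  have x: "x = c *\<^sub>R a + d *\<^sub>R p"
  proof -
    have "(1 / cross2 p a) *\<^sub>R (cross2 p a *\<^sub>R x) = (1 / cross2 p a) *\<^sub>R (cross2 p x *\<^sub>R a + cross2 x a *\<^sub>R p)"
      by (simp only: cramer_plane[of p a x])
    then show ?thesis using pa by (simp add: c_def d_def scaleR_add_right)
  qed
  have "edge_form p a x = c + d" by (subst x) (simp add: edge_form_add edge_form_scale edge_vals)
  moreover have "width x = d * width p" by (subst x) (simp add: width_add width_scale)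
  ultimately show ?thesis using width_p(2) by (subst x) (simp add: apex_def algebra_simps)
qed

lemma apex_vals: "edge_form p a apex = 0" "width apex = 1" "edge_form q a apex = 1"
proof -
  show 1: "edge_form p a apex = 0" by (simp add: apex_def edge_form_scale edge_form_diff edge_vals)
  show 2: "width apex = 1" using width_p(2) by (simp add: apex_def width_scale width_diff)
  show "edge_form q a apex = 1" using 1 2 by (simp add: width_def)
qed

lemma p_coords: "p - a = width p *\<^sub>R apex"
  using width_p(2) by (simp add: apex_def)

lemma q_coords: "q - a = width q *\<^sub>R (apex - a)"
  by (subst coordinates[of q]) (simp add: width_q(1) algebra_simps)

text \<open>
  \<open>z\<close> is reached from \<open>r a\<close> along the two edges; the hypothesis says that the coefficients of
  \<open>p - a\<close> and \<open>q - a\<close> sum up to at most \<open>r\<close>, that is, that \<open>z\<close> is in the dilated triangle \<open>a\<close>, \<open>p\<close>, \<open>q\<close>.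
\<close>

lemma dilate_mem:
  assumes r: "0 < r" "edge_form p a z \<le> r" "r \<le> edge_form q a z"
    and "(edge_form q a z - r) / width p + (r - edge_form p a z) / width q \<le> r"
  shows "\<exists>x\<in>F. z = r *\<^sub>R x"
proof -
  define s t where "s = (edge_form q a z - r) / (r * width p)" and "t = (r - edge_form p a z) / (r * width q)"
  have st: "0 \<le> s" "0 \<le> t" using r width_p(2) width_q(2) by (auto simp: s_def t_def)
  have "s = ((edge_form q a z - r) / width p) / r" "t = ((r - edge_form p a z) / width q) / r"
    by (simp_all add: s_def t_def mult.commute)
  then have "s + t = ((edge_form q a z - r) / width p + (r - edge_form p a z) / width q) / r"
    by (simp add: add_divide_distrib)
  then have "s + t \<le> 1" using assms(4) r(1) by (simp add: divide_le_eq)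
  then have "a + s *\<^sub>R (p - a) + t *\<^sub>R (q - a) \<in> F"
    using convex_triangle_mem[OF conv aF pF qF] st by blast
  moreover have "z = r *\<^sub>R (a + s *\<^sub>R (p - a) + t *\<^sub>R (q - a))"
  proof -
    have sr: "r * s * width p = edge_form q a z - r" and tr: "r * t * width q = r - edge_form p a z"
      using r(1) width_p(2) width_q(2) by (simp_all add: s_def t_def)
    have "r *\<^sub>R (a + s *\<^sub>R (p - a) + t *\<^sub>R (q - a)) =
      r *\<^sub>R a + (r * s * width p) *\<^sub>R apex + (r * t * width q) *\<^sub>R (apex - a)"
      by (simp add: p_coords q_coords scaleR_add_right mult.assoc)
    also have "\<dots> = edge_form p a z *\<^sub>R a + width z *\<^sub>R apex"
      unfolding sr tr by (simp add: width_def algebra_simps)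
    finally show ?thesis using coordinates[of z] by simp
  qed
  ultimately show ?thesis by blast
qed

text \<open>
  From level \<open>h\<close> on, both edges at \<open>a\<close>, dilated by \<open>h\<close> and \<open>h + 1\<close>, are long enough to reach each other.
\<close>

definition level_ok :: "nat \<Rightarrow> bool" where
  "level_ok h \<longleftrightarrow> 1 \<le> real h * width p \<and> 1 \<le> real (h + 1) * width q"

lemma level_ok_mono: "level_ok h \<Longrightarrow> h \<le> h' \<Longrightarrow> level_ok h'"
  using width_p(2) width_q(2) unfolding level_ok_def
  by (meson add_le_mono1 less_imp_le mult_right_mono of_nat_le_iff order_trans)

lemma exists_level_ok: "\<exists>h. 0 < h \<and> level_ok h"
proof -
  obtain h1 h2 :: nat where h: "1 / width p \<le> real h1" "1 / width q \<le> real h2"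
    using real_arch_simple by metis
  have "1 \<le> real (Suc (h1 + h2)) * width p" "1 \<le> real (Suc (h1 + h2) + 1) * width q"
  proof -
    have "1 / width p \<le> real (Suc (h1 + h2))" "1 / width q \<le> real (Suc (h1 + h2) + 1)" using h by auto
    then show "1 \<le> real (Suc (h1 + h2)) * width p" "1 \<le> real (Suc (h1 + h2) + 1) * width q"
      using width_p(2) width_q(2) by (simp_all add: divide_le_eq)
  qed
  then show ?thesis unfolding level_ok_def by blast
qed

lemma level_ok_pos: "level_ok h \<Longrightarrow> 0 < h"
  by (cases h) (auto simp: level_ok_def)

lemma gap_meet_eq: "gap_meet a p q h = (if level_ok h then {real h *\<^sub>R a + apex} else {})"
proof -
  have fwd: "X = real h *\<^sub>R a + apex \<and> level_ok h" if "X \<in> gap_meet a p q h" for X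
  proof -
    obtain y y' where y: "y \<in> closed_segment a p" "X = real h *\<^sub>R y"
      and y': "y' \<in> closed_segment a q" "X = real (h + 1) *\<^sub>R y'"
      using \<open>X \<in> gap_meet a p q h\<close> unfolding gap_meet_def by blast
    obtain u where u: "0 \<le> u" "u \<le> 1" "y = (1 - u) *\<^sub>R a + u *\<^sub>R p" using y(1) by (auto simp: in_segment)
    obtain u' where u': "0 \<le> u'" "u' \<le> 1" "y' = (1 - u') *\<^sub>R a + u' *\<^sub>R q" using y'(1) by (auto simp: in_segment)
    have Ly: "edge_form p a y = 1" using u by (simp add: edge_form_add edge_form_scale edge_vals)
    have Ly': "edge_form q a y' = 1" using u' by (simp add: edge_form_add edge_form_scale edge_vals)
    have LX: "edge_form p a X = real h"
      unfolding y(2) by (simp only: edge_form_scale Ly mult_1_right)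
    moreover have "edge_form q a X = real (h + 1)"
      unfolding y'(2) by (simp only: edge_form_scale Ly' mult_1_right)
    ultimately have w: "width X = 1" by (simp add: width_def)
    have "width X = real h * (u * width p)" using y(2) u by (simp add: width_scale width_add)
    moreover have "u * width p \<le> width p" using u width_p(2) by (simp add: mult_left_le_one_le)
    ultimately have 1: "1 \<le> real h * width p" using w by (metis mult_left_mono of_nat_0_le_iff)
    have "width X = real (h + 1) * (u' * width q)" using y'(2) u' by (simp add: width_scale width_add)
    moreover have "u' * width q \<le> width q" using u' width_q(2) by (simp add: mult_left_le_one_le)
    ultimately have 2: "1 \<le> real (h + 1) * width q" using w by (metis mult_left_mono of_nat_0_le_iff)
    show ?thesis using coordinates[of X] LX w 1 2 by (simp add: level_ok_def)
  qed
  have bwd: "real h *\<^sub>R a + apex \<in> gap_meet a p q h" if ok: "level_ok h"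
  proof -
    have h: "0 < h" using level_ok_pos ok by blast
    define u where "u = 1 / (real h * width p)"
    define u' where "u' = 1 / (real (h + 1) * width q)"
    have u: "0 \<le> u" "u \<le> 1" "real h * u * width p = 1"
      using ok h width_p(2) by (auto simp: u_def level_ok_def)
    have u': "0 \<le> u'" "u' \<le> 1" "real (h + 1) * u' * width q = 1"
      using ok width_q(2) by (auto simp: u'_def level_ok_def)
    have "real h *\<^sub>R (a + u *\<^sub>R (p - a)) = real h *\<^sub>R a + (real h * u * width p) *\<^sub>R apex"
      by (simp add: p_coords scaleR_add_right mult.assoc)
    then have 1: "real h *\<^sub>R a + apex = real h *\<^sub>R (a + u *\<^sub>R (p - a))" using u(3) by simp
    have "real (h + 1) *\<^sub>R (a + u' *\<^sub>R (q - a)) = real (h + 1) *\<^sub>R a + (real (h + 1) * u' * width q) *\<^sub>R (apex - a)"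
      by (simp add: q_coords scaleR_add_right mult.assoc)
    then have 2: "real h *\<^sub>R a + apex = real (h + 1) *\<^sub>R (a + u' *\<^sub>R (q - a))"
      unfolding u'(3) by (simp add: algebra_simps)
    have "a + u *\<^sub>R (p - a) \<in> closed_segment a p" "a + u' *\<^sub>R (q - a) \<in> closed_segment a q"
      using u u' by (auto simp: in_segment algebra_simps)
    then show ?thesis unfolding gap_meet_def using 1 2 by blast
  qed
  show ?thesis using fwd bwd by auto
qed

abbreviation "j \<equiv> gap_level a p q"

lemma gap_level_ok: "level_ok j"
proof -
  have "j = (LEAST h. 0 < h \<and> level_ok h)"
    unfolding gap_level_def gap_meet_eq by (rule arg_cong[where f = Least]) (auto simp: is_singleton_def)
  then show ?thesis using LeastI_ex[OF exists_level_ok] by simp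
qed

lemma gap_point_eq: "gap_point a p q = real j *\<^sub>R a + apex"
  using gap_level_ok by (simp add: gap_point_def gap_meet_eq)

lemma gap_line_eq: "gap_line a p q = {x. width x = 1}"
proof
  have aff: "affine {x. width x = 1}"
    unfolding affine_def by (auto simp: width_add width_scale)
  have "(\<Union>h\<in>{j..}. gap_meet a p q h) \<subseteq> {x. width x = 1}"
    by (auto simp: gap_meet_eq width_add width_scale apex_vals)
  then show "gap_line a p q \<subseteq> {x. width x = 1}"
    unfolding gap_line_def using aff by (intro hull_minimal)
  show "{x. width x = 1} \<subseteq> gap_line a p q"
  proof
    fix x assume "x \<in> {x. width x = 1}"
    then have x: "x = edge_form p a x *\<^sub>R a + apex" using coordinates[of x] by simp
    define t where "t = edge_form p a x - real j"
    have mem: "real h *\<^sub>R a + apex \<in> gap_line a p q" if "j \<le> h" for h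
      unfolding gap_line_def
    proof (rule hull_inc)
      have "level_ok h" using level_ok_mono[OF gap_level_ok that] .
      then show "real h *\<^sub>R a + apex \<in> (\<Union>h\<in>{j..}. gap_meet a p q h)"
        using that by (intro UN_I[of h]) (auto simp: gap_meet_eq)
    qed
    have "affine (gap_line a p q)" unfolding gap_line_def by simp
    then have "(1 - t) *\<^sub>R (real j *\<^sub>R a + apex) + t *\<^sub>R (real (j + 1) *\<^sub>R a + apex) \<in> gap_line a p q"
      using mem[of j] mem[of "j + 1"] by (intro mem_affine) auto
    also have "(1 - t) *\<^sub>R (real j *\<^sub>R a + apex) + t *\<^sub>R (real (j + 1) *\<^sub>R a + apex) = x"
      by (subst x) (simp add: t_def algebra_simps)
    finally show "x \<in> gap_line a p q" .
  qed
qed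

lemma shifted_level_eq: "shifted_level a p q (real m *\<^sub>R a) = int (j + m)"
  unfolding shifted_level_def
proof (rule the_equality)
  show "real_of_int (int (j + m)) *\<^sub>R a = real j *\<^sub>R a + real m *\<^sub>R a"
    by (simp add: scaleR_add_left)
  fix c assume "real_of_int c *\<^sub>R a = real j *\<^sub>R a + real m *\<^sub>R a"
  then have "(real_of_int c - real (j + m)) *\<^sub>R a = 0" by (simp add: algebra_simps)
  then have "real_of_int c = real (j + m)" using a_nonzero by simp
  then show "c = int (j + m)" by linarith
qed

lemma interior_gap_triangle:
  assumes "x \<in> interior (gap_triangle a p q)"
  shows "0 < edge_form p a x" "edge_form q a x < 1"
proof -
  let ?T = "{x. 0 \<le> edge_form p a x \<and> edge_form q a x \<le> 1}"
  have "convex ?T"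
    unfolding convex_def
    by (auto simp: edge_form_add edge_form_scale intro!: convex_bound_le)
  then have "gap_triangle a p q \<subseteq> ?T"
    unfolding gap_triangle_def by (intro hull_minimal) (auto simp: gap_point_eq edge_vals apex_vals)
  then have T: "- edge_form p a y \<le> 0" "edge_form q a y \<le> 1" if "y \<in> gap_triangle a p q" for y
    using that by auto
  have "- edge_form p a x < 0"
    by (rule interior_below_linear[OF assms, of "\<lambda>y. - edge_form p a y", of 0 "- a" 1])
      (use T edge_form_diff edge_form_scale edge_vals in \<open>auto simp: edge_form_diff edge_form_scale edge_vals\<close>)
  then show "0 < edge_form p a x" by simp
  show "edge_form q a x < 1"
    by (rule interior_below_linear[OF assms, of "edge_form q a", of 1 a 1])
      (use T in \<open>auto simp: edge_form_add edge_form_scale edge_vals\<close>)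
qed

lemma dilate_bounds:
  assumes "x \<in> F" "z = real i *\<^sub>R x"
  shows "edge_form p a z \<le> real i" "real i \<le> edge_form q a z"
  using upper[OF assms(1)] lower[OF assms(1)] assms(2)
    mult_left_mono[of "edge_form p a x" 1 "real i"] mult_left_mono[of 1 "edge_form q a x" "real i"]
  by (simp_all add: edge_form_scale)

text \<open>
  In a translated open gap triangle both edge forms lie strictly between consecutive integers; on
  the open segment they agree and are not integers.
\<close>

lemma no_gap_of_integer:
  assumes i: "edge_form p a z \<le> real_of_int i" "real_of_int i \<le> edge_form q a z"
  shows "z \<notin> (\<lambda>X. X + real h *\<^sub>R a) ` (interior (gap_triangle a p q) \<union> open_segment 0 a)"
proof
  assume "z \<in> (\<lambda>X. X + real h *\<^sub>R a) ` (interior (gap_triangle a p q) \<union> open_segment 0 a)"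
  then obtain X where X: "z = X + real h *\<^sub>R a" "X \<in> interior (gap_triangle a p q) \<union> open_segment 0 a" by blast
  have "0 < edge_form p a X \<and> edge_form q a X < 1"
    using X(2)
  proof
    assume "X \<in> open_segment 0 a"
    then obtain u where "0 < u" "u < 1" "X = u *\<^sub>R a" by (auto simp: in_segment)
    then show ?thesis by (simp add: edge_form_scale edge_vals)
  qed (simp add: interior_gap_triangle)
  then have "real h < real_of_int i" "real_of_int i < real h + 1"
    using i X(1) by (simp_all add: edge_form_add edge_form_scale edge_vals)
  then have "int h < i" "i < int h + 1" by linarith+
  then show False by linarith
qed

text \<open>
  There is an integer between the edge forms at \<open>z\<close>, namely the one for \<open>z + m a\<close> minus \<open>m\<close>. Up to level \<open>j + m\<close> of the
  outer edge form, \<open>z\<close> is in the quadrilateral of \<open>gap_region\<close>, and not in a removed triangle.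
  Beyond it, the edges are long enough for \<open>z\<close> to be in the dilated triangle \<open>a\<close>, \<open>p\<close>, \<open>q\<close>.
\<close>

lemma strip_dichotomy:
  assumes zn: "x0 \<in> F" "z + real m *\<^sub>R a = real i0 *\<^sub>R x0" and m: "0 < m"
    and w: "0 \<le> width z" "width z \<le> 1"
    and z: "z = width z *\<^sub>R R + \<mu> *\<^sub>R a" "0 \<le> \<mu>" and R: "R \<in> gap_line a p q \<inter> \<tau>'"
  shows "z \<in> gap_region a p q (real m *\<^sub>R a) \<tau>' \<or> (\<exists>i. \<exists>x\<in>F. z = real i *\<^sub>R x)"
proof -
  define i where "i = int i0 - int m"
  have i: "edge_form p a z \<le> real_of_int i" "real_of_int i \<le> edge_form q a z"
    using dilate_bounds[OF zn] by (simp_all add: i_def edge_form_add edge_form_scale edge_vals)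
  show ?thesis
  proof (cases "edge_form p a z \<le> real (j + m)")
    case True
    let ?H = "convex hull ({0, real (j + m) *\<^sub>R a, gap_point a p q + real m *\<^sub>R a} \<union> (gap_line a p q \<inter> \<tau>'))"
    have cvx: "convex ?H" by simp
    have vert: "0 \<in> ?H" "real (j + m) *\<^sub>R a \<in> ?H" "gap_point a p q + real m *\<^sub>R a \<in> ?H" "R \<in> ?H"
      using R by (auto intro!: hull_inc)
    \<comment> \<open>The points of width \<open>width z\<close> in the quadrilateral form a segment parallel to the ray, from the side joining
      0 and \<open>R\<close> to the side parallel to the outer edge.\<close>
    let ?s = "edge_form p a R" and ?k = "width z"
    have wR: "width R = 1" using R by (simp add: gap_line_eq)
    then have apex: "apex = R - ?s *\<^sub>R a" using coordinates[of R] by (simp add: algebra_simps)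
    have low: "?k *\<^sub>R R \<in> ?H"
      using convexD[OF cvx vert(1) vert(4), of "1 - ?k" ?k] w by simp
    have "(1 - ?k) *\<^sub>R (real (j + m) *\<^sub>R a) + ?k *\<^sub>R (gap_point a p q + real m *\<^sub>R a) \<in> ?H"
      using w by (intro convexD[OF cvx vert(2,3)]) auto
    also have "(1 - ?k) *\<^sub>R (real (j + m) *\<^sub>R a) + ?k *\<^sub>R (gap_point a p q + real m *\<^sub>R a) =
        ?k *\<^sub>R R + (real (j + m) - ?k * ?s) *\<^sub>R a"
      by (simp add: gap_point_eq apex algebra_simps)
    finally have high: "?k *\<^sub>R R + (real (j + m) - ?k * ?s) *\<^sub>R a \<in> ?H" .
    define L where "L = real (j + m) - ?k * ?s"
    have "edge_form p a z = ?k * ?s + \<mu>"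
      by (subst z(1)) (simp add: edge_form_add edge_form_scale edge_vals)
    then have muL: "\<mu> \<le> L" using True by (simp add: L_def)
    have "z \<in> ?H"
    proof (cases "L = 0")
      case True
      then have "\<mu> = 0" using muL z(2) by simp
      then show ?thesis using low z(1) by simp
    next
      case False
      then have L: "0 < L" using muL z(2) by simp
      have "(1 - \<mu> / L) *\<^sub>R (?k *\<^sub>R R) + (\<mu> / L) *\<^sub>R (?k *\<^sub>R R + L *\<^sub>R a) \<in> ?H"
        using L muL z(2) high unfolding L_def[symmetric]
        by (intro convexD[OF cvx low]) (auto simp: divide_le_eq)
      also have "(1 - \<mu> / L) *\<^sub>R (?k *\<^sub>R R) + (\<mu> / L) *\<^sub>R (?k *\<^sub>R R + L *\<^sub>R a) = ?k *\<^sub>R R + \<mu> *\<^sub>R a"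
        using L by (simp add: algebra_simps)
      finally show ?thesis using z(1) by simp
    qed
    moreover have "z \<notin> (\<Union>h\<in>{h. int h < int (j + m)}. (\<lambda>X. X + real h *\<^sub>R a) `
        (interior (gap_triangle a p q) \<union> open_segment 0 a))"
      using no_gap_of_integer[OF i] by blast
    ultimately show ?thesis unfolding gap_region_def shifted_level_eq by simp
  next
    case False
    then have "real (j + m) < real_of_int i" using i by linarith
    then have ij: "int j + 1 < i" using m by linarith
    define n where "n = nat i"
    have n: "real n = real_of_int i" "j + 1 < n" using ij by (auto simp: n_def)
    have np: "0 < real n" using n by simp
    have ok: "1 \<le> real n * width p" "1 \<le> real n * width q"
    proof -
      have "1 \<le> real j * width p" "1 \<le> real (j + 1) * width q" using gap_level_ok by (auto simp: level_ok_def)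
      moreover have "real j * width p \<le> real n * width p" "real (j + 1) * width q \<le> real n * width q"
        using n(2) width_p(2) width_q(2) by (auto intro!: mult_right_mono)
      ultimately show "1 \<le> real n * width p" "1 \<le> real n * width q" by linarith+
    qed
    let ?x = "edge_form q a z - real n" and ?y = "real n - edge_form p a z"
    have xy: "0 \<le> ?x" "0 \<le> ?y" "?x + ?y \<le> 1" using i n w by (auto simp: width_def)
    have "?x / width p \<le> real n * ?x" "?y / width q \<le> real n * ?y"
      using mult_right_mono[OF ok(1) xy(1)] mult_right_mono[OF ok(2) xy(2)] width_p(2) width_q(2)
      by (simp_all add: divide_le_eq mult_ac)
    moreover have "real n * ?x + real n * ?y = real n * (?x + ?y)" by (rule distrib_left[symmetric])
    moreover have "real n * (?x + ?y) \<le> real n" using xy np by (simp add: mult_left_le)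
    ultimately have "?x / width p + ?y / width q \<le> real n" by linarith
    then have "\<exists>x\<in>F. z = real n *\<^sub>R x" using xy np by (intro dilate_mem) auto
    then show ?thesis by blast
  qed
qed

text \<open>
  Inside the sector of directions that cross both edges at \<open>a\<close>, the bounds of the interval are attained.
\<close>

lemma sector_mem:
  assumes "0 < edge_form p a z" "0 \<le> width z" "width z \<le> min (width p) (width q) * edge_form p a z"
    and r: "edge_form p a z \<le> r" "r \<le> edge_form q a z"
  shows "\<exists>x\<in>F. z = r *\<^sub>R x"
proof (rule dilate_mem)
  let ?m = "min (width p) (width q)"
  let ?x = "edge_form q a z - r" and ?y = "r - edge_form p a z"
  have m: "0 < ?m" using width_p width_q by simp
  have "?x / width p \<le> ?x / ?m" "?y / width q \<le> ?y / ?m"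
    using r m width_p(2) width_q(2) by (auto intro!: divide_left_mono)
  moreover have "?x / ?m + ?y / ?m = (?x + ?y) / ?m" by (rule add_divide_distrib[symmetric])
  ultimately have "?x / width p + ?y / width q \<le> (?x + ?y) / ?m" by linarith
  also have "?x + ?y = width z" by (simp add: width_def)
  also have "width z / ?m \<le> edge_form p a z" using assms(3) m by (simp add: divide_le_eq mult.commute)
  finally show "?x / width p + ?y / width q \<le> r" using r by linarith
qed (use assms in auto)

end

text \<open>
  \<open>\<sigma>\<close> is the sense in which \<open>q\<close> follows \<open>a\<close> and \<open>a\<close> follows \<open>p\<close> on the boundary of \<open>F\<close>. The strict
  inequalities hold because otherwise the two edge forms agree, and \<open>F\<close> lies on one line.
\<close>

lemma cornerI:
  fixes \<sigma> :: real
  assumes conv: "convex F" and mem: "a \<in> F" "p \<in> F" "q \<in> F" and int: "interior F \<noteq> {}"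
    and pos: "0 < \<sigma> * cross2 p a" "0 < \<sigma> * cross2 q a"
    and low: "\<And>x. x \<in> F \<Longrightarrow> 0 \<le> \<sigma> * cross2 (q - a) (x - a)"
    and up: "\<And>x. x \<in> F \<Longrightarrow> 0 \<le> \<sigma> * cross2 (a - p) (x - p)"
  shows "corner F a p q"
proof -
  have nz: "cross2 p a \<noteq> 0" "cross2 q a \<noteq> 0" "\<sigma> \<noteq> 0" using pos by auto
  have upper: "edge_form p a x \<le> 1" if "x \<in> F" for x
  proof -
    have "\<sigma> * cross2 (p - a) x \<le> \<sigma> * cross2 p a"
      using up[OF that] by (simp add: cross2_def algebra_simps)
    moreover have "edge_form p a x = (\<sigma> * cross2 (p - a) x) / (\<sigma> * cross2 p a)"
      using nz by (simp add: edge_form_def)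
    ultimately show ?thesis using pos(1) by (simp only: divide_le_eq) simp
  qed
  have lower: "1 \<le> edge_form q a x" if "x \<in> F" for x
  proof -
    have "\<sigma> * cross2 q a \<le> \<sigma> * cross2 (q - a) x"
      using low[OF that] by (simp add: cross2_def algebra_simps)
    moreover have "edge_form q a x = (\<sigma> * cross2 (q - a) x) / (\<sigma> * cross2 q a)"
      using nz by (simp add: edge_form_def)
    ultimately show ?thesis using pos(2) by (simp only: le_divide_eq) simp
  qed
  obtain x0 where x0: "x0 \<in> interior F" using int by blast
  have "edge_form p a x0 < 1"
    by (rule interior_below_linear[OF x0, of "edge_form p a" 1 a 1])
      (use upper nz in \<open>auto simp: edge_form_add edge_form_scale edge_form_ends\<close>)
  moreover have "1 \<le> edge_form q a x0" using lower x0 interior_subset by blast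
  ultimately have neq: "edge_form p a x0 \<noteq> edge_form q a x0" by linarith
  have basis: "edge_form q a x0 = edge_form p a x0"
    if "cross2 r a \<noteq> 0" "edge_form q a r = 1" "edge_form p a r = 1" for r
  proof -
    have "cross2 r a * edge_form q a x0 = cross2 r a * edge_form p a x0"
      using arg_cong[OF cramer_plane[of r a x0], of "edge_form q a"]
        arg_cong[OF cramer_plane[of r a x0], of "edge_form p a"] that nz
      by (simp add: edge_form_add edge_form_scale edge_form_ends)
    then show ?thesis using that(1) by simp
  qed
  have "edge_form q a p \<noteq> 1" using basis[of p] nz neq by (auto simp: edge_form_ends)
  moreover have "edge_form p a q \<noteq> 1" using basis[of q] nz neq by (auto simp: edge_form_ends)
  ultimately show ?thesis
    using conv mem nz upper lower upper[OF mem(3)] lower[OF mem(2)]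
    by unfold_locales (auto simp: order_less_le)
qed

text \<open>
  \<open>sector_mem\<close> in coordinates: close to the ray of \<open>a\<close>, width 1 suffices for an interval of length 1.
\<close>

lemma (in corner) near_ray:
  assumes m: "0 < m" and w: "0 < width n'"
  shows "\<exists>\<epsilon>>0. \<forall>x y z. z = x *\<^sub>R (real m *\<^sub>R a) + y *\<^sub>R n' \<longrightarrow> y \<le> \<epsilon> * x \<longrightarrow> 0 \<le> y \<longrightarrow> 1 \<le> width z \<longrightarrow>
    0 \<le> edge_form p a z \<and> edge_form p a z + 1 \<le> edge_form q a z \<and>
    (\<forall>r. edge_form p a z \<le> r \<longrightarrow> r \<le> edge_form q a z \<longrightarrow> (\<exists>x\<in>F. z = r *\<^sub>R x))"
proof -
  define \<mu> l c where "\<mu> = min (width p) (width q)" and "l = edge_form p a n'" and "c = width n'"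
  have mu: "0 < \<mu>" using width_p width_q by (simp add: \<mu>_def)
  have c: "0 < c + \<mu> * \<bar>l\<bar>" using w mu by (simp add: c_def add_pos_nonneg)
  \<comment> \<open>Chosen such that \<open>y c \<le> \<mu> (x m + y l)\<close>, the condition of \<open>sector_mem\<close>.\<close>
  define \<epsilon> where "\<epsilon> = \<mu> * real m / (c + \<mu> * \<bar>l\<bar>)"
  have "0 < \<epsilon>" using mu m c by (simp add: \<epsilon>_def)
  moreover have "0 \<le> edge_form p a z \<and> edge_form p a z + 1 \<le> edge_form q a z \<and>
    (\<forall>r. edge_form p a z \<le> r \<longrightarrow> r \<le> edge_form q a z \<longrightarrow> (\<exists>x\<in>F. z = r *\<^sub>R x))"
    if z: "z = x *\<^sub>R (real m *\<^sub>R a) + y *\<^sub>R n'" and y: "y \<le> \<epsilon> * x" "0 \<le> y" and wz: "1 \<le> width z" for x y z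
  proof -
    have Lz: "edge_form p a z = x * real m + y * l" unfolding z l_def
      by (simp add: edge_form_add edge_form_scale edge_vals)
    have wz': "width z = y * c" unfolding z c_def by (simp add: width_add width_scale)
    have "y * (c + \<mu> * \<bar>l\<bar>) \<le> \<mu> * real m * x"
      using y(1) c by (simp add: \<epsilon>_def field_simps)
    moreover have "- (y * \<mu> * \<bar>l\<bar>) \<le> y * \<mu> * l"
      using y(2) mu mult_left_mono[of "- \<bar>l\<bar>" l "y * \<mu>"] by (simp add: abs_le_iff)
    ultimately have "y * c \<le> \<mu> * (x * real m + y * l)" by (simp add: algebra_simps)
    then have le: "width z \<le> \<mu> * edge_form p a z" using Lz wz' by simp
    have pos: "0 < edge_form p a z"
    proof (rule ccontr)
      assume "\<not> 0 < edge_form p a z"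
      then have "\<mu> * edge_form p a z \<le> 0" using mu by (simp add: mult_nonneg_nonpos)
      then show False using le wz by linarith
    qed
    have "\<exists>x\<in>F. z = r *\<^sub>R x" if "edge_form p a z \<le> r" "r \<le> edge_form q a z" for r
      using sector_mem[OF pos _ le[unfolded \<mu>_def] that] wz by simp
    then show ?thesis using pos wz by (simp add: width_def)
  qed
  ultimately show ?thesis by blast
qed

section \<open>The region without gaps\<close>

text \<open>The coefficient of \<open>v\<close> in the basis \<open>v\<close>, \<open>w\<close>.\<close>

definition coord :: "real \<times> real \<Rightarrow> real \<times> real \<Rightarrow> real \<times> real \<Rightarrow> real" where
  "coord v w x = cross2 w x / cross2 w v"

lemma coord_add: "coord v w (x + y) = coord v w x + coord v w y"
  by (simp add: coord_def cross2_add_right add_divide_distrib)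
lemma coord_diff: "coord v w (x - y) = coord v w x - coord v w y"
  by (simp add: coord_def cross2_diff_right diff_divide_distrib)
lemma coord_scale: "coord v w (c *\<^sub>R x) = c * coord v w x"
  by (simp add: coord_def cross2_scale_right)
lemma coord_zero [simp]: "coord v w 0 = 0"
  by (simp add: coord_def)

text \<open>
  The form in which coefficients of the second basis vector appear when the basis is listed in
  the same order.
\<close>

lemma coord_swap: "coord w v x = cross2 x v / cross2 w v"
  by (simp add: coord_def cross2_flip[of v])

lemma coord_combination:
  assumes "cross2 w v \<noteq> 0"
  shows "x = coord v w x *\<^sub>R v + coord w v x *\<^sub>R w"
proof -
  have "(1 / cross2 w v) *\<^sub>R (cross2 w v *\<^sub>R x) =
      (1 / cross2 w v) *\<^sub>R (cross2 w x *\<^sub>R v + cross2 x v *\<^sub>R w)"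
    by (simp only: cramer_plane[of w v x])
  then show ?thesis using assms by (simp add: coord_def[of v w] coord_swap[of w v] scaleR_add_right)
qed

text \<open>
  The hypotheses are symmetric in \<open>n1\<close> and \<open>n2\<close>, so that every statement about the first ray yields one
  about the second.
\<close>

locale polygon_cone =
  fixes F :: "(real \<times> real) set" and n1 n2 :: "real \<times> real"
  assumes conv: "convex F" and int: "interior F \<noteq> {}"
    and n1: "n1 \<in> polygonal_semigroup F" and n2: "n2 \<in> polygonal_semigroup F"
    and indep: "cross2 n2 n1 \<noteq> 0"
    and coord_F: "x \<in> F \<Longrightarrow> 0 \<le> coord n1 n2 x" "x \<in> F \<Longrightarrow> 0 \<le> coord n2 n1 x"
begin

abbreviation "P \<equiv> polygonal_semigroup F"
abbreviation "coord1 \<equiv> coord n1 n2"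
abbreviation "coord2 \<equiv> coord n2 n1"

lemma swapped: "polygon_cone F n2 n1"
  using conv int n1 n2 indep coord_F by unfold_locales (auto simp: cross2_flip[of n1 n2])

lemma coords: "x = coord1 x *\<^sub>R n1 + coord2 x *\<^sub>R n2"
  by (rule coord_combination[OF indep])

lemma coord_basis [simp]: "coord1 n1 = 1" "coord1 n2 = 0" "coord2 n1 = 0" "coord2 n2 = 1"
  using indep by (simp_all add: coord_def cross2_flip[of n1 n2])

lemma coord_eqI: "coord1 x = coord1 y \<Longrightarrow> coord2 x = coord2 y \<Longrightarrow> x = y"
  using coords[of x] coords[of y] by simp

lemma mem_P_iff: "z \<in> P \<longleftrightarrow> z \<in> nat_plane \<and> (\<exists>i::nat. \<exists>x\<in>F. z = real i *\<^sub>R x)"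
  unfolding polygonal_semigroup_def by blast

lemma coord_P:
  assumes "z \<in> P"
  shows "0 \<le> coord1 z" "0 \<le> coord2 z"
proof -
  obtain i x where "x \<in> F" "z = real i *\<^sub>R x" using assms unfolding mem_P_iff by blast
  then show "0 \<le> coord1 z" "0 \<le> coord2 z" using coord_F by (simp_all add: coord_scale)
qed

text \<open>
  An interval of dilation factors. By convexity these intervals behave additively, which makes
  their length superadditive.
\<close>

definition fits :: "real \<times> real \<Rightarrow> real \<Rightarrow> real \<Rightarrow> bool" where
  "fits z s t \<longleftrightarrow> 0 \<le> s \<and> s \<le> t \<and> (\<forall>r. s \<le> r \<longrightarrow> r \<le> t \<longrightarrow> (\<exists>x\<in>F. z = r *\<^sub>R x))"

lemma dilate_add:
  assumes "x \<in> F" "y \<in> F" "0 \<le> r" "0 \<le> s"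
  shows "\<exists>w\<in>F. r *\<^sub>R x + s *\<^sub>R y = (r + s) *\<^sub>R w"
proof (cases "r + s = 0")
  case True
  then have "r = 0" "s = 0" using assms by auto
  then show ?thesis using assms by (intro bexI[of _ x]) auto
next
  case False
  have "(r / (r + s)) *\<^sub>R x + (s / (r + s)) *\<^sub>R y \<in> F"
    using assms False by (intro convexD[OF conv]) (auto simp: add_divide_distrib[symmetric])
  moreover have "(r + s) *\<^sub>R ((r / (r + s)) *\<^sub>R x + (s / (r + s)) *\<^sub>R y) = r *\<^sub>R x + s *\<^sub>R y"
    using False by (simp add: scaleR_add_right)
  ultimately show ?thesis by metis
qed

lemma fits_add:
  assumes "fits z s t" "fits z' s' t'"
  shows "fits (z + z') (s + s') (t + t')"
  unfolding fits_def
proof (intro conjI allI impI)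
  fix r assume r: "s + s' \<le> r" "r \<le> t + t'"
  define r1 r2 where "r1 = min t (r - s')" and "r2 = r - r1"
  have "s \<le> r1" "r1 \<le> t" "s' \<le> r2" "r2 \<le> t'" using r assms by (auto simp: r1_def r2_def fits_def)
  then obtain x y where "x \<in> F" "z = r1 *\<^sub>R x" "y \<in> F" "z' = r2 *\<^sub>R y" "0 \<le> r1" "0 \<le> r2"
    using assms unfolding fits_def by (metis order_trans)
  then show "\<exists>x\<in>F. z + z' = r *\<^sub>R x" using dilate_add[of x y r1 r2] by (simp add: r2_def)
qed (use assms in \<open>auto simp: fits_def\<close>)

lemma fits_scale:
  assumes "fits z s t" "0 \<le> c"
  shows "fits (c *\<^sub>R z) (c * s) (c * t)"
  unfolding fits_def
proof (intro conjI allI impI)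
  fix r assume r: "c * s \<le> r" "r \<le> c * t"
  show "\<exists>x\<in>F. c *\<^sub>R z = r *\<^sub>R x"
  proof (cases "c = 0")
    case True
    then have "r = 0" using r by simp
    moreover obtain x where "x \<in> F" using int interior_subset by blast
    ultimately show ?thesis using True by (intro bexI[of _ x]) auto
  next
    case False
    then have "s \<le> r / c" "r / c \<le> t" using r assms(2) by (auto simp: field_simps)
    then obtain x where "x \<in> F" "z = (r / c) *\<^sub>R x" using assms(1) unfolding fits_def by blast
    then show ?thesis using False by auto
  qed
qed (use assms in \<open>auto simp: fits_def mult_left_mono\<close>)

lemma fits_point: "x \<in> F \<Longrightarrow> z = r *\<^sub>R x \<Longrightarrow> 0 \<le> r \<Longrightarrow> fits z r r"
  unfolding fits_def by force

lemma fits_generators: obtains r1 r2 where "fits n1 r1 r1" "fits n2 r2 r2"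
proof -
  obtain i x where "x \<in> F" "n1 = real i *\<^sub>R x" using n1 unfolding mem_P_iff by blast
  moreover obtain j y where "y \<in> F" "n2 = real j *\<^sub>R y" using n2 unfolding mem_P_iff by blast
  ultimately show thesis using that fits_point by (metis of_nat_0_le_iff)
qed

lemma fits_imp_P:
  assumes "fits z s t" "s + 1 \<le> t" "z \<in> nat_plane"
  shows "z \<in> P"
proof -
  have "s \<le> real (nat \<lceil>s\<rceil>)" "real (nat \<lceil>s\<rceil>) \<le> t" using assms unfolding fits_def by linarith+
  then show ?thesis using assms unfolding fits_def mem_P_iff by blast
qed

lemma fits_imp_rat_cone:
  assumes "fits z s t" "s < t"
  shows "z \<in> rat_cone F"
proof -
  obtain r where r: "r \<in> \<rat>" "s < r" "r < t" using Rats_dense_in_real[OF assms(2)] by blast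
  then obtain x where x: "x \<in> F" "z = r *\<^sub>R x" using assms(1) unfolding fits_def by (meson less_imp_le)
  have "0 \<le> r" using r assms(1) unfolding fits_def by linarith
  then show ?thesis unfolding rat_cone_def using r x
    by (intro CollectI exI[of _ "1::nat"] exI[of _ "\<lambda>_. r"] exI[of _ "\<lambda>_. x"]) auto
qed

lemma rat_cone_coords:
  assumes "z \<in> rat_cone F"
  shows "0 \<le> coord1 z" "0 \<le> coord2 z"
proof -
  obtain p :: nat and c f where z: "z = (\<Sum>i<p. c i *\<^sub>R f i)" "\<And>i. i < p \<Longrightarrow> 0 \<le> c i \<and> f i \<in> F"
    using assms unfolding rat_cone_def by blast
  have "0 \<le> coord1 (\<Sum>i<k. c i *\<^sub>R f i) \<and> 0 \<le> coord2 (\<Sum>i<k. c i *\<^sub>R f i)" if "k \<le> p" for k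
    using that
  proof (induction k)
    case 0
    then show ?case by simp
  next
    case (Suc k)
    then show ?case using z(2)[of k] coord_F by (simp add: coord_add coord_scale)
  qed
  then show "0 \<le> coord1 z" "0 \<le> coord2 z" using z(1) by auto
qed

lemma exists_interior_fit:
  "\<exists>y s t. fits y s t \<and> s < t \<and> 0 < coord1 y \<and> 0 < coord2 y"
proof -
  obtain y where y: "y \<in> interior F" using int by blast
  have "- coord1 y < 0"
    by (rule interior_below_linear[OF y, of "\<lambda>x. - coord1 x" 0 "- n1" 1])
      (use coord_F in \<open>auto simp: coord_diff coord_scale\<close>)
  moreover have "- coord2 y < 0"
    by (rule interior_below_linear[OF y, of "\<lambda>x. - coord2 x" 0 "- n2" 1])
      (use coord_F in \<open>auto simp: coord_diff coord_scale\<close>)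
  moreover obtain e where e: "0 < e" "cball y e \<subseteq> F" using y mem_interior_cball by blast
  \<comment> \<open>For \<open>1 \<le> r \<le> 1 + d\<close> the point \<open>y / r\<close> is at distance at most \<open>e\<close> from \<open>y\<close>.\<close>
  define d where "d = e / (norm y + e)"
  have ne: "0 < norm y + e" using e by (simp add: add_nonneg_pos)
  have d: "0 < d" "d \<le> 1" using e ne by (auto simp: d_def)
  have "fits y 1 (1 + d)"
    unfolding fits_def
  proof (intro conjI allI impI)
    fix r assume r: "1 \<le> r" "r \<le> 1 + d"
    have "norm (y - (1 / r) *\<^sub>R y) = (1 - 1 / r) * norm y"
    proof -
      have "y - (1 / r) *\<^sub>R y = (1 - 1 / r) *\<^sub>R y" by (simp add: algebra_simps)
      then show ?thesis using r by simp
    qed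
    also have "1 - 1 / r \<le> d" using r d by (simp add: field_simps) (smt (verit) mult_left_mono mult_le_cancel_left1)
    then have "(1 - 1 / r) * norm y \<le> d * norm y" by (rule mult_right_mono) simp
    also have "d * norm y \<le> e" using e ne by (simp add: d_def field_simps)
    finally have "(1 / r) *\<^sub>R y \<in> F" using e(2) by (auto simp: mem_cball dist_norm)
    then show "\<exists>x\<in>F. y = r *\<^sub>R x" using r by (intro bexI[of _ "(1 / r) *\<^sub>R y"]) auto
  qed (use d in auto)
  ultimately show ?thesis using d(1) by (intro exI[of _ y] exI[of _ 1] exI[of _ "1 + d"]) auto
qed

text \<open>
  Some interior point \<open>y\<close> of \<open>F\<close> has an interval of positive length, and a multiple of \<open>y\<close> splits off from
  any \<open>z\<close> inside the cone.
\<close>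

lemma fits_inside:
  "\<exists>\<delta>>0. \<forall>z. 0 \<le> coord1 z \<longrightarrow> 0 \<le> coord2 z \<longrightarrow>
    (\<exists>s t. fits z s t \<and> \<delta> * min (coord1 z) (coord2 z) \<le> t - s)"
proof -
  obtain y s t where y: "fits y s t" "s < t" "0 < coord1 y" "0 < coord2 y" using exists_interior_fit by blast
  obtain r1 r2 where r: "fits n1 r1 r1" "fits n2 r2 r2" using fits_generators by blast
  define K where "K = max (coord1 y) (coord2 y)"
  define \<delta> where "\<delta> = (t - s) / K"
  have K: "0 < K" using y by (simp add: K_def)
  have "\<exists>s t. fits z s t \<and> \<delta> * min (coord1 z) (coord2 z) \<le> t - s"
    if z: "0 \<le> coord1 z" "0 \<le> coord2 z" for z
  proof -
    define g where "g = min (coord1 z) (coord2 z) / K"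
    have g0: "0 \<le> g" using z K by (simp add: g_def)
    have gK: "g * K = min (coord1 z) (coord2 z)" using K by (simp add: g_def)
    have "g * coord1 y \<le> g * K" "g * coord2 y \<le> g * K"
      using g0 by (auto simp: K_def intro!: mult_left_mono)
    then have nn: "0 \<le> coord1 z - g * coord1 y" "0 \<le> coord2 z - g * coord2 y" using gK by auto
    have "fits ((coord1 z - g * coord1 y) *\<^sub>R n1 + (coord2 z - g * coord2 y) *\<^sub>R n2 + g *\<^sub>R y)
      ((coord1 z - g * coord1 y) * r1 + (coord2 z - g * coord2 y) * r2 + g * s)
      ((coord1 z - g * coord1 y) * r1 + (coord2 z - g * coord2 y) * r2 + g * t)"
      by (intro fits_add fits_scale r y nn g0)
    moreover have "(coord1 z - g * coord1 y) *\<^sub>R n1 + (coord2 z - g * coord2 y) *\<^sub>R n2 + g *\<^sub>R y = z"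
      by (rule coord_eqI) (simp_all add: coord_add coord_scale)
    moreover have "\<delta> * min (coord1 z) (coord2 z) = g * t - g * s"
      using K by (simp add: \<delta>_def g_def algebra_simps diff_divide_distrib)
    ultimately show ?thesis by fastforce
  qed
  moreover have "0 < \<delta>" using y K by (simp add: \<delta>_def)
  ultimately show ?thesis by blast
qed

lemma fits_segment:
  assumes seg: "nondegenerate_segment (F \<inter> {t *\<^sub>R n | t. 0 \<le> t})" and n: "n \<noteq> 0"
  shows "\<exists>s t. fits n s t \<and> s < t"
proof -
  obtain x y where xy: "x \<noteq> y" "F \<inter> {t *\<^sub>R n | t. 0 \<le> t} = closed_segment x y"
    using seg unfolding nondegenerate_segment_def by blast
  have "x \<in> F \<inter> {t *\<^sub>R n | t. 0 \<le> t}" "y \<in> F \<inter> {t *\<^sub>R n | t. 0 \<le> t}" using xy(2) by auto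
  then obtain u v where u: "0 \<le> u" "x = u *\<^sub>R n" "x \<in> F" and v: "0 \<le> v" "y = v *\<^sub>R n" "y \<in> F" by blast
  define l h where "l = min u v" and "h = max u v"
  have lh: "l < h" "0 \<le> l" "l *\<^sub>R n \<in> F" "h *\<^sub>R n \<in> F"
    using u v xy(1) by (auto simp: l_def h_def min_def max_def)
  \<comment> \<open>The lower end \<open>l\<close> may be 0, so the segment is shortened before taking reciprocals.\<close>
  define l' where "l' = (l + h) / 2"
  have l': "0 < l'" "l < l'" "l' < h" using lh by (auto simp: l'_def)
  have mem: "c *\<^sub>R n \<in> F" if "l \<le> c" "c \<le> h" for c
  proof -
    have "((h - c) / (h - l)) *\<^sub>R (l *\<^sub>R n) + ((c - l) / (h - l)) *\<^sub>R (h *\<^sub>R n) \<in> F"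
      using lh that by (intro convexD[OF conv]) (auto simp: add_divide_distrib[symmetric])
    moreover have "(h - c) / (h - l) * l + (c - l) / (h - l) * h = ((h - c) * l + (c - l) * h) / (h - l)"
      by (simp add: add_divide_distrib)
    moreover have "(h - c) * l + (c - l) * h = c * (h - l)" by (simp add: algebra_simps)
    moreover have "h - l \<noteq> 0" using lh by simp
    ultimately show ?thesis by (simp add: scaleR_add_left[symmetric])
  qed
  have "fits n (1 / h) (1 / l')"
    unfolding fits_def
  proof (intro conjI allI impI)
    fix r assume r: "1 / h \<le> r" "r \<le> 1 / l'"
    have h: "0 < h" using lh by linarith
    have r0: "0 < r" using r h by (meson less_le_trans zero_less_divide_1_iff)
    have "1 / r \<le> h" "l' \<le> 1 / r" using r h r0 l' by (auto simp: field_simps)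
    then have "(1 / r) *\<^sub>R n \<in> F" using l' by (intro mem) auto
    then show "\<exists>x\<in>F. n = r *\<^sub>R x" using r0 by (intro bexI[of _ "(1 / r) *\<^sub>R n"]) auto
  qed (use lh l' in \<open>auto simp: field_simps\<close>)
  moreover have "1 / h < 1 / l'" using lh l' by (auto simp: field_simps)
  ultimately show ?thesis by blast
qed

text \<open>
  Far out in some sector along the ray of \<open>v\<close>, the points satisfying \<open>G\<close> have an interval of length 1,
  so they are in no gap.
\<close>

definition clear_near :: "real \<times> real \<Rightarrow> real \<times> real \<Rightarrow> (real \<times> real \<Rightarrow> bool) \<Rightarrow> bool" where
  "clear_near v w G \<longleftrightarrow> (\<exists>\<epsilon>>0. \<exists>N. \<forall>z. 0 \<le> coord w v z \<longrightarrow> coord w v z \<le> \<epsilon> * coord v w z \<longrightarrow> N \<le> coord v w z \<longrightarrow> G z \<longrightarrow>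
     (\<exists>s t. fits z s t \<and> s + 1 \<le> t))"

lemma clear_near_segment:
  assumes "fits n1 s t" "s < t"
  shows "clear_near n1 n2 (\<lambda>_. True)"
  unfolding clear_near_def
proof (rule exI[of _ 1], rule conjI, simp, rule exI[of _ "1 / (t - s)"], intro allI impI)
  fix z assume z: "0 \<le> coord2 z" "coord2 z \<le> 1 * coord1 z" "1 / (t - s) \<le> coord1 z"
  obtain r1 r2 where r: "fits n1 r1 r1" "fits n2 r2 r2" using fits_generators by blast
  have "fits (coord1 z *\<^sub>R n1 + coord2 z *\<^sub>R n2) (coord1 z * s + coord2 z * r2) (coord1 z * t + coord2 z * r2)"
    using z by (intro fits_add fits_scale r assms) auto
  moreover have "1 \<le> coord1 z * (t - s)" using z(3) assms(2) by (simp add: divide_le_eq)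
  ultimately show "\<exists>s t. fits z s t \<and> s + 1 \<le> t"
    using coords[of z] by (intro exI[of _ "coord1 z * s + coord2 z * r2"] exI[of _ "coord1 z * t + coord2 z * r2"]) (simp add: algebra_simps)
qed

lemma clear_near_corner:
  assumes "corner F a p q" "n1 = real m *\<^sub>R a" "0 < m" "0 < corner.width a p q n2"
  shows "clear_near n1 n2 (\<lambda>z. 1 \<le> corner.width a p q z)"
proof -
  interpret corner F a p q by fact
  obtain \<epsilon> where "0 < \<epsilon>" and e: "\<forall>x y z. z = x *\<^sub>R (real m *\<^sub>R a) + y *\<^sub>R n2 \<longrightarrow> y \<le> \<epsilon> * x \<longrightarrow> 0 \<le> y \<longrightarrow> 1 \<le> width z \<longrightarrow>
    0 \<le> edge_form p a z \<and> edge_form p a z + 1 \<le> edge_form q a z \<and>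
    (\<forall>r. edge_form p a z \<le> r \<longrightarrow> r \<le> edge_form q a z \<longrightarrow> (\<exists>x\<in>F. z = r *\<^sub>R x))"
    using near_ray[OF assms(3,4)] by blast
  show ?thesis
    unfolding clear_near_def
  proof (rule exI[of _ \<epsilon>], rule conjI, fact, rule exI[of _ 0], intro allI impI)
    fix z assume "0 \<le> coord2 z" "coord2 z \<le> \<epsilon> * coord1 z" "1 \<le> width z"
    then have "0 \<le> edge_form p a z \<and> edge_form p a z + 1 \<le> edge_form q a z \<and>
      (\<forall>r. edge_form p a z \<le> r \<longrightarrow> r \<le> edge_form q a z \<longrightarrow> (\<exists>x\<in>F. z = r *\<^sub>R x))"
      using e coords[of z] unfolding assms(2) by blast
    then show "\<exists>s t. fits z s t \<and> s + 1 \<le> t"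
      unfolding fits_def by (intro exI[of _ "edge_form p a z"] exI[of _ "edge_form q a z"]) auto
  qed
qed

text \<open>
  Outside the sectors along the two rays both coordinates are large, and \<open>fits_inside\<close> applies.
\<close>

lemma clear_imp_cofinite:
  assumes "clear_near n1 n2 G1" "clear_near n2 n1 G2"
  shows "\<exists>N. \<forall>z\<in>nat_plane. 0 \<le> coord1 z \<longrightarrow> 0 \<le> coord2 z \<longrightarrow> G1 z \<longrightarrow> G2 z \<longrightarrow> N \<le> coord1 z + coord2 z \<longrightarrow> z \<in> P"
proof -
  obtain e1 N1 where e1: "0 < e1" and c1: "\<And>z. 0 \<le> coord2 z \<Longrightarrow> coord2 z \<le> e1 * coord1 z \<Longrightarrow> N1 \<le> coord1 z \<Longrightarrow> G1 z \<Longrightarrow>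
     \<exists>s t. fits z s t \<and> s + 1 \<le> t" using assms(1) unfolding clear_near_def by blast
  obtain e2 N2 where e2: "0 < e2" and c2: "\<And>z. 0 \<le> coord1 z \<Longrightarrow> coord1 z \<le> e2 * coord2 z \<Longrightarrow> N2 \<le> coord2 z \<Longrightarrow> G2 z \<Longrightarrow>
     \<exists>s t. fits z s t \<and> s + 1 \<le> t" using assms(2) unfolding clear_near_def by blast
  obtain d where d: "0 < d" and fd: "\<And>z. 0 \<le> coord1 z \<Longrightarrow> 0 \<le> coord2 z \<Longrightarrow>
    \<exists>s t. fits z s t \<and> d * min (coord1 z) (coord2 z) \<le> t - s" using fits_inside by blast
  define K1 K2 where "K1 = max (max N1 0) (1 / d)" and "K2 = max (max N2 0) (1 / d)"
  \<comment> \<open>If \<open>x + y \<ge> N\<close>, then \<open>y \<le> e1 x\<close> gives \<open>x \<ge> K1\<close>, \<open>x \<le> e2 y\<close> gives \<open>y \<ge> K2\<close>, and in the middle sector both hold.\<close>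
  define N where "N = (1 + e1) * K1 + (1 + e2) * K2 + (1 + 1 / e1) * K2 + (1 + 1 / e2) * K1"
  have K: "0 \<le> K1" "0 \<le> K2" "N1 \<le> K1" "N2 \<le> K2" "1 / d \<le> K1" "1 / d \<le> K2" by (auto simp: K1_def K2_def)
  have pos: "0 \<le> (1 + e1) * K1" "0 \<le> (1 + e2) * K2" "0 \<le> (1 + 1 / e1) * K2" "0 \<le> (1 + 1 / e2) * K1"
    using e1 e2 K by auto
  have "z \<in> P" if z: "z \<in> nat_plane" "0 \<le> coord1 z" "0 \<le> coord2 z" "G1 z" "G2 z" "N \<le> coord1 z + coord2 z" for z
  proof -
    let ?x = "coord1 z" and ?y = "coord2 z"
    consider "?y \<le> e1 * ?x" "N1 \<le> ?x" | "?x \<le> e2 * ?y" "N2 \<le> ?y" | "K1 \<le> ?x" "K2 \<le> ?y"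
    proof -
      consider "?y \<le> e1 * ?x" | "?x \<le> e2 * ?y" | "e1 * ?x < ?y" "e2 * ?y < ?x" by linarith
      then show thesis
      proof cases
        case 1
        then have "(1 + e1) * K1 \<le> (1 + e1) * ?x" using z(6) pos N_def by (simp add: algebra_simps)
        then have "K1 \<le> ?x" using e1 by simp
        then show ?thesis using that(1) 1 K by linarith
      next
        case 2
        then have "(1 + e2) * K2 \<le> (1 + e2) * ?y" using z(6) pos N_def by (simp add: algebra_simps)
        then have "K2 \<le> ?y" using e2 by simp
        then show ?thesis using that(2) 2 K by linarith
      next
        case 3
        have "?x \<le> (1 / e1) * ?y" "?y \<le> (1 / e2) * ?x" using 3 e1 e2 by (auto simp: field_simps)
        then have "(1 + 1 / e1) * K2 \<le> (1 + 1 / e1) * ?y" "(1 + 1 / e2) * K1 \<le> (1 + 1 / e2) * ?x"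
          using z(6) pos unfolding N_def by (simp_all only: distrib_right mult_1_left)
        moreover have "0 < 1 + 1 / e1" "0 < 1 + 1 / e2" using e1 e2 by (auto intro: add_pos_pos)
        ultimately have "K2 \<le> ?y" "K1 \<le> ?x" by (simp_all only: mult_le_cancel_left_pos)
        then show ?thesis using that(3) by blast
      qed
    qed
    then show ?thesis
    proof cases
      case 1
      then show ?thesis using c1 z fits_imp_P by blast
    next
      case 2
      then show ?thesis using c2 z fits_imp_P by blast
    next
      case 3
      obtain s t where st: "fits z s t" "d * min ?x ?y \<le> t - s" using fd z by blast
      have "1 / d \<le> min ?x ?y" using 3 K by auto
      then have "1 \<le> d * min ?x ?y" unfolding pos_divide_le_eq[OF d] by (simp only: mult.commute)
      then show ?thesis using fits_imp_P[OF st(1)] st(2) z(1) by simp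
    qed
  qed
  then show ?thesis by blast
qed

end

section \<open>From the polygon to its cone\<close>

lemma planar_polytope_interior:
  fixes F :: "(real \<times> real) set"
  assumes "polytope F" "F \<noteq> {}" "\<nexists>a b. F = closed_segment a b"
  shows "interior F \<noteq> {}"
proof
  assume empty: "interior F = {}"
  have conv: "convex F" and comp: "compact F"
    using polytope_imp_convex[OF assms(1)] polytope_imp_compact[OF assms(1)] by blast+
  have "affine hull F \<noteq> UNIV"
    using rel_interior_interior[of F] rel_interior_eq_empty[OF conv] empty assms(2) by auto
  then have "aff_dim F \<noteq> 2" using aff_dim_eq_full[of F] by simp
  moreover have "aff_dim F \<le> 2" using aff_dim_le_DIM[of F] by simp
  ultimately have "collinear F" by (simp add: collinear_aff_dim)
  then show False using compact_convex_collinear_segment[OF assms(2) comp conv] assms(3) by blast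
qed

lemma open_contains_rational:
  fixes A :: "real set"
  assumes "open A" "x \<in> A"
  shows "\<exists>q\<in>\<rat>. q \<in> A"
proof -
  obtain e where e: "0 < e" "ball x e \<subseteq> A" using assms open_contains_ball by blast
  obtain q where "q \<in> \<rat>" "x < q" "q < x + e" using Rats_dense_in_real[of x "x + e"] e by auto
  then show ?thesis using e by (intro bexI[of _ q]) (auto simp: dist_real_def subset_iff)
qed

text \<open>Rational points are dense.\<close>

lemma open_contains_dilated_lattice_point:
  fixes A :: "(real \<times> real) set"
  assumes "open A" "A \<noteq> {}" "A \<subseteq> nonneg_plane"
  shows "\<exists>y\<in>A. \<exists>N::nat. 0 < N \<and> real N *\<^sub>R y \<in> nat_plane"
proof -
  obtain x1 x2 where "(x1, x2) \<in> A" using assms(2) by auto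
  then obtain A1 A2 where A: "open A1" "open A2" "x1 \<in> A1" "x2 \<in> A2" "A1 \<times> A2 \<subseteq> A"
    using assms(1) by (metis open_prod_elim mem_Sigma_iff)
  obtain q1 q2 where q: "q1 \<in> \<rat>" "q1 \<in> A1" "q2 \<in> \<rat>" "q2 \<in> A2"
    using open_contains_rational A by metis
  then have mem: "(q1, q2) \<in> A" using A by blast
  then have nn: "0 \<le> q1" "0 \<le> q2" using assms(3) by auto
  obtain m1 d1 :: nat where 1: "d1 \<noteq> 0" "\<bar>q1\<bar> = real m1 / real d1" using Rats_abs_nat_div_natE q(1) by metis
  obtain m2 d2 :: nat where 2: "d2 \<noteq> 0" "\<bar>q2\<bar> = real m2 / real d2" using Rats_abs_nat_div_natE q(3) by metis
  have "real (d1 * d2) * q1 = real (m1 * d2)" using 1 nn by (simp add: field_simps)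
  moreover have "real (d1 * d2) * q2 = real (m2 * d1)" using 2 nn by (simp add: field_simps)
  ultimately have "real (d1 * d2) *\<^sub>R (q1, q2) \<in> nat_plane"
    by (simp only: scaleR_Pair real_scaleR_def mem_Sigma_iff of_nat_in_Nats simp_thms)
  then show ?thesis using mem 1(1) 2(1) by (intro bexI[of _ "(q1, q2)"] exI[of _ "d1 * d2"]) auto
qed

text \<open>
  \<open>F\<close> may have irrational vertices, so it is not itself generated by \<open>P\<close>; but the directions of lattice
  points are dense in it.
\<close>

lemma nonneg_on_polygon:
  fixes g :: "real \<times> real \<Rightarrow> real"
  assumes F: "convex F" "interior F \<noteq> {}" "F \<subseteq> nonneg_plane"
    and g: "continuous_on UNIV g" "\<And>c y. g (c *\<^sub>R y) = c * g y"
    and P: "\<And>z. z \<in> polygonal_semigroup F \<Longrightarrow> 0 \<le> g z" and x: "x \<in> F"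
  shows "0 \<le> g x"
proof (rule ccontr)
  assume "\<not> 0 \<le> g x"
  define U where "U = {y. g y < 0}"
  have U: "open U" unfolding U_def using g(1) by (intro open_Collect_less continuous_on_const) auto
  have "x \<in> closure (interior F)" using x convex_closure_interior[OF F(1,2)] closure_subset by blast
  moreover have "x \<in> U" using \<open>\<not> 0 \<le> g x\<close> by (simp add: U_def)
  ultimately have ne: "U \<inter> interior F \<noteq> {}" using open_Int_closure_eq_empty[OF U, of "interior F"] by blast
  have "open (U \<inter> interior F)" using U by (intro open_Int) auto
  moreover have "U \<inter> interior F \<subseteq> nonneg_plane" using F(3) interior_subset by blast
  ultimately obtain y N where y: "y \<in> U \<inter> interior F" and N: "0 < N" "real N *\<^sub>R y \<in> nat_plane"
    using open_contains_dilated_lattice_point ne by meson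
  have "y \<in> F" using y interior_subset by blast
  then have "real N *\<^sub>R y \<in> polygonal_semigroup F" using N unfolding polygonal_semigroup_def by blast
  then have "0 \<le> real N * g y" using P g(2) by metis
  then show False using y N(1) by (simp add: U_def zero_le_mult_iff)
qed

text \<open>
  If a point \<open>x\<close> of the cone were on the other side of the ray than \<open>n'\<close>, some sum \<open>x + b n'\<close> would lie on the
  line of the ray. As the ray is a face, it would contain \<open>n'\<close>.
\<close>

lemma ray_face_supports:
  fixes \<sigma> :: real
  assumes C: "C \<subseteq> nonneg_plane" and face: "{t *\<^sub>R n | t. 0 \<le> t} face_of (convex_cone hull C)"
    and n': "n' \<in> convex_cone hull C" and pos: "0 < \<sigma> * cross2 n' n" and x: "x \<in> convex_cone hull C"
  shows "0 \<le> \<sigma> * cross2 x n"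
proof (rule ccontr)
  assume neg: "\<not> 0 \<le> \<sigma> * cross2 x n"
  let ?K = "convex_cone hull C"
  have nz: "cross2 n' n \<noteq> 0" "\<sigma> \<noteq> 0" using pos by auto
  have "nonneg_plane = {x :: real \<times> real. 0 \<le> fst x \<and> 0 \<le> snd x}" by auto
  moreover have "convex_cone {x :: real \<times> real. 0 \<le> fst x \<and> 0 \<le> snd x}" by (auto simp: convex_cone_iff)
  ultimately have K: "?K \<subseteq> nonneg_plane" using C by (intro hull_minimal) auto
  define b where "b = - (cross2 x n / cross2 n' n)"
  define a where "a = cross2 n' x / cross2 n' n"
  have b: "0 < b"
  proof -
    have "cross2 x n / cross2 n' n < 0" using neg pos
      by (auto simp: not_le mult_less_0_iff zero_less_mult_iff divide_less_0_iff)
    then show ?thesis by (simp add: b_def)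
  qed
  have "(1 / cross2 n' n) *\<^sub>R (cross2 n' n *\<^sub>R x) = (1 / cross2 n' n) *\<^sub>R (cross2 n' x *\<^sub>R n + cross2 x n *\<^sub>R n')"
    by (simp only: cramer_plane[of n' n x])
  then have "x = (cross2 n' x / cross2 n' n) *\<^sub>R n + (cross2 x n / cross2 n' n) *\<^sub>R n'"
    using nz by (simp add: scaleR_add_right)
  then have "x = a *\<^sub>R n + (- b) *\<^sub>R n'" unfolding a_def b_def minus_minus .
  then have "x + b *\<^sub>R n' = (a *\<^sub>R n + (- b) *\<^sub>R n') + b *\<^sub>R n'"
    by (rule arg_cong[of _ _ "\<lambda>v. v + b *\<^sub>R n'"])
  then have xn: "x + b *\<^sub>R n' = a *\<^sub>R n" by simp
  have n: "n \<in> ?K" using face_of_imp_subset[OF face] by (force intro: exI[of _ 1])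
  show False
  proof (cases "0 \<le> a")
    case True
    have neq: "2 *\<^sub>R x \<noteq> (2 * b) *\<^sub>R n'"
    proof
      assume "2 *\<^sub>R x = (2 * b) *\<^sub>R n'"
      then have "2 * cross2 x n = 2 * b * cross2 n' n" by (metis cross2_scale_left)
      then have "\<sigma> * cross2 x n = b * (\<sigma> * cross2 n' n)" by simp
      moreover have "0 < b * (\<sigma> * cross2 n' n)" using b pos by (rule mult_pos_pos)
      ultimately show False using neg by linarith
    qed
    have "x + b *\<^sub>R n' = (1 - 1 / 2) *\<^sub>R (2 *\<^sub>R x) + (1 / 2) *\<^sub>R ((2 * b) *\<^sub>R n')" by simp
    then have "x + b *\<^sub>R n' \<in> open_segment (2 *\<^sub>R x) ((2 * b) *\<^sub>R n')"
      unfolding in_segment using neq by (intro conjI exI[of _ "1 / 2"]) auto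
    moreover have "2 *\<^sub>R x \<in> ?K" "(2 * b) *\<^sub>R n' \<in> ?K" using x n' b by (auto intro!: convex_cone_hull_mul)
    moreover have "x + b *\<^sub>R n' \<in> {t *\<^sub>R n | t. 0 \<le> t}" using xn True by auto
    ultimately have "(2 * b) *\<^sub>R n' \<in> {t *\<^sub>R n | t. 0 \<le> t}" using face_ofD[OF face] by blast
    then obtain t where "(2 * b) *\<^sub>R n' = t *\<^sub>R n" by blast
    then have "2 * b * cross2 n' n = t * cross2 n n" by (metis cross2_scale_left)
    then show False using b nz by simp
  next
    case False
    define y where "y = x + b *\<^sub>R n'"
    have "y \<in> nonneg_plane" unfolding y_def
      using K convex_cone_hull_add[OF x convex_cone_hull_mul[OF n', of b]] b by auto
    moreover have "n \<in> nonneg_plane" using n K by blast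
    moreover have "y = a *\<^sub>R n" using xn by (simp add: y_def)
    ultimately have "0 \<le> a * fst n" "0 \<le> a * snd n" "0 \<le> fst n" "0 \<le> snd n" by auto
    then have "fst n = 0" "snd n = 0" using False by (auto simp: zero_le_mult_iff)
    then show False using nz by (simp add: cross2_def)
  qed
qed

lemma extremal_ray_eq:
  assumes "extremal_ray C \<tau>" "n \<in> \<tau>" "n \<noteq> 0"
  shows "\<tau> = {t *\<^sub>R n | t. 0 \<le> t}"
proof -
  obtain v where v: "\<tau> = {t *\<^sub>R v | t. 0 \<le> t}" using assms(1) unfolding extremal_ray_def by blast
  obtain s where s: "0 \<le> s" "n = s *\<^sub>R v" using assms(2) v by blast
  then have s0: "0 < s" using assms(3) by (cases "s = 0") auto
  show ?thesis
  proof (rule equalityI; rule subsetI)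
    fix x assume "x \<in> \<tau>"
    then obtain t where "0 \<le> t" "x = t *\<^sub>R v" using v by blast
    then have "x = (t / s) *\<^sub>R n" "0 \<le> t / s" using s s0 by auto
    then show "x \<in> {t *\<^sub>R n | t. 0 \<le> t}" by blast
  next
    fix x assume "x \<in> {t *\<^sub>R n | t. 0 \<le> t}"
    then obtain t where "0 \<le> t" "x = t *\<^sub>R n" by blast
    then have "x = (t * s) *\<^sub>R v" "0 \<le> t * s" using s by auto
    then show "x \<in> \<tau>" using v by blast
  qed
qed

lemma ccw_vertices_length:
  assumes F: "compact F" "convex F" "interior F \<noteq> {}" and A: "ccw_vertices F A"
  shows "2 \<le> length A"
proof (rule ccontr)
  assume "\<not> 2 \<le> length A"
  then have "length A = 0 \<or> length A = 1" by linarith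
  then obtain v where sub: "set A \<subseteq> {v}" by (auto simp: length_Suc_conv)
  have "F = convex hull (set A)" using Krein_Milman_Minkowski[OF F(1,2)] A by (simp add: ccw_vertices_def)
  also have "\<dots> \<subseteq> convex hull {v}" by (rule hull_mono[OF sub])
  also have "\<dots> = {v}" by simp
  finally have "interior F \<subseteq> interior {v}" by (rule interior_mono)
  then show False using F(3) by simp
qed

lemma ccw_vertices_edges:
  assumes A: "ccw_vertices F A" and len: "2 \<le> length A"
  shows "A ! 0 \<in> F" "A ! 1 \<in> F" "last A \<in> F" "A ! 1 \<noteq> A ! 0" "last A \<noteq> A ! 0"
    and "x \<in> F \<Longrightarrow> 0 \<le> cross2 (A ! 1 - A ! 0) (x - A ! 0)"
    and "x \<in> F \<Longrightarrow> 0 \<le> cross2 (A ! 0 - last A) (x - last A)"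
proof -
  let ?n = "length A"
  have dist: "distinct A" and set: "set A = {x. x extreme_point_of F}"
    and edge: "\<And>i x. i < ?n \<Longrightarrow> x \<in> F \<Longrightarrow> 0 \<le> cross2 (A ! ((i + 1) mod ?n) - A ! i) (x - A ! i)"
    using A unfolding ccw_vertices_def by blast+
  have last: "last A = A ! (?n - 1)" using len by (intro last_conv_nth) auto
  have idx: "0 < ?n" "1 < ?n" "?n - 1 < ?n" "?n - 1 \<noteq> 0" using len by auto
  have "set A \<subseteq> F" using set by (auto simp: extreme_point_of_def)
  then show "A ! 0 \<in> F" "A ! 1 \<in> F" "last A \<in> F" unfolding last using idx(1-3) nth_mem by blast+
  show "A ! 1 \<noteq> A ! 0" "last A \<noteq> A ! 0" unfolding last
    using nth_eq_iff_index_eq[OF dist idx(2,1)] nth_eq_iff_index_eq[OF dist idx(3,1)] idx(4) by auto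
  show "0 \<le> cross2 (A ! 1 - A ! 0) (x - A ! 0)" if "x \<in> F"
    using edge[OF idx(1) that] idx(2) by simp
  have "(?n - 1 + 1) mod ?n = 0" using idx(1) by simp
  then show "0 \<le> cross2 (A ! 0 - last A) (x - last A)" if "x \<in> F"
    unfolding last using edge[OF idx(3) that] by simp
qed

context polygon_cone begin

section \<open>The semigroup of the polygon\<close>

lemma P_lattice: "P \<subseteq> nat_plane" by (auto simp: polygonal_semigroup_def)

lemma P_zero: "0 \<in> P"
proof -
  obtain x where x: "x \<in> F" using int interior_subset by blast
  have "0 = real 0 *\<^sub>R x" by simp
  moreover have "(0 :: real \<times> real) \<in> nat_plane" by (simp add: zero_prod_def)
  ultimately show ?thesis using x unfolding mem_P_iff by blast
qed

lemma P_add: "x \<in> P \<Longrightarrow> y \<in> P \<Longrightarrow> x + y \<in> P"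
proof -
  assume "x \<in> P" "y \<in> P"
  then obtain i j u v where *: "x \<in> nat_plane" "u \<in> F" "x = real i *\<^sub>R u" "y \<in> nat_plane" "v \<in> F" "y = real j *\<^sub>R v"
    unfolding mem_P_iff by blast
  obtain w where "w \<in> F" "x + y = (real i + real j) *\<^sub>R w" using dilate_add[of u v "real i" "real j"] * by auto
  then have "\<exists>k::nat. \<exists>w\<in>F. x + y = real k *\<^sub>R w" by (intro exI[of _ "i + j"]) auto
  moreover have "x + y \<in> nat_plane" using *(1,4) by (auto simp: mem_Times_iff)
  ultimately show ?thesis unfolding mem_P_iff by blast
qed

lemma P_scale: "x \<in> P \<Longrightarrow> real k *\<^sub>R x \<in> P"
  by (induction k) (auto simp: P_zero P_add scaleR_left_distrib)

lemma P_sum: "(\<And>i. i \<in> I \<Longrightarrow> f i \<in> P) \<Longrightarrow> sum f I \<in> P"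
  by (induction I rule: infinite_finite_induct) (auto simp: P_zero P_add)

lemma cross2_nat:
  assumes "0 < cross2 n2 n1" "x \<in> P"
  obtains a b :: nat where "cross2 n2 x = real a" "cross2 x n1 = real b"
proof -
  have "0 \<le> cross2 n2 x" "0 \<le> cross2 x n1"
    using coord_P[OF assms(2)] assms(1) by (simp_all add: coord_def[of n1] coord_swap[of n2] zero_le_divide_iff)
  moreover have "x \<in> nat_plane" "n1 \<in> nat_plane" "n2 \<in> nat_plane" using assms n1 n2 P_lattice by blast+
  ultimately show thesis using cross2_nat_of_nonneg that by metis
qed

lemma P_completion:
  assumes pos: "0 < cross2 n2 n1" and p: "p \<in> P"
  shows "\<exists>p'\<in>P. \<exists>i j::nat. p + p' = real i *\<^sub>R n1 + real j *\<^sub>R n2"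
proof -
  obtain a b :: nat where ab: "cross2 n2 p = real a" "cross2 p n1 = real b" using cross2_nat[OF pos p] .
  obtain d d' :: nat where d: "cross2 n2 n1 = real d" "cross2 n1 n1 = real d'" using cross2_nat[OF pos n1] .
  have "0 < d" using pos d by simp
  then have "p + real (d - 1) *\<^sub>R p = real d *\<^sub>R p" by (simp add: of_nat_diff algebra_simps)
  also have "\<dots> = real a *\<^sub>R n1 + real b *\<^sub>R n2" using cramer_plane[of n2 n1 p] ab d by simp
  finally show ?thesis using P_scale[OF p, of "d - 1"] by blast
qed

text \<open>
  By Cramer's rule the determinant \<open>d\<close> of \<open>n1\<close>, \<open>n2\<close> multiplies every element of \<open>P\<close> into \<open>\<nat> n1 + \<nat> n2\<close>, so the
  coefficients of the generators can be reduced modulo \<open>d\<close>.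
\<close>

lemma P_apery:
  assumes pos: "0 < cross2 n2 n1" and G: "finite G" "P = generated_semigroup G"
  shows "\<exists>B. finite B \<and> B \<subseteq> P \<and> (\<forall>p\<in>P. \<exists>b\<in>B. \<exists>i j::nat. p = b + real i *\<^sub>R n1 + real j *\<^sub>R n2)"
proof -
  have GP: "g \<in> P" if "g \<in> G" for g
    unfolding G(2) generated_semigroup_def
    using that by (intro CollectI exI[of _ "1::nat"] exI[of _ "\<lambda>_. 1"] exI[of _ "\<lambda>_. g"]) auto
  obtain d d' :: nat where d: "cross2 n2 n1 = real d" "cross2 n1 n1 = real d'" using cross2_nat[OF pos n1] .
  have d0: "0 < d" using pos d by simp
  have "\<forall>g\<in>G. \<exists>ab :: nat \<times> nat. real d *\<^sub>R g = real (fst ab) *\<^sub>R n1 + real (snd ab) *\<^sub>R n2"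
  proof
    fix g assume "g \<in> G"
    then obtain a b :: nat where ab: "cross2 n2 g = real a" "cross2 g n1 = real b" using cross2_nat[OF pos] GP by blast
    then have "real d *\<^sub>R g = real (fst (a, b)) *\<^sub>R n1 + real (snd (a, b)) *\<^sub>R n2"
      using cramer_plane[of n2 n1 g] d by simp
    then show "\<exists>ab :: nat \<times> nat. real d *\<^sub>R g = real (fst ab) *\<^sub>R n1 + real (snd ab) *\<^sub>R n2" by blast
  qed
  from bchoice[OF this] obtain h :: "real \<times> real \<Rightarrow> nat \<times> nat"
    where h: "\<And>g. g \<in> G \<Longrightarrow> real d *\<^sub>R g = real (fst (h g)) *\<^sub>R n1 + real (snd (h g)) *\<^sub>R n2" by blast
  define B where "B = (\<lambda>r. \<Sum>g\<in>G. real (r g) *\<^sub>R g) ` (G \<rightarrow>\<^sub>E {..<d})"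
  have fin: "finite B" unfolding B_def using G(1) by (intro finite_imageI finite_PiE) auto
  have sub: "B \<subseteq> P"
  proof
    fix b assume "b \<in> B"
    then obtain r where b: "b = (\<Sum>g\<in>G. real (r g) *\<^sub>R g)" unfolding B_def by blast
    show "b \<in> P" unfolding b by (rule P_sum, rule P_scale, rule GP)
  qed
  have rep: "\<exists>b\<in>B. \<exists>i j::nat. p = b + real i *\<^sub>R n1 + real j *\<^sub>R n2" if pP: "p \<in> P" for p
  proof -
    obtain m :: nat and c :: "nat \<Rightarrow> nat" and f where pm: "p = (\<Sum>i<m. real (c i) *\<^sub>R f i)" and fG: "\<forall>i<m. f i \<in> G"
      using pP unfolding G(2) generated_semigroup_def by blast
    define k where "k g = (\<Sum>i\<in>{i\<in>{..<m}. f i = g}. c i)" for g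
    have "p = (\<Sum>g\<in>G. \<Sum>i\<in>{i\<in>{..<m}. f i = g}. real (c i) *\<^sub>R f i)"
      unfolding pm by (rule sum.group[symmetric]) (use G(1) fG in auto)
    also have "\<dots> = (\<Sum>g\<in>G. real (k g) *\<^sub>R g)"
      by (rule sum.cong) (auto simp: k_def scaleR_sum_left)
    also have "\<dots> = (\<Sum>g\<in>G. real (k g mod d) *\<^sub>R g + (real (k g div d * fst (h g)) *\<^sub>R n1 + real (k g div d * snd (h g)) *\<^sub>R n2))"
    proof (rule sum.cong[OF refl])
      fix g assume g: "g \<in> G"
      have "real (k g) = real (k g mod d + k g div d * d)" by simp
      then have "real (k g) *\<^sub>R g = real (k g mod d) *\<^sub>R g + real (k g div d) *\<^sub>R (real d *\<^sub>R g)"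
        by (simp only: of_nat_add of_nat_mult scaleR_add_left scaleR_scaleR)
      then show "real (k g) *\<^sub>R g = real (k g mod d) *\<^sub>R g + (real (k g div d * fst (h g)) *\<^sub>R n1 + real (k g div d * snd (h g)) *\<^sub>R n2)"
        unfolding h[OF g] by (simp add: scaleR_add_right)
    qed
    also have "\<dots> = (\<Sum>g\<in>G. real (k g mod d) *\<^sub>R g) + real (\<Sum>g\<in>G. k g div d * fst (h g)) *\<^sub>R n1
        + real (\<Sum>g\<in>G. k g div d * snd (h g)) *\<^sub>R n2"
      by (simp add: sum.distrib scaleR_sum_left add.assoc)
    finally have p: "p = (\<Sum>g\<in>G. real (k g mod d) *\<^sub>R g) + real (\<Sum>g\<in>G. k g div d * fst (h g)) *\<^sub>R n1
        + real (\<Sum>g\<in>G. k g div d * snd (h g)) *\<^sub>R n2" .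
    have "(\<Sum>g\<in>G. real (k g mod d) *\<^sub>R g) = (\<Sum>g\<in>G. real (restrict (\<lambda>g. k g mod d) G g) *\<^sub>R g)"
      by (rule sum.cong) auto
    moreover have "restrict (\<lambda>g. k g mod d) G \<in> G \<rightarrow>\<^sub>E {..<d}" using d0 by auto
    ultimately have "(\<Sum>g\<in>G. real (k g mod d) *\<^sub>R g) \<in> B" unfolding B_def by blast
    then show ?thesis using p by blast
  qed
  show ?thesis by (rule exI[of _ B], intro conjI ballI fin sub rep)
qed

text \<open>So the criterion speaks about lattice points of the cone only.\<close>

lemma nat_plane_of_shift:
  assumes "z + n1 \<in> P" "z + n2 \<in> P"
  shows "z \<in> nat_plane" "0 \<le> coord1 z" "0 \<le> coord2 z"
proof -
  show c: "0 \<le> coord1 z" "0 \<le> coord2 z"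
    using coord_P(1)[OF assms(2)] coord_P(2)[OF assms(1)] by (simp_all add: coord_add)
  have n: "n1 \<in> nat_plane" "n2 \<in> nat_plane" using n1 n2 P_lattice by blast+
  then have nn: "0 \<le> fst n1" "0 \<le> snd n1" "0 \<le> fst n2" "0 \<le> snd n2"
    by (auto simp: mem_Times_iff elim!: Nats_cases)
  have "fst z = coord1 z * fst n1 + coord2 z * fst n2" "snd z = coord1 z * snd n1 + coord2 z * snd n2"
    using arg_cong[OF coords[of z], of fst] arg_cong[OF coords[of z], of snd] by simp_all
  then have z0: "0 \<le> fst z" "0 \<le> snd z" using c nn by auto
  have "z + n1 \<in> nat_plane" using assms P_lattice by blast
  then have "fst z + fst n1 \<in> \<int>" "fst n1 \<in> \<int>" "snd z + snd n1 \<in> \<int>" "snd n1 \<in> \<int>"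
    using n(1) Nats_subset_Ints by (auto simp: mem_Times_iff)
  then have "fst z \<in> \<int>" "snd z \<in> \<int>" using Ints_diff by fastforce+
  then show "z \<in> nat_plane" using z0 by (auto simp: mem_Times_iff Nats_altdef2)
qed

lemma lattice_point_in_rat_cone:
  assumes z: "z \<in> nat_plane" and c: "0 \<le> coord1 z" "0 \<le> coord2 z"
  shows "z \<in> rat_cone P"
proof -
  have n: "n1 \<in> nat_plane" "n2 \<in> nat_plane" using n1 n2 P_lattice by blast+
  have "cross2 x y \<in> \<rat>" if "x \<in> nat_plane" "y \<in> nat_plane" for x y
    using that Nats_subset_Rats unfolding cross2_def mem_Times_iff by (intro Rats_diff Rats_mult) blast+
  then have rat: "coord1 z \<in> \<rat>" "coord2 z \<in> \<rat>"
    unfolding coord_def using n z by (auto intro!: Rats_divide)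
  have "z = (\<Sum>i<(2::nat). (if i = 0 then coord1 z else coord2 z) *\<^sub>R (if i = 0 then n1 else n2))"
    using coords[of z] by (simp add: numeral_2_eq_2)
  then show ?thesis unfolding rat_cone_def using rat c n1 n2
    by (intro CollectI exI[of _ "2::nat"] exI[of _ "\<lambda>i. if i = 0 then coord1 z else coord2 z"]
        exI[of _ "\<lambda>i. if i = 0 then n1 else n2"]) auto
qed

abbreviation "ray1 \<equiv> {t *\<^sub>R n1 | t. 0 \<le> t}"
abbreviation "ray2 \<equiv> {t *\<^sub>R n2 | t. 0 \<le> t}"

lemma ray1_iff: "x \<in> ray1 \<longleftrightarrow> 0 \<le> coord1 x \<and> coord2 x = 0"
  using coords[of x] by (auto simp: coord_scale)
lemmas ray2_iff = polygon_cone.ray1_iff[OF swapped]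

definition gap_criterion :: bool where
  "gap_criterion \<longleftrightarrow> (\<forall>z. z + n1 \<in> P \<and> z + n2 \<in> P \<longrightarrow> z \<in> P)"

section \<open>Equal interiors\<close>

text \<open>
  Subtract \<open>n\<close> as long as possible; the remainder is shorter than \<open>n\<close>, hence zero.
\<close>

lemma ray_multiples:
  assumes n: "n \<in> P" "n \<noteq> 0" and least: "\<And>x. x \<in> P \<Longrightarrow> x \<in> {t *\<^sub>R n | t. 0 \<le> t} \<Longrightarrow> x \<noteq> 0 \<Longrightarrow> norm n \<le> norm x"
    and step: "\<And>z. z \<in> {t *\<^sub>R n | t. 0 < t} \<Longrightarrow> z + n \<in> P \<Longrightarrow> z \<in> P"
  shows "P \<inter> {t *\<^sub>R n | t. 0 \<le> t} = {real l *\<^sub>R n | l. True}"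
proof
  show "{real l *\<^sub>R n | l. True} \<subseteq> P \<inter> {t *\<^sub>R n | t. 0 \<le> t}" using P_scale[OF n(1)] by force
  show "P \<inter> {t *\<^sub>R n | t. 0 \<le> t} \<subseteq> {real l *\<^sub>R n | l. True}"
  proof
    fix x assume "x \<in> P \<inter> {t *\<^sub>R n | t. 0 \<le> t}"
    then obtain t where t: "0 \<le> t" "x = t *\<^sub>R n" "x \<in> P" by blast
    have desc: "(t - real l) *\<^sub>R n \<in> P" if "real l \<le> t" "t \<noteq> real l" for l
      using that
    proof (induction l)
      case 0
      then show ?case using t by simp
    next
      case (Suc l)
      then have "(t - real l) *\<^sub>R n \<in> P" by simp
      moreover have "(t - real (Suc l)) *\<^sub>R n + n = (t - real l) *\<^sub>R n" by (simp add: algebra_simps)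
      moreover have "(t - real (Suc l)) *\<^sub>R n \<in> {t *\<^sub>R n | t. 0 < t}" using Suc.prems by fastforce
      ultimately show ?case using step[of "(t - real (Suc l)) *\<^sub>R n"] by simp
    qed
    define l where "l = nat \<lfloor>t\<rfloor>"
    have l: "real l \<le> t" "t < real l + 1" using t(1) by (auto simp: l_def)
    have "t = real l"
    proof (rule ccontr)
      assume ne: "t \<noteq> real l"
      have "norm n \<le> norm ((t - real l) *\<^sub>R n)"
        using desc[OF l(1) ne] l(1) ne n(2) by (intro least) auto
      also have "\<dots> = (t - real l) * norm n" using l(1) by simp
      also have "\<dots> < 1 * norm n" using l n(2) by (intro mult_strict_right_mono) auto
      finally show False by simp
    qed
    then show "x \<in> {real l *\<^sub>R n | l. True}" using t by blast
  qed
qed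

text \<open>
  For \<open>z\<close> on the ray, \<open>z + n2\<close> is an interior lattice point, so only the condition on \<open>z + n1\<close> remains.
\<close>

lemma gap_criterion_imp_ray1_multiples:
  assumes crit: gap_criterion and inP: "\<And>z. z \<in> nat_plane \<Longrightarrow> 0 < coord1 z \<Longrightarrow> 0 < coord2 z \<Longrightarrow> z \<in> P"
    and least: "\<And>x. x \<in> P \<Longrightarrow> x \<in> ray1 \<Longrightarrow> x \<noteq> 0 \<Longrightarrow> norm n1 \<le> norm x"
  shows "P \<inter> ray1 = {real l *\<^sub>R n1 | l. True}"
proof (rule ray_multiples[OF n1 _ least])
  show "n1 \<noteq> 0" using indep by auto
  fix z assume z: "z \<in> {t *\<^sub>R n1 | t. 0 < t}" "z + n1 \<in> P"
  then obtain t where t: "0 < t" "z = t *\<^sub>R n1" by blast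
  have n: "n1 \<in> nat_plane" "n2 \<in> nat_plane" "z + n1 \<in> nat_plane" using n1 n2 z(2) P_lattice by blast+
  then have "fst z + fst n1 \<in> \<int>" "fst n1 \<in> \<int>" "snd z + snd n1 \<in> \<int>" "snd n1 \<in> \<int>"
    using Nats_subset_Ints by (auto simp: mem_Times_iff)
  then have "fst z \<in> \<int>" "snd z \<in> \<int>" using Ints_diff by fastforce+
  moreover have "0 \<le> fst z" "0 \<le> snd z" using t n(1) by (auto simp: mem_Times_iff elim!: Nats_cases)
  ultimately have "z \<in> nat_plane" by (simp add: mem_Times_iff Nats_altdef2)
  then have "z + n2 \<in> nat_plane" using n(2) by (auto simp: mem_Times_iff)
  then have "z + n2 \<in> P" using t by (intro inP) (simp_all add: coord_add coord_scale)
  then show "z \<in> P" using crit z(2) unfolding gap_criterion_def by blast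
qed

lemma gap_criterion_swapped: "polygon_cone.gap_criterion F n2 n1 \<longleftrightarrow> gap_criterion"
  unfolding gap_criterion_def polygon_cone.gap_criterion_def[OF swapped] by blast

lemma gap_criterion_equal_interiors:
  assumes eq: "C - (ray1 \<union> ray2) = P - (ray1 \<union> ray2)" and C: "C = rat_cone P \<inter> nat_plane"
    and least1: "\<And>x. x \<in> P \<Longrightarrow> x \<in> ray1 \<Longrightarrow> x \<noteq> 0 \<Longrightarrow> norm n1 \<le> norm x"
    and least2: "\<And>x. x \<in> P \<Longrightarrow> x \<in> ray2 \<Longrightarrow> x \<noteq> 0 \<Longrightarrow> norm n2 \<le> norm x"
  shows "gap_criterion \<longleftrightarrow> P \<inter> ray1 = {real l *\<^sub>R n1 | l. True} \<and> P \<inter> ray2 = {real l *\<^sub>R n2 | l. True}"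
proof
  have n: "n1 \<noteq> 0" "n2 \<noteq> 0" using indep by auto
  have inP: "z \<in> P" if "z \<in> nat_plane" "0 < coord1 z" "0 < coord2 z" for z
  proof -
    have "z \<in> C - (ray1 \<union> ray2)"
      using that lattice_point_in_rat_cone[of z] unfolding C Un_iff Diff_iff ray1_iff ray2_iff by simp
    then show ?thesis unfolding eq by blast
  qed
  show "P \<inter> ray1 = {real l *\<^sub>R n1 | l. True} \<and> P \<inter> ray2 = {real l *\<^sub>R n2 | l. True}" if crit: gap_criterion
    using gap_criterion_imp_ray1_multiples[OF crit inP least1]
      polygon_cone.gap_criterion_imp_ray1_multiples[OF swapped crit[folded gap_criterion_swapped] inP least2] by blast
  assume rays: "P \<inter> ray1 = {real l *\<^sub>R n1 | l. True} \<and> P \<inter> ray2 = {real l *\<^sub>R n2 | l. True}"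
  show gap_criterion
    unfolding gap_criterion_def
  proof (intro allI impI)
    fix z assume z: "z + n1 \<in> P \<and> z + n2 \<in> P"
    then have nz: "z \<in> nat_plane" "0 \<le> coord1 z" "0 \<le> coord2 z" using nat_plane_of_shift by blast+
    consider "coord2 z = 0" | "coord1 z = 0" | "0 < coord1 z" "0 < coord2 z" using nz by linarith
    then show "z \<in> P"
    proof cases
      case 1
      then have "z + n1 \<in> P \<inter> ray1" using z nz unfolding Int_iff ray1_iff by (simp add: coord_add)
      then obtain l where l: "z + n1 = real l *\<^sub>R n1" using rays by blast
      have "coord1 z + 1 = real l" using arg_cong[OF l, of coord1] by (simp add: coord_add coord_scale)
      then have "0 < l" using nz by (cases l) auto
      then have "real l *\<^sub>R n1 = real (l - 1) *\<^sub>R n1 + n1" by (simp add: of_nat_diff algebra_simps)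
      then have "z = real (l - 1) *\<^sub>R n1" using l by simp
      then show ?thesis using P_scale[OF n1] by simp
    next
      case 2
      then have "z + n2 \<in> P \<inter> ray2" using z nz unfolding Int_iff ray2_iff by (simp add: coord_add)
      then obtain l where l: "z + n2 = real l *\<^sub>R n2" using rays by blast
      have "coord2 z + 1 = real l" using arg_cong[OF l, of coord2] by (simp add: coord_add coord_scale)
      then have "0 < l" using nz by (cases l) auto
      then have "real l *\<^sub>R n2 = real (l - 1) *\<^sub>R n2 + n2" by (simp add: of_nat_diff algebra_simps)
      then have "z = real (l - 1) *\<^sub>R n2" using l by simp
      then show ?thesis using P_scale[OF n2] by simp
    next
      case 3
      then show ?thesis using inP nz by blast
    qed
  qed
qed

lemma corner_facts:
  assumes c: "corner F a p q" and n: "n1 = real m *\<^sub>R a" and m: "0 < m"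
  shows "\<exists>w>0. (\<forall>x. x \<in> gap_line a p q \<longleftrightarrow> coord2 x * w = 1) \<and> clear_near n1 n2 (\<lambda>z. 1 \<le> coord2 z * w) \<and>
    (\<forall>z. z + n1 \<in> P \<longrightarrow> z \<in> nat_plane \<longrightarrow> 0 \<le> coord1 z \<longrightarrow> 0 \<le> coord2 z \<longrightarrow> coord2 z * w \<le> 1 \<longrightarrow>
      z \<in> gap_region a p q n1 ray2 \<or> z \<in> P)"
proof -
  interpret corner F a p q by fact
  have width: "width z = coord2 z * width n2" for z
    by (subst coords[of z]) (simp add: width_add width_scale n del: coord_basis)
  have w: "0 < width n2"
    using width_p(2) coord_F(2)[OF pF] unfolding width[of p] by (auto simp: zero_less_mult_iff)
  have "z \<in> gap_region a p q n1 ray2 \<or> z \<in> P"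
    if z: "z + n1 \<in> P" "z \<in> nat_plane" "0 \<le> coord1 z" "0 \<le> coord2 z" "coord2 z * width n2 \<le> 1" for z
  proof -
    obtain i0 x0 where "x0 \<in> F" "z + n1 = real i0 *\<^sub>R x0" using z(1) unfolding mem_P_iff by blast
    then have zn: "x0 \<in> F" "z + real m *\<^sub>R a = real i0 *\<^sub>R x0" using n by auto
    define R where "R = (1 / width n2) *\<^sub>R n2"
    have R: "R \<in> gap_line a p q \<inter> ray2"
      using w unfolding gap_line_eq by (auto simp: R_def width_scale)
    have "width z *\<^sub>R R = coord2 z *\<^sub>R n2" using w by (simp add: width[of z] R_def)
    then have zR: "z = width z *\<^sub>R R + (coord1 z * real m) *\<^sub>R a"
      using coords[of z] n by (simp add: add.commute)
    have wz: "0 \<le> width z" "width z \<le> 1" using z(4,5) w unfolding width[of z] by auto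
    have mu: "0 \<le> coord1 z * real m" using z(3) by simp
    have "z \<in> gap_region a p q (real m *\<^sub>R a) ray2 \<or> (\<exists>i. \<exists>x\<in>F. z = real i *\<^sub>R x)"
      by (rule strip_dichotomy[OF zn m wz zR mu R])
    then show ?thesis unfolding n[symmetric] mem_P_iff using z(2) by blast
  qed
  moreover have "clear_near n1 n2 (\<lambda>z. 1 \<le> coord2 z * width n2)"
  proof -
    have "(\<lambda>z. 1 \<le> width z) = (\<lambda>z. 1 \<le> coord2 z * width n2)"
      by (rule ext, subst width, rule refl)
    then show ?thesis using clear_near_corner[OF c n m w] by (simp only:)
  qed
  moreover have "x \<in> gap_line a p q \<longleftrightarrow> coord2 x * width n2 = 1" for x
    unfolding gap_line_eq using width[of x] by simp
  ultimately show ?thesis using w by (intro exI[of _ "width n2"] conjI allI impI) blast+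
qed

text \<open>
  A rational dilation factor exists when the interval has positive length. This may fail on a ray
  that meets \<open>F\<close> in a single point.
\<close>

lemma rat_cone_mem:
  assumes c: "0 \<le> coord1 z" "0 \<le> coord2 z"
    and 1: "0 < coord2 z \<or> nondegenerate_segment (F \<inter> ray1)"
    and 2: "0 < coord1 z \<or> nondegenerate_segment (F \<inter> ray2)"
    and nb: "\<not> (nondegenerate_segment (F \<inter> ray1) \<and> nondegenerate_segment (F \<inter> ray2))"
  shows "z \<in> rat_cone F"
proof -
  have n: "n1 \<noteq> 0" "n2 \<noteq> 0" using indep by auto
  consider "0 < coord1 z" "0 < coord2 z" | "coord2 z = 0" "0 < coord1 z" "nondegenerate_segment (F \<inter> ray1)"
    | "coord1 z = 0" "0 < coord2 z" "nondegenerate_segment (F \<inter> ray2)"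
    using assms by linarith
  then show ?thesis
  proof cases
    case 1
    obtain d where d: "0 < d" "\<And>z. 0 \<le> coord1 z \<Longrightarrow> 0 \<le> coord2 z \<Longrightarrow>
      \<exists>s t. fits z s t \<and> d * min (coord1 z) (coord2 z) \<le> t - s" using fits_inside by blast
    obtain s t where st: "fits z s t" "d * min (coord1 z) (coord2 z) \<le> t - s" using d(2)[OF c] by blast
    have "0 < d * min (coord1 z) (coord2 z)" using d(1) 1 by simp
    then show ?thesis using fits_imp_rat_cone[OF st(1)] st(2) by simp
  next
    case 2
    obtain s t where st: "fits n1 s t" "s < t" using fits_segment[OF 2(3) n(1)] by blast
    have "fits (coord1 z *\<^sub>R n1) (coord1 z * s) (coord1 z * t)" by (rule fits_scale[OF st(1) c(1)])
    moreover have "coord1 z *\<^sub>R n1 = z" using coords[of z] 2(1) by simp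
    ultimately show ?thesis using fits_imp_rat_cone[of z] st(2) 2(2) by simp
  next
    case 3
    obtain s t where st: "fits n2 s t" "s < t" using fits_segment[OF 3(3) n(2)] by blast
    have "fits (coord2 z *\<^sub>R n2) (coord2 z * s) (coord2 z * t)" by (rule fits_scale[OF st(1) c(2)])
    moreover have "coord2 z *\<^sub>R n2 = z" using coords[of z] 3(1) by simp
    ultimately show ?thesis using fits_imp_rat_cone[of z] st(2) 3(2) by simp
  qed
qed

text \<open>
  Adding \<open>n1\<close> or \<open>n2\<close> raises the sum of the coordinates by 1, so the criterion can be applied by
  descending induction on it.
\<close>

lemma gap_criterion_of_cofinite:
  assumes crit: gap_criterion
    and step: "\<And>z. D z \<Longrightarrow> D (z + n1)" "\<And>z. D z \<Longrightarrow> D (z + n2)"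
    and far: "\<And>z. D z \<Longrightarrow> N \<le> coord1 z + coord2 z \<Longrightarrow> z \<in> P"
    and z: "D z"
  shows "z \<in> P"
proof -
  have "z \<in> P" if "D z" "N - real k \<le> coord1 z + coord2 z" for k z
    using that
  proof (induction k arbitrary: z)
    case 0
    then show ?case using far by simp
  next
    case (Suc k)
    have "z + n1 \<in> P" using Suc.prems step by (intro Suc.IH) (simp_all add: coord_add)
    moreover have "z + n2 \<in> P" using Suc.prems step by (intro Suc.IH) (simp_all add: coord_add)
    ultimately show ?case using crit unfolding gap_criterion_def by blast
  qed
  moreover obtain k :: nat where "N - (coord1 z + coord2 z) \<le> real k" using real_arch_simple by blast
  ultimately show ?thesis using z by (metis diff_le_eq add.commute)
qed

text \<open>
  The vertex case and the segment case in one form. Scaled by \<open>w\<close>, the distance from the ray is 1 on the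
  line \<open>\<nu>\<close> in the vertex case; in the segment case there are no gaps far out near the ray.
\<close>

lemma ray1_facts:
  fixes N Y :: "(real \<times> real) set"
  defines "seg \<equiv> nondegenerate_segment (F \<inter> ray1)"
  assumes c: "\<not> seg \<Longrightarrow> corner F a p q \<and> (\<exists>m>0. n1 = real m *\<^sub>R a)"
    and N: "N = (if seg then ray1 else gap_line a p q)"
    and Y: "Y = (if seg then {0} else gap_region a p q n1 ray2)"
    and Q: "Q \<in> N"
  shows "\<exists>w>0. (seg \<longrightarrow> coord2 Q = 0) \<and> (\<not> seg \<longrightarrow> coord2 Q * w = 1) \<and>
    clear_near n1 n2 (\<lambda>z. seg \<or> 1 \<le> coord2 z * w) \<and>
    (\<not> seg \<longrightarrow> (\<forall>z. z + n1 \<in> P \<longrightarrow> z \<in> nat_plane \<longrightarrow> 0 \<le> coord1 z \<longrightarrow> 0 \<le> coord2 z \<longrightarrow> coord2 z * w \<le> 1 \<longrightarrow>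
      z \<in> Y \<or> z \<in> P))"
proof (cases seg)
  case True
  have n: "n1 \<noteq> 0" using indep by auto
  obtain s t where "fits n1 s t" "s < t" using fits_segment[OF _ n] True seg_def by blast
  then have "clear_near n1 n2 (\<lambda>_. True)" by (rule clear_near_segment)
  moreover have "coord2 Q = 0" using Q True unfolding N by (simp only: if_True ray1_iff)
  ultimately show ?thesis using True by (intro exI[of _ 1]) simp
next
  case False
  then obtain m where c: "corner F a p q" "n1 = real m *\<^sub>R a" "0 < m" using c by blast
  obtain w where w: "0 < w" "\<forall>x. x \<in> gap_line a p q \<longleftrightarrow> coord2 x * w = 1" "clear_near n1 n2 (\<lambda>z. 1 \<le> coord2 z * w)"
    "\<forall>z. z + n1 \<in> P \<longrightarrow> z \<in> nat_plane \<longrightarrow> 0 \<le> coord1 z \<longrightarrow> 0 \<le> coord2 z \<longrightarrow> coord2 z * w \<le> 1 \<longrightarrow>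
      z \<in> gap_region a p q n1 ray2 \<or> z \<in> P"
    using corner_facts[OF c] by (elim exE conjE) (rule that)
  have "coord2 Q * w = 1" using Q False w(2) unfolding N by simp
  then show ?thesis using False w(1,3,4) unfolding Y by (intro exI[of _ w]) (simp only: if_False simp_thms)
qed

lemma gap_criterion_iff_regions:
  fixes N1 N2 Y1 Y2 :: "(real \<times> real) set"
  defines "seg1 \<equiv> nondegenerate_segment (F \<inter> ray1)" and "seg2 \<equiv> nondegenerate_segment (F \<inter> ray2)"
  assumes c1: "\<not> seg1 \<Longrightarrow> corner F a1 p1 q1 \<and> (\<exists>m>0. n1 = real m *\<^sub>R a1)"
    and c2: "\<not> seg2 \<Longrightarrow> corner F a2 p2 q2 \<and> (\<exists>m>0. n2 = real m *\<^sub>R a2)"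
    and nb: "\<not> (seg1 \<and> seg2)"
    and N1: "N1 = (if seg1 then ray1 else gap_line a1 p1 q1)"
    and N2: "N2 = (if seg2 then ray2 else gap_line a2 p2 q2)"
    and Y1: "Y1 = (if seg1 then {0} else gap_region a1 p1 q1 n1 ray2)"
    and Y2: "Y2 = (if seg2 then {0} else gap_region a2 p2 q2 n2 ray1)"
    and Q: "N1 \<inter> N2 = {Q}"
    and U: "U = (\<lambda>X. Q + X) ` rat_cone F \<inter> nat_plane"
    and U': "U' = {X \<in> Y1 \<inter> nat_plane. X + n1 \<in> P \<and> X + n2 \<in> P}"
    and U'': "U'' = {X \<in> Y2 \<inter> nat_plane. X + n1 \<in> P \<and> X + n2 \<in> P}"
  shows "gap_criterion \<longleftrightarrow> U \<union> U' \<union> U'' \<subseteq> P"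
proof -
  have QN: "Q \<in> N1" "Q \<in> N2" using Q by blast+
  obtain w1 where w1: "0 < w1" "seg1 \<Longrightarrow> coord2 Q = 0" "\<not> seg1 \<Longrightarrow> coord2 Q * w1 = 1"
    "clear_near n1 n2 (\<lambda>z. seg1 \<or> 1 \<le> coord2 z * w1)"
    "\<And>z. \<not> seg1 \<Longrightarrow> z + n1 \<in> P \<Longrightarrow> z \<in> nat_plane \<Longrightarrow> 0 \<le> coord1 z \<Longrightarrow> 0 \<le> coord2 z \<Longrightarrow> coord2 z * w1 \<le> 1 \<Longrightarrow>
      z \<in> Y1 \<or> z \<in> P"
    using ray1_facts[OF c1[unfolded seg1_def] N1[unfolded seg1_def] Y1[unfolded seg1_def] QN(1)]
    unfolding seg1_def by blast
  obtain w2 where w2: "0 < w2" "seg2 \<Longrightarrow> coord1 Q = 0" "\<not> seg2 \<Longrightarrow> coord1 Q * w2 = 1"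
    "clear_near n2 n1 (\<lambda>z. seg2 \<or> 1 \<le> coord1 z * w2)"
    "\<And>z. \<not> seg2 \<Longrightarrow> z + n2 \<in> P \<Longrightarrow> z \<in> nat_plane \<Longrightarrow> 0 \<le> coord1 z \<Longrightarrow> 0 \<le> coord2 z \<Longrightarrow> coord1 z * w2 \<le> 1 \<Longrightarrow>
      z \<in> Y2 \<or> z \<in> P"
    using polygon_cone.ray1_facts[OF swapped c2[unfolded seg2_def] N2[unfolded seg2_def] Y2[unfolded seg2_def] QN(2)]
    unfolding seg2_def by blast
  have Q0: "0 \<le> coord1 Q" "0 \<le> coord2 Q"
    using w1(1-3) w2(1-3) by (metis order_refl zero_le_one mult_neg_pos not_le order_less_imp_le)+
  show ?thesis
  proof
    assume crit: gap_criterion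
    \<comment> \<open>The region beyond both lines, closed under adding \<open>n1\<close> and \<open>n2\<close>.\<close>
    define D where "D z \<longleftrightarrow> z \<in> nat_plane \<and> 0 \<le> coord1 z \<and> 0 \<le> coord2 z \<and>
      (seg1 \<or> 1 \<le> coord2 z * w1) \<and> (seg2 \<or> 1 \<le> coord1 z * w2)" for z
    obtain N where N: "\<forall>z\<in>nat_plane. 0 \<le> coord1 z \<longrightarrow> 0 \<le> coord2 z \<longrightarrow> (seg1 \<or> 1 \<le> coord2 z * w1) \<longrightarrow>
      (seg2 \<or> 1 \<le> coord1 z * w2) \<longrightarrow> N \<le> coord1 z + coord2 z \<longrightarrow> z \<in> P"
      using clear_imp_cofinite[OF w1(4) w2(4)] by blast
    have nat_add: "z + n \<in> nat_plane" if "z \<in> nat_plane" "n \<in> P" for z n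
    proof -
      have "n \<in> nat_plane" using that P_lattice by blast
      then show ?thesis using that(1) by (auto simp: mem_Times_iff)
    qed
    have D1: "D (z + n1)" if z: "D z" for z
    proof -
      have "coord1 z * w2 \<le> coord1 (z + n1) * w2" using w2(1) by (simp add: coord_add)
      moreover have "z + n1 \<in> nat_plane" using nat_add[OF _ n1] z unfolding D_def by blast
      moreover have "coord2 (z + n1) = coord2 z" "coord1 (z + n1) = coord1 z + 1" by (simp_all add: coord_add)
      ultimately show ?thesis using z unfolding D_def by auto
    qed
    have D2: "D (z + n2)" if z: "D z" for z
    proof -
      have "coord2 z * w1 \<le> coord2 (z + n2) * w1" using w1(1) by (simp add: coord_add)
      moreover have "z + n2 \<in> nat_plane" using nat_add[OF _ n2] z unfolding D_def by blast
      moreover have "coord1 (z + n2) = coord1 z" "coord2 (z + n2) = coord2 z + 1" by (simp_all add: coord_add)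
      ultimately show ?thesis using z unfolding D_def by auto
    qed
    have DP: "z \<in> P" if "D z" for z
      by (rule gap_criterion_of_cofinite[OF crit D1 D2 _ that, of N]) (use N in \<open>auto simp: D_def\<close>)
    have "U \<subseteq> P"
    proof
      fix z assume "z \<in> U"
      then have zU: "z \<in> (\<lambda>X. Q + X) ` rat_cone F" "z \<in> nat_plane" unfolding U by simp_all
      from zU(1) obtain X where X: "X \<in> rat_cone F" "z = Q + X" by (elim imageE) (rule that)
      have Xc: "0 \<le> coord1 X" "0 \<le> coord2 X" using rat_cone_coords[OF X(1)] by auto
      have "seg1 \<or> 1 \<le> coord2 z * w1"
      proof (cases seg1)
        case False
        moreover have "0 \<le> coord2 X * w1" using w1(1) Xc by simp
        ultimately show ?thesis using w1(3) by (simp add: X(2) coord_add distrib_right)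
      qed simp
      moreover have "seg2 \<or> 1 \<le> coord1 z * w2"
      proof (cases seg2)
        case False
        moreover have "0 \<le> coord1 X * w2" using w2(1) Xc by simp
        ultimately show ?thesis using w2(3) by (simp add: X(2) coord_add distrib_right)
      qed simp
      ultimately show "z \<in> P"
        using zU(2) Xc Q0 by (intro DP) (simp add: D_def X(2) coord_add)
    qed
    moreover have "U' \<subseteq> P" "U'' \<subseteq> P" using crit unfolding U' U'' gap_criterion_def by blast+
    ultimately show "U \<union> U' \<union> U'' \<subseteq> P" by blast
  next
    assume sub: "U \<union> U' \<union> U'' \<subseteq> P"
    show gap_criterion
      unfolding gap_criterion_def
    proof (intro allI impI)
      fix z assume zn: "z + n1 \<in> P \<and> z + n2 \<in> P"
      then have z: "z \<in> nat_plane" "0 \<le> coord1 z" "0 \<le> coord2 z" using nat_plane_of_shift by blast+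
      consider "\<not> seg1" "coord2 z * w1 \<le> 1" | "\<not> seg2" "coord1 z * w2 \<le> 1"
        | "seg1 \<or> 1 < coord2 z * w1" "seg2 \<or> 1 < coord1 z * w2" by linarith
      then show "z \<in> P"
      proof cases
        case 1
        then have "z \<in> Y1 \<or> z \<in> P" using w1(5) zn z by blast
        then show ?thesis using sub zn z unfolding U' by blast
      next
        case 2
        then have "z \<in> Y2 \<or> z \<in> P" using w2(5) zn z by blast
        then show ?thesis using sub zn z unfolding U'' by blast
      next
        case 3
        have "0 \<le> coord1 (z - Q) \<and> (0 < coord1 (z - Q) \<or> seg2)"
        proof (cases seg2)
          case True
          then show ?thesis using w2(2) z by (simp add: coord_diff)
        next
          case False
          then have "coord1 Q * w2 < coord1 z * w2" using 3 w2(3) by simp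
          then show ?thesis using w2(1) by (simp add: coord_diff)
        qed
        moreover have "0 \<le> coord2 (z - Q) \<and> (0 < coord2 (z - Q) \<or> seg1)"
        proof (cases seg1)
          case True
          then show ?thesis using w1(2) z by (simp add: coord_diff)
        next
          case False
          then have "coord2 Q * w1 < coord2 z * w1" using 3 w1(3) by simp
          then show ?thesis using w1(1) by (simp add: coord_diff)
        qed
        ultimately have "z - Q \<in> rat_cone F"
          using nb unfolding seg1_def seg2_def by (intro rat_cone_mem) auto
        then have "Q + (z - Q) \<in> (\<lambda>X. Q + X) ` rat_cone F" by (rule imageI)
        then have "z \<in> U" unfolding U using z(1) by simp
        then show ?thesis using sub by blast
      qed
    qed
  qed
qed

lemma continuous_coord: "continuous_on UNIV (coord v w)"
proof -
  have eq: "coord v w = (\<lambda>x. (1 / cross2 w v) * (fst w * snd x - snd w * fst x))"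
    by (rule ext) (simp add: coord_def cross2_def[of w])
  show ?thesis unfolding eq by (intro continuous_intros)
qed

text \<open>A compact convex subset of a line is a segment.\<close>

lemma ray_section:
  assumes F: "compact F" and ray: "closed R" "convex R" "\<And>x. x \<in> R \<Longrightarrow> \<exists>t. x = t *\<^sub>R n"
    and ne: "F \<inter> R \<noteq> {}" and ndeg: "\<not> nondegenerate_segment (F \<inter> R)"
  shows "is_singleton (F \<inter> R)"
proof -
  have "collinear (F \<inter> R)"
    unfolding collinear_def
  proof (intro exI[of _ n] ballI)
    fix x y assume "x \<in> F \<inter> R" "y \<in> F \<inter> R"
    then obtain s t where "x = s *\<^sub>R n" "y = t *\<^sub>R n" using ray(3) by (meson IntD2)
    then show "\<exists>c. x - y = c *\<^sub>R n" by (intro exI[of _ "s - t"]) (simp add: scaleR_diff_left)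
  qed
  moreover have "compact (F \<inter> R)" using F ray(1) by (rule compact_Int_closed)
  moreover have "convex (F \<inter> R)" using conv ray(2) by (rule convex_Int)
  ultimately obtain a b where ab: "F \<inter> R = closed_segment a b"
    using compact_convex_collinear_segment[OF ne] by metis
  then have "a = b" using ndeg unfolding nondegenerate_segment_def by blast
  then show ?thesis using ab by (simp add: is_singleton_def)
qed

lemma ray1_section: "compact F \<Longrightarrow> \<not> nondegenerate_segment (F \<inter> ray1) \<Longrightarrow> is_singleton (F \<inter> ray1)"
proof (rule ray_section)
  have eq: "ray1 = {x. 0 \<le> coord1 x} \<inter> {x. coord2 x = 0}" using ray1_iff by blast
  show "closed ray1" unfolding eq
    by (intro closed_Int closed_Collect_le closed_Collect_eq continuous_coord continuous_on_const)
  show "convex ray1" unfolding eq by (auto simp: convex_def coord_add coord_scale)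
  show "F \<inter> ray1 \<noteq> {}"
  proof -
    obtain i x where x: "x \<in> F" "n1 = real i *\<^sub>R x" using n1 unfolding mem_P_iff by blast
    have "i \<noteq> 0" using x indep by (cases i) auto
    then have "x = (1 / real i) *\<^sub>R n1" using x by simp
    then show ?thesis using x(1) by force
  qed
qed auto

lemmas ray2_section = polygon_cone.ray1_section[OF swapped]

lemma generator_multiple:
  assumes "n \<in> P" "n \<noteq> 0" "F \<inter> {t *\<^sub>R n | t. 0 \<le> t} = {a}"
  shows "\<exists>m>0. n = real m *\<^sub>R a"
proof -
  obtain i x where x: "x \<in> F" "n = real i *\<^sub>R x" using assms(1) unfolding mem_P_iff by blast
  have i: "i \<noteq> 0" using x assms(2) by (cases i) auto
  then have "x = (1 / real i) *\<^sub>R n" using x by simp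
  then have "x \<in> F \<inter> {t *\<^sub>R n | t. 0 \<le> t}" using x(1) by force
  then have "x = a" using assms(3) by simp
  then show ?thesis using x i by auto
qed

text \<open>The sign \<open>\<sigma>\<close> is the orientation of the two rays; it decides which neighbour faces the origin.\<close>

lemma corner_on_ray1:
  fixes \<sigma> :: real
  assumes a: "F \<inter> ray1 = {a}" and mem: "a \<in> F" "p \<in> F" "q \<in> F" "p \<noteq> a" "q \<noteq> a"
    and \<sigma>: "0 < \<sigma> * cross2 n2 n1"
    and low: "\<And>x. x \<in> F \<Longrightarrow> 0 \<le> \<sigma> * cross2 (q - a) (x - a)"
    and up: "\<And>x. x \<in> F \<Longrightarrow> 0 \<le> \<sigma> * cross2 (a - p) (x - p)"
  shows "corner F a p q \<and> (\<exists>m>0. n1 = real m *\<^sub>R a)"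
proof -
  have "n1 \<noteq> 0" using indep by auto
  from generator_multiple[OF n1 this a] obtain m where m: "0 < m" "n1 = real m *\<^sub>R a" by blast
  have pos: "0 < \<sigma> * cross2 x a" if "x \<in> F" "x \<noteq> a" for x
  proof -
    have "x \<notin> ray1" using that a by blast
    then have "coord2 x \<noteq> 0" using coord_F(1)[OF that(1)] by (simp only: ray1_iff simp_thms)
    then have "0 < coord2 x" using coord_F(2)[OF that(1)] by simp
    then have "0 < coord2 x * (\<sigma> * cross2 n2 n1)" using \<sigma> by (rule mult_pos_pos)
    moreover have "coord2 x * cross2 n2 n1 = real m * cross2 x a"
      using indep m(2) by (simp add: coord_swap[of n2] cross2_scale_right)
    ultimately have "0 < real m * (\<sigma> * cross2 x a)" by (simp add: mult.left_commute)
    then show ?thesis using m(1) by (simp add: zero_less_mult_iff)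
  qed
  have "corner F a p q" by (rule cornerI[OF conv mem(1-3) int pos[OF mem(2,4)] pos[OF mem(3,5)] low up])
  then show ?thesis using m by blast
qed

lemma corner_ray1:
  assumes F: "compact F" and pos: "0 < cross2 n2 n1" and A: "ccw_vertices F A" and a: "F \<inter> ray1 = {A ! 0}"
  shows "corner F (A ! 0) (last A) (A ! 1) \<and> (\<exists>m>0. n1 = real m *\<^sub>R (A ! 0))"
proof -
  note E = ccw_vertices_edges[OF A ccw_vertices_length[OF F conv int A]]
  show ?thesis by (rule corner_on_ray1[OF a E(1,3,2,5,4), of 1]) (use pos E in auto)
qed

lemma corner_ray2:
  assumes F: "compact F" and pos: "0 < cross2 n2 n1" and B: "ccw_vertices F B" and a: "F \<inter> ray2 = {B ! 0}"
  shows "corner F (B ! 0) (B ! 1) (last B) \<and> (\<exists>m>0. n2 = real m *\<^sub>R (B ! 0))"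
proof -
  note E = ccw_vertices_edges[OF B ccw_vertices_length[OF F conv int B]]
  show ?thesis
  proof (rule polygon_cone.corner_on_ray1[OF swapped a E(1,2,3,4,5), of "- 1"])
    show "0 < - 1 * cross2 n1 n2" using pos by (simp add: cross2_flip[of n1])
    show "0 \<le> - 1 * cross2 (last B - B ! 0) (x - B ! 0)" if "x \<in> F" for x
      using E(7)[OF that] by (simp add: cross2_def algebra_simps)
    show "0 \<le> - 1 * cross2 (B ! 0 - B ! 1) (x - B ! 1)" if "x \<in> F" for x
      using E(6)[OF that] by (simp add: cross2_def algebra_simps)
  qed
qed

end

lemma mem_rat_cone_self: "p \<in> S \<Longrightarrow> p \<in> rat_cone S"
  unfolding rat_cone_def
  by (intro CollectI exI[of _ "1::nat"] exI[of _ "\<lambda>_. 1"] exI[of _ "\<lambda>_. p"]) auto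

text \<open>
  The extremal rays bound \<open>P\<close> by \<open>ray_face_supports\<close>, hence \<open>F\<close> by \<open>nonneg_on_polygon\<close>.
\<close>

lemma polygon_coneI:
  assumes F: "convex F" "interior F \<noteq> {}" "F \<subseteq> nonneg_plane"
    and P: "P = polygonal_semigroup F" and C: "C = rat_cone P \<inter> nat_plane"
    and rays: "extremal_ray C \<tau>1" "extremal_ray C \<tau>2" "greater_slope \<tau>1 \<tau>2"
    and n1: "n1 \<in> P" "n1 \<in> \<tau>1" "n1 \<noteq> 0" and n2: "n2 \<in> P" "n2 \<in> \<tau>2" "n2 \<noteq> 0"
  shows "polygon_cone F n1 n2" and "0 < cross2 n2 n1"
proof -
  note eq = extremal_ray_eq[OF rays(1) n1(2,3)] extremal_ray_eq[OF rays(2) n2(2,3)]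
  show indep: "0 < cross2 n2 n1"
  proof -
    obtain v w where vw: "v \<in> \<tau>1" "w \<in> \<tau>2" "0 < cross2 w v" using rays(3) unfolding greater_slope_def by blast
    then obtain s r where "v = s *\<^sub>R n1" "w = r *\<^sub>R n2" "0 \<le> s" "0 \<le> r" unfolding eq by blast
    then have "0 < (r * s) * cross2 n2 n1" "0 \<le> r * s"
      using vw(3) by (simp_all add: cross2_scale_left cross2_scale_right mult_ac)
    then show ?thesis by (simp add: zero_less_mult_iff)
  qed
  have C0: "C \<subseteq> nonneg_plane" unfolding C by (auto elim!: Nats_cases)
  have "P \<subseteq> nat_plane" unfolding P polygonal_semigroup_def by blast
  then have PK: "x \<in> convex_cone hull C" if "x \<in> P" for x
    using mem_rat_cone_self[OF that] that unfolding C by (intro hull_inc) blast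
  have faces: "{t *\<^sub>R n1 | t. 0 \<le> t} face_of convex_cone hull C" "{t *\<^sub>R n2 | t. 0 \<le> t} face_of convex_cone hull C"
  proof -
    have "\<tau>1 face_of convex_cone hull C" "\<tau>2 face_of convex_cone hull C"
      using rays(1,2) unfolding extremal_ray_def by blast+
    then show "{t *\<^sub>R n1 | t. 0 \<le> t} face_of convex_cone hull C" "{t *\<^sub>R n2 | t. 0 \<le> t} face_of convex_cone hull C"
      by (simp_all only: eq)
  qed
  have p1: "0 \<le> cross2 x n1" if "x \<in> P" for x
    using ray_face_supports[OF C0 faces(1) PK[OF n2(1)], of 1 x] indep PK[OF that] by simp
  have p2: "0 \<le> cross2 n2 x" if "x \<in> P" for x
    using ray_face_supports[OF C0 faces(2) PK[OF n1(1)], of "- 1" x] indep PK[OF that]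
    by (simp add: cross2_flip[of n1 n2] cross2_flip[of x n2])
  have F2: "0 \<le> cross2 n2 x" if "x \<in> F" for x
    by (rule nonneg_on_polygon[OF F, of "cross2 n2", OF _ _ _ that])
      (use p2 in \<open>auto simp: cross2_scale_right P cross2_def[abs_def] algebra_simps intro!: continuous_intros\<close>)
  have F1: "0 \<le> cross2 x n1" if "x \<in> F" for x
    by (rule nonneg_on_polygon[OF F, of "\<lambda>x. cross2 x n1", OF _ _ _ that])
      (use p1 in \<open>auto simp: cross2_scale_left P cross2_def[abs_def] algebra_simps intro!: continuous_intros\<close>)
  show "polygon_cone F n1 n2"
  proof
    show "0 \<le> coord n1 n2 x" "0 \<le> coord n2 n1 x" if "x \<in> F" for x
      using F1[OF that] F2[OF that] indep by (simp_all add: coord_def[of n1] coord_swap[of n2])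
  qed (use F n1 n2 indep P in auto)
qed

theorem theorem11:
  fixes F P C \<tau>1 \<tau>2 U U' U'' :: "(real \<times> real) set"
    and n1 n2 Q :: "real \<times> real"
    and A B :: "(real \<times> real) list"
  assumes polygon: "polytope F" "F \<noteq> {}" "F \<subseteq> nonneg_plane"
    and not_segment: "\<nexists>a b. F = closed_segment a b"
    and P: "P = polygonal_semigroup F"
    and C: "C = rat_cone P \<inter> nat_plane"
    and simplicial: "simplicial_affine P"
    and P_neq_C: "P \<noteq> C"
    and rays: "extremal_ray C \<tau>1" "extremal_ray C \<tau>2" "greater_slope \<tau>1 \<tau>2"
    and not_both: "\<not> (nondegenerate_segment (F \<inter> \<tau>1) \<and> nondegenerate_segment (F \<inter> \<tau>2))"
    and n1: "is_arg_min norm (\<lambda>x. x \<in> P \<inter> \<tau>1 \<and> x \<noteq> 0) n1"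
    and n2: "is_arg_min norm (\<lambda>x. x \<in> P \<inter> \<tau>2 \<and> x \<noteq> 0) n2"
    and A: "ccw_vertices F A" "is_singleton (F \<inter> \<tau>1) \<longrightarrow> F \<inter> \<tau>1 = {A ! 0}"
    and B: "ccw_vertices F B" "is_singleton (F \<inter> \<tau>2) \<longrightarrow> F \<inter> \<tau>2 = {B ! 0}"
    and Q: "nu1 F \<tau>1 A \<inter> nu2 F \<tau>2 B = {Q}"
    and U: "U = (\<lambda>X. Q + X) ` rat_cone F \<inter> nat_plane"
    and U': "U' = {X \<in> Upsilon1 F \<tau>1 \<tau>2 n1 A \<inter> nat_plane. X + n1 \<in> P \<and> X + n2 \<in> P}"
    and U'': "U'' = {X \<in> Upsilon2 F \<tau>1 \<tau>2 n2 B \<inter> nat_plane. X + n1 \<in> P \<and> X + n2 \<in> P}"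
  shows "(C - (\<tau>1 \<union> \<tau>2) = P - (\<tau>1 \<union> \<tau>2) \<longrightarrow>
            (Cohen_Macaulay_ring (semigroup_ring P :: ((real \<times> real) \<Rightarrow>\<^sub>0 'k::field) ring) \<longleftrightarrow>
               P \<inter> \<tau>1 = {real l *\<^sub>R n1 | l. True} \<and> P \<inter> \<tau>2 = {real l *\<^sub>R n2 | l. True})) \<and>
         (C - (\<tau>1 \<union> \<tau>2) \<noteq> P - (\<tau>1 \<union> \<tau>2) \<longrightarrow>
            (Cohen_Macaulay_ring (semigroup_ring P :: ((real \<times> real) \<Rightarrow>\<^sub>0 'k::field) ring) \<longleftrightarrow>
               U \<union> U' \<union> U'' \<subseteq> P))"
proof -
  let ?R = "semigroup_ring P :: ((real \<times> real) \<Rightarrow>\<^sub>0 'k) ring"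
  have conv: "convex F" and comp: "compact F"
    using polytope_imp_convex[OF polygon(1)] polytope_imp_compact[OF polygon(1)] by blast+
  have int: "interior F \<noteq> {}" by (rule planar_polytope_interior[OF polygon(1,2) not_segment])
  have N1: "n1 \<in> P" "n1 \<in> \<tau>1" "n1 \<noteq> 0" and least1: "\<And>x. x \<in> P \<Longrightarrow> x \<in> \<tau>1 \<Longrightarrow> x \<noteq> 0 \<Longrightarrow> norm n1 \<le> norm x"
    using n1 unfolding is_arg_min_def by (auto simp: not_less)
  have N2: "n2 \<in> P" "n2 \<in> \<tau>2" "n2 \<noteq> 0" and least2: "\<And>x. x \<in> P \<Longrightarrow> x \<in> \<tau>2 \<Longrightarrow> x \<noteq> 0 \<Longrightarrow> norm n2 \<le> norm x"
    using n2 unfolding is_arg_min_def by (auto simp: not_less)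
  have ray1: "\<tau>1 = {t *\<^sub>R n1 | t. 0 \<le> t}" by (rule extremal_ray_eq[OF rays(1) N1(2,3)])
  have ray2: "\<tau>2 = {t *\<^sub>R n2 | t. 0 \<le> t}" by (rule extremal_ray_eq[OF rays(2) N2(2,3)])
  note cone = polygon_coneI[OF conv int polygon(3) P C rays N1 N2]
  note pos = cone(2)
  interpret polygon_cone F n1 n2 by (rule cone(1))
  obtain G where G: "finite G" "P = generated_semigroup G"
    using simplicial unfolding simplicial_affine_def by blast
  obtain B' where B': "finite B'" "B' \<subseteq> P" "\<forall>p\<in>P. \<exists>b\<in>B'. \<exists>i j::nat. p = b + real i *\<^sub>R n1 + real j *\<^sub>R n2"
    using P_apery[OF pos G(1)] G(2) unfolding P by blast
  interpret simplicial_semigroup P n1 n2 B'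
  proof
    show "0 \<in> P" "\<And>x y. x \<in> P \<Longrightarrow> y \<in> P \<Longrightarrow> x + y \<in> P" using P_zero P_add unfolding P by blast+
    show "P \<subseteq> nat_plane" using P_lattice unfolding P .
    show "n1 \<in> P" "n2 \<in> P" by (rule N1 N2)+
    show "0 < cross2 n2 n1" by (rule pos)
    show "finite B'" "B' \<subseteq> P" by (rule B')+
    show "\<exists>b\<in>B'. \<exists>i j::nat. p = b + real i *\<^sub>R n1 + real j *\<^sub>R n2" if "p \<in> P" for p
      using B'(3) that by blast
    fix p assume p: "p \<in> P"
    then obtain a b :: nat where "cross2 n2 p = real a" "cross2 p n1 = real b"
      using polygon_cone.cross2_nat[OF polygon_cone_axioms pos, of p] unfolding P by blast
    then show "0 \<le> cross2 p n1" "0 \<le> cross2 n2 p" by simp_all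
    show "\<exists>p'\<in>P. \<exists>i j::nat. p + p' = real i *\<^sub>R n1 + real j *\<^sub>R n2"
      using P_completion[OF pos, of p] p unfolding P by blast
  qed
  have CM: "Cohen_Macaulay_ring ?R \<longleftrightarrow> gap_criterion"
    using Cohen_Macaulay_iff_gap_criterion[where ?'k = 'k] unfolding gap_criterion_def P .
  have first: "gap_criterion \<longleftrightarrow> P \<inter> \<tau>1 = {real l *\<^sub>R n1 | l. True} \<and> P \<inter> \<tau>2 = {real l *\<^sub>R n2 | l. True}"
    if "C - (\<tau>1 \<union> \<tau>2) = P - (\<tau>1 \<union> \<tau>2)"
    using gap_criterion_equal_interiors[OF that[unfolded ray1 ray2 P] C[unfolded P]] least1 least2
    unfolding ray1 ray2 P by blast
  have c1: "corner F (A ! 0) (last A) (A ! 1) \<and> (\<exists>m>0. n1 = real m *\<^sub>R (A ! 0))"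
    if "\<not> nondegenerate_segment (F \<inter> \<tau>1)"
    by (rule corner_ray1[OF comp pos A(1)]) (use ray1_section[OF comp] that A(2) in \<open>simp add: ray1\<close>)
  have c2: "corner F (B ! 0) (B ! 1) (last B) \<and> (\<exists>m>0. n2 = real m *\<^sub>R (B ! 0))"
    if "\<not> nondegenerate_segment (F \<inter> \<tau>2)"
    by (rule corner_ray2[OF comp pos B(1)]) (use ray2_section[OF comp] that B(2) in \<open>simp add: ray2\<close>)
  have second: "gap_criterion \<longleftrightarrow> U \<union> U' \<union> U'' \<subseteq> P"
    unfolding P
  proof (rule gap_criterion_iff_regions[OF _ _ _ _ _ _ _ Q U])
    show "\<not> (nondegenerate_segment (F \<inter> {t *\<^sub>R n1 | t. 0 \<le> t}) \<and> nondegenerate_segment (F \<inter> {t *\<^sub>R n2 | t. 0 \<le> t}))"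
      using not_both unfolding ray1 ray2 .
    show "U' = {X \<in> Upsilon1 F \<tau>1 \<tau>2 n1 A \<inter> nat_plane. X + n1 \<in> polygonal_semigroup F \<and> X + n2 \<in> polygonal_semigroup F}"
      using U' unfolding P .
    show "U'' = {X \<in> Upsilon2 F \<tau>1 \<tau>2 n2 B \<inter> nat_plane. X + n1 \<in> polygonal_semigroup F \<and> X + n2 \<in> polygonal_semigroup F}"
      using U'' unfolding P .
  qed (use c1 c2 in \<open>auto simp: nu1_def nu2_def Upsilon1_def Upsilon2_def ray1 ray2\<close>)
  show ?thesis using CM first second by blast
qed

end
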